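(* Suppose $k\geq t+2\geq 4$ and $n\geq t+\max\{15(t+2)^2(k-t),\,10k^2\}$. Let $\mathcal{F},\mathcal{G}\subseteq\binom{[n]}{k}$ be cross $t$-intersecting families with $|\cap\mathcal{F}|<t$ and $|\cap\mathcal{G}|<t$. The following hold. (i) If $k\geq 2t+2$, then $|\mathcal{F}||\mathcal{G}|\leq|\mathcal{H}(n,k,t)|^2$, with equality if and only if $\mathcal{F}=\mathcal{H}(X,K,L)$ and $\mathcal{G}=\mathcal{H}(X,L,K)$ for some $X\in\binom{[n]}{t}$ and $K,L\in\binom{[n]}{k+1}$ with $X\subseteq K\cap L$ and $|K\cap L|\geq t+2$. (ii) If $k\leq 2t+1$, then $|\mathcal{F}||\mathcal{G}|\leq|\mathcal{A}(n,k,t)|^2$, with equality if and only if $\mathcal{F}=\mathcal{G}=\mathcal{A}(Z)$ for some $Z\in\binom{[n]}{t+2}$.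
   Context: $n,k,t$ are positive integers, $[n]=\{1,\dots,n\}$, $[i,j]=\{i,i+1,\dots,j\}$, and $\binom{[n]}{k}$ is the family of all $k$-subsets of $[n]$. For a family $\mathcal{F}$ of sets, $\cap\mathcal{F}$ denotes the intersection of all its members. Families $\mathcal{F},\mathcal{G}$ are cross $t$-intersecting if $|F\cap G|\ge t$ for all $F\in\mathcal{F}$, $G\in\mathcal{G}$. For $Z\in\binom{[n]}{t+2}$, $\mathcal{A}(Z)=\{F\in\binom{[n]}{k}:|F\cap Z|\geq t+1\}$, and $\mathcal{A}(n,k,t)=\mathcal{A}([t+2])$. For $X\in\binom{[n]}{t}$ and $K,L\in\binom{[n]}{k+1}$ with $X\subseteq K\cap L$, $$\mathcal{H}(X,K,L)=\left\{F\in\binom{[n]}{k}:X\subseteq F,\ F\cap(L\setminus X)\neq\emptyset\right\}\cup\{K\setminus\{x\}:x\in X\},$$ and $\mathcal{H}(n,k,t)=\mathcal{H}([t],[k+1],[k+1])=\{F\in\binom{[n]}{k}:[t]\subseteq F,\ F\cap[t+1,k+1]\neq\emptyset\}\cup\{[k+1]\setminus\{i\}:i\in[t]\}$. *)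

theory Defs
  imports Main "HOL-Library.Ramsey"
begin

text \<open>
  The \<open>k\<close>-subsets of \<open>[n]\<close> are written \<^term>\<open>nsets {1..n} k\<close>, with \<^const>\<open>nsets\<close> from
  Ramsey theory.
\<close>

definition cross_intersecting :: "nat \<Rightarrow> 'a set set \<Rightarrow> 'a set set \<Rightarrow> bool" where
  "cross_intersecting t \<F> \<G> \<longleftrightarrow> (\<forall>F\<in>\<F>. \<forall>G\<in>\<G>. t \<le> card (F \<inter> G))"

text \<open>
  The intersection of a family of subsets of \<open>[n]\<close>. It is taken relative to \<open>[n]\<close>, so that the
  empty family has intersection \<open>[n]\<close>; the absolute intersection would be the infinite set
  \<^const>\<open>UNIV\<close>, whose \<^const>\<open>card\<close> is \<open>0\<close>. For nonempty families the two agree.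
\<close>

definition common_part :: "nat \<Rightarrow> nat set set \<Rightarrow> nat set" where
  "common_part n \<F> = {1..n} \<inter> \<Inter>\<F>"

lemma common_part_eq_Inter:
  assumes "\<F> \<subseteq> Pow {1..n}" "\<F> \<noteq> {}"
  shows "common_part n \<F> = \<Inter>\<F>"
  using assms unfolding common_part_def by blast

definition A_family :: "nat \<Rightarrow> nat \<Rightarrow> nat \<Rightarrow> nat set \<Rightarrow> nat set set" where
  "A_family n k t Z = {F \<in> nsets {1..n} k. t + 1 \<le> card (F \<inter> Z)}"

definition A_std :: "nat \<Rightarrow> nat \<Rightarrow> nat \<Rightarrow> nat set set" where
  "A_std n k t = A_family n k t {1..t + 2}"

definition H_family :: "nat \<Rightarrow> nat \<Rightarrow> nat set \<Rightarrow> nat set \<Rightarrow> nat set \<Rightarrow> nat set set" where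
  "H_family n k X K L =
     {F \<in> nsets {1..n} k. X \<subseteq> F \<and> F \<inter> (L - X) \<noteq> {}} \<union> {K - {x} | x. x \<in> X}"

definition H_std :: "nat \<Rightarrow> nat \<Rightarrow> nat \<Rightarrow> nat set set" where
  "H_std n k t = H_family n k {1..t} {1..k + 1} {1..k + 1}"

lemma H_std_eq:
  "H_std n k t =
     {F \<in> nsets {1..n} k. {1..t} \<subseteq> F \<and> F \<inter> {t + 1..k + 1} \<noteq> {}} \<union> {{1..k + 1} - {i} | i. i \<in> {1..t}}"
proof -
  have "{1..k + 1} - {1..t} = {t + 1..k + 1}"
    by auto
  then show ?thesis
    unfolding H_std_def H_family_def by simp
qed

end

(*
  Replacing the pair by a maximal one, G consists of all k-sets meeting every member of F in at
  least t points, and vice versa. Put m = k - t + 1 and let B be the number of k-sets containing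
  a given (t + 1)-set; since n is large, every further prescribed element costs a factor
  eps = (k - t) / (n - t). Non-triviality means that neither family has a t-cover of size t, where
  a t-cover of F is a set meeting all members of F in at least t points. The t-covers of F of
  size t + 1 ("generators") produce the main part of G, at most B sets each.

  A branching argument with binomial(k, t) starting points is too lossy for polynomial n.
  Instead, both families are split according to their traces A, B on one small t-cover W. By a
  product bound for cross l-intersecting links, classes with traces A and B have sizes whose
  product is bounded by C eta^|A - B| eta^|B - A|, and such a kernel tensorizes over the points
  of W: the product of the total sizes is at most C (1 + eta)^(2 |W|). This settles all cases in
  which one family has no generators, and, applied to the part of G without generators, most of
  the error terms.

  If both families have generators, these form cross t-intersecting families of (t + 1)-sets.
  Either some t-set X lies in at least three generators of each family, and then the families
  are contained in some H(X, K, L) and H(X, L, K), or one of them loses almost B sets; or the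
  generators of each family are the (t + 1)-subsets of one (t + 2)-set Z, and both families are
  A(Z); or there are too few generators.
*)

theory Submission
  imports Defs Complex_Main
begin

section \<open>Covers and branching\<close>

text \<open>The lower bounds on \<open>n\<close> enter mainly as
  \<open>15 * (t + 2)^2 * eps <= 1\<close> and \<open>10 * k^2 * eps <= m - 1\<close>. With B =
  \<open>b (t + 1)\<close>, the first keeps the square of \<open>card_A\<close> within 2/15 B^2 of
  ((t + 2) B)^2, the second keeps the square of \<open>card_H\<close> above 9/10 of (m B)^2. A case
  that is clearly not extremal is compared with 0.9 \<open>leading_deg\<close>^2 B^2; only the close
  ones need the sharper forms.

  The obstacle is that only products can be bounded: either family may be large when the other is
  small, so a loss in one bound has to be charged to a gain in the other. The kernel does this for
  pairs of traces. Its weight \<eta> = 2 / (3 (t + 2)) is a compromise: (1 + \<eta>)^(2 (t + 2))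
  stays below exp (4/3) for every t, while eps / \<eta> is still at most 1/40. Members without
  generators are few because they can be branched twice from a t-set, one factor m * eps more than
  arbitrary members.\<close>

definition up :: "'a set set \<Rightarrow> 'a set \<Rightarrow> 'a set set" where
  "up \<F> T = {F \<in> \<F>. T \<subseteq> F}"

definition trace :: "'a set set \<Rightarrow> 'a set \<Rightarrow> 'a set \<Rightarrow> 'a set set" where
  "trace \<F> W A = {F \<in> \<F>. F \<inter> W = A}"

definition t_cover :: "nat \<Rightarrow> 'a set set \<Rightarrow> 'a set \<Rightarrow> bool" where
  "t_cover t \<F> T \<longleftrightarrow> (\<forall>F\<in>\<F>. t \<le> card (F \<inter> T))"

text \<open>One branching step: the members containing T are distributed over the at most m sets
  \<open>insert y T\<close> with y in Y. Disjointness from T makes each of these exactly one point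
  larger.\<close>

definition extends_by :: "nat \<Rightarrow> 'a set set \<Rightarrow> 'a set \<Rightarrow> bool" where
  "extends_by m \<G> T \<longleftrightarrow> (\<exists>Y. finite Y \<and> card Y \<le> m \<and> Y \<inter> T = {} \<and> (\<forall>G\<in>up \<G> T. G \<inter> Y \<noteq> {}))"

lemma finite_nsets_subset: "\<F> \<subseteq> nsets {1..n::nat} k \<Longrightarrow> finite \<F>"
  using finite_subset finite_imp_finite_nsets by blast

lemma up_subset: "up \<F> T \<subseteq> \<F>"
  by (auto simp: up_def)

lemma trace_subset: "trace \<F> W A \<subseteq> \<F>"
  by (auto simp: trace_def)

lemma cross_intersecting_sym: "cross_intersecting t \<F> \<G> \<Longrightarrow> cross_intersecting t \<G> \<F>"
  unfolding cross_intersecting_def by (metis Int_commute)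

lemma cross_intersecting_mono:
  "cross_intersecting t \<F> \<G> \<Longrightarrow> \<F>' \<subseteq> \<F> \<Longrightarrow> \<G>' \<subseteq> \<G> \<Longrightarrow> cross_intersecting t \<F>' \<G>'"
  by (auto simp: cross_intersecting_def)

lemma extends_by_mono: "extends_by m \<G> T \<Longrightarrow> \<G>' \<subseteq> \<G> \<Longrightarrow> extends_by m \<G>' T"
  unfolding extends_by_def up_def by (smt (verit) mem_Collect_eq subsetD)

lemma extends_by_empty: "up \<G> T = {} \<Longrightarrow> extends_by m \<G> T"
  unfolding extends_by_def by (rule exI[of _ "{}"]) auto

lemma card_nsets_superset:
  assumes "T \<subseteq> A" "finite A" "card T \<le> k"
  shows "card {F \<in> nsets A k. T \<subseteq> F} = (card A - card T) choose (k - card T)"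
proof -
  have fT: "finite T" using assms finite_subset by blast
  have "bij_betw (\<lambda>F. F - T) {F \<in> nsets A k. T \<subseteq> F} (nsets (A - T) (k - card T))"
  proof (rule bij_betw_byWitness[where f' = "\<lambda>F. F \<union> T"])
    show "\<forall>F\<in>{F \<in> nsets A k. T \<subseteq> F}. F - T \<union> T = F" by auto
    show "\<forall>F\<in>nsets (A - T) (k - card T). F \<union> T - T = F" by (auto simp: nsets_def)
    show "(\<lambda>F. F - T) ` {F \<in> nsets A k. T \<subseteq> F} \<subseteq> nsets (A - T) (k - card T)"
      using fT by (auto simp: nsets_def card_Diff_subset)
    show "(\<lambda>F. F \<union> T) ` nsets (A - T) (k - card T) \<subseteq> {F \<in> nsets A k. T \<subseteq> F}"
    proof clarsimp
      fix F assume F: "F \<in> nsets (A - T) (k - card T)"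
      then have "F \<inter> T = {}" "finite F" "card F = k - card T" "F \<subseteq> A"
        by (auto simp: nsets_def)
      with fT assms show "F \<union> T \<in> nsets A k"
        by (auto simp: nsets_def card_Un_disjoint)
    qed
  qed
  then have "card {F \<in> nsets A k. T \<subseteq> F} = card (nsets (A - T) (k - card T))"
    by (rule bij_betw_same_card)
  also have "\<dots> = (card A - card T) choose (k - card T)"
    using assms fT by (simp add: card_nsets card_Diff_subset)
  finally show ?thesis .
qed

lemma card_UN_le_mult:
  assumes "finite I" "\<And>i. i \<in> I \<Longrightarrow> real (card (A i)) \<le> c"
  shows "real (card (\<Union>i\<in>I. A i)) \<le> real (card I) * c"
proof -
  have "real (card (\<Union>i\<in>I. A i)) \<le> (\<Sum>i\<in>I. real (card (A i)))"
    using card_UN_le[OF assms(1), of A] by (metis of_nat_le_iff of_nat_sum)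
  also have "\<dots> \<le> (\<Sum>i\<in>I. c)"
    by (rule sum_mono) (rule assms(2))
  finally show ?thesis by simp
qed

text \<open>Pascal's rule writes the coefficient as a sum of two entries of the row N - 1. The saved
  factor 2 turns the constant in \<open>card_mult_traces_le\<close> into 4 ^ (l - 1), which is 1 for
  l = 1.\<close>

lemma binomial_le_half_pow2: "1 \<le> N \<Longrightarrow> N choose r \<le> 2 ^ (N - 1)"
proof -
  assume "1 \<le> N"
  then obtain M where N: "N = Suc M" by (cases N) auto
  show ?thesis
  proof (cases r)
    case 0
    then show ?thesis by simp
  next
    case (Suc s)
    have "(M choose s) + (M choose Suc s) \<le> 2 ^ M"
    proof -
      have "(M choose s) + (M choose Suc s) = (\<Sum>i\<in>{s, Suc s}. M choose i)" by simp
      also have "\<dots> \<le> (\<Sum>i\<in>{..M} \<union> {s, Suc s}. M choose i)"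
        by (rule sum_mono2) auto
      also have "\<dots> = (\<Sum>i\<le>M. M choose i)"
        by (rule sum.mono_neutral_right) (auto simp: binomial_eq_0)
      also have "\<dots> = 2 ^ M" by (rule choose_row_sum)
      finally show ?thesis .
    qed
    then show ?thesis using N Suc by simp
  qed
qed

text \<open>Bounding the diagonal products p = x y and q = x' y' separately would cost a factor 2.
  But p q = (x y') (x' y) \<le> \<eta>^2 K^2, so they are not both near K: (K - p) (K - q) \<ge> 0
  gives p + q \<le> K + p q / K \<le> (1 + \<eta>^2) K.\<close>

lemma two_by_two_bound:
  fixes x x' y y' K \<eta> :: real
  assumes "0 \<le> x" "0 \<le> x'" "0 \<le> y" "0 \<le> y'" "0 \<le> K" "0 \<le> \<eta>"
    and "x * y \<le> K" "x' * y' \<le> K" "x * y' \<le> \<eta> * K" "x' * y \<le> \<eta> * K"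
  shows "(x + x') * (y + y') \<le> K * (1 + \<eta>)\<^sup>2"
proof (cases "K = 0")
  case True
  then show ?thesis using assms by (simp add: algebra_simps)
next
  case False
  then have K: "0 < K" using assms by simp
  have "(x * y) * (x' * y') = (x * y') * (x' * y)" by simp
  also have "\<dots> \<le> (\<eta> * K) * (\<eta> * K)"
    by (rule mult_mono) (use assms in auto)
  finally have pq: "(x * y) * (x' * y') \<le> \<eta>\<^sup>2 * K * K" by (simp add: power2_eq_square algebra_simps)
  have "0 \<le> (K - x * y) * (K - x' * y')" using assms by simp
  then have "K * (x * y + x' * y') \<le> K * K + (x * y) * (x' * y')" by (simp add: algebra_simps)
  also have "\<dots> \<le> K * (K + \<eta>\<^sup>2 * K)" using pq by (simp add: algebra_simps)
  finally have "x * y + x' * y' \<le> K + \<eta>\<^sup>2 * K" using K by simp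
  then show ?thesis using assms by (simp add: power2_eq_square algebra_simps)
qed

text \<open>Induction on W. A point w splits each sum in two according to whether w lies in the
  trace; the four products satisfy the hypothesis with C if w lies in both traces or in neither, and
  with \<eta> C otherwise. \<open>two_by_two_bound\<close> then charges (1 + \<eta>)^2 for
  w.\<close>

lemma trace_kernel_bound:
  fixes f g :: "'a set \<Rightarrow> real"
  assumes "finite W" "0 \<le> \<eta>"
    and "\<And>A. 0 \<le> f A" "\<And>A. 0 \<le> g A" "0 \<le> C"
    and "\<And>A B. A \<subseteq> W \<Longrightarrow> B \<subseteq> W \<Longrightarrow> f A * g B \<le> C * \<eta> ^ (card (A - B) + card (B - A))"
  shows "(\<Sum>A\<in>Pow W. f A) * (\<Sum>B\<in>Pow W. g B) \<le> C * (1 + \<eta>) ^ (2 * card W)"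
  using assms
proof (induction W arbitrary: f g C rule: finite_induct)
  case empty
  then show ?case using empty.prems(5)[of "{}" "{}"] by simp
next
  case (insert w W)
  define f1 g1 where "f1 A = f (insert w A)" and "g1 A = g (insert w A)" for A
  have split: "(\<Sum>A\<in>Pow (insert w W). h A) = (\<Sum>A\<in>Pow W. h (insert w A)) + (\<Sum>A\<in>Pow W. h A)"
    for h :: "'a set \<Rightarrow> real"
  proof -
    have "inj_on (insert w) (Pow W)" using insert.hyps
      by (auto simp: inj_on_def)
    moreover have "Pow W \<inter> insert w ` Pow W = {}" using insert.hyps by auto
    ultimately show ?thesis using insert.hyps
      by (simp add: Pow_insert sum.union_disjoint sum.reindex)
  qed
  let ?K = "C * (1 + \<eta>) ^ (2 * card W)"
  note bnd = insert.prems(5)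
  have D: "insert w A - insert w B = A - B" "A - insert w B = A - B" "insert w A - B = insert w (A - B)"
    if "A \<subseteq> W" "B \<subseteq> W" for A B using that insert.hyps by auto
  have Dc: "card (insert w (A - B)) = Suc (card (A - B))" if "A \<subseteq> W" for A B
    using that insert.hyps by (subst card_insert_disjoint) (auto intro: finite_subset)
  have k11: "sum f1 (Pow W) * sum g1 (Pow W) \<le> ?K"
  proof (rule insert.IH)
    fix A B assume "A \<subseteq> W" "B \<subseteq> W"
    then show "f1 A * g1 B \<le> C * \<eta> ^ (card (A - B) + card (B - A))"
      using bnd[of "insert w A" "insert w B"] by (auto simp: f1_def g1_def D)
  qed (use insert.prems in \<open>auto simp: f1_def g1_def\<close>)
  have k00: "sum f (Pow W) * sum g (Pow W) \<le> ?K"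
  proof (rule insert.IH)
    fix A B assume "A \<subseteq> W" "B \<subseteq> W"
    then show "f A * g B \<le> C * \<eta> ^ (card (A - B) + card (B - A))"
      using bnd[of A B] by auto
  qed (use insert.prems in auto)
  have k10: "sum f1 (Pow W) * sum g (Pow W) \<le> (\<eta> * C) * (1 + \<eta>) ^ (2 * card W)"
  proof (rule insert.IH)
    fix A B assume "A \<subseteq> W" "B \<subseteq> W"
    then show "f1 A * g B \<le> \<eta> * C * \<eta> ^ (card (A - B) + card (B - A))"
      using bnd[of "insert w A" B] by (auto simp: f1_def D Dc algebra_simps)
  qed (use insert.prems in \<open>auto simp: f1_def\<close>)
  have k01: "sum f (Pow W) * sum g1 (Pow W) \<le> (\<eta> * C) * (1 + \<eta>) ^ (2 * card W)"
  proof (rule insert.IH)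
    fix A B assume "A \<subseteq> W" "B \<subseteq> W"
    then show "f A * g1 B \<le> \<eta> * C * \<eta> ^ (card (A - B) + card (B - A))"
      using bnd[of A "insert w B"] by (auto simp: g1_def D Dc algebra_simps)
  qed (use insert.prems in \<open>auto simp: g1_def\<close>)
  have "(sum f1 (Pow W) + sum f (Pow W)) * (sum g1 (Pow W) + sum g (Pow W)) \<le> ?K * (1 + \<eta>)\<^sup>2"
    by (rule two_by_two_bound)
      (use k11 k00 k10 k01 insert.prems in \<open>auto simp: f1_def g1_def mult.assoc intro!: sum_nonneg\<close>)
  also have "\<dots> = C * (1 + \<eta>) ^ (2 * card (insert w W))"
    using insert.hyps by (simp add: power2_eq_square algebra_simps)
  finally show ?case by (simp add: split f1_def g1_def)
qed

text \<open>
  A member of \<open>\<G>\<close> that contains \<open>T\<close> meets \<open>F\<close> in at least \<open>t - card (F \<inter> T)\<close> points outside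
  \<open>T\<close>, hence meets every subset of \<open>F - T\<close> of size \<open>k - t + 1\<close>.
\<close>

lemma extends_by_if_not_cover:
  assumes "cross_intersecting t \<F> \<G>" "\<F> \<subseteq> nsets V k" "\<not> t_cover t \<F> T" "t \<le> k"
  shows "extends_by (k - t + 1) \<G> T"
proof -
  obtain F where F: "F \<in> \<F>" "card (F \<inter> T) < t"
    using assms(3) by (auto simp: t_cover_def not_le)
  then have kF: "finite F" "card F = k" using assms(2) by (auto simp: nsets_def)
  have cFT: "card (F - T) = k - card (F \<inter> T)"
    using kF by (metis card_Diff_subset_Int finite_Int)
  then obtain Y where Y: "Y \<subseteq> F - T" "card Y = k - t + 1"
    using F(2) assms(4) by (metis Suc_eq_plus1 Suc_diff_le diff_Suc_Suc diff_le_mono2 less_eq_Suc_le obtain_subset_with_card_n)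
  have fY: "finite Y" using Y kF finite_subset by blast
  have "G \<inter> Y \<noteq> {}" if G: "G \<in> up \<G> T" for G
  proof
    assume e: "G \<inter> Y = {}"
    have "t \<le> card (F \<inter> G)" using assms(1) F G by (auto simp: cross_intersecting_def up_def)
    also have "\<dots> \<le> card (F - Y)"
      using e kF by (intro card_mono) auto
    also have "\<dots> = k - (k - t + 1)"
      using Y fY kF by (subst card_Diff_subset) auto
    finally show False using F(2) assms(4) by linarith
  qed
  moreover have "Y \<inter> T = {}" using Y(1) by auto
  ultimately show ?thesis unfolding extends_by_def using Y(2) fY by (intro exI[of _ Y]) simp
qed

section \<open>Parameters, degrees and iterated branching\<close>

locale params =
  fixes n k t :: nat
  assumes kt: "t + 2 \<le> k" and t2: "2 \<le> t"
    and n_ge: "t + max (15 * (t + 2)\<^sup>2 * (k - t)) (10 * k\<^sup>2) \<le> n"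
begin

text \<open>Removing m points from a k-set leaves t - 1, so a set sharing t points with it meets
  each of its m-subsets; this is the branching width. It is also the size of \<open>L - X\<close> in
  \<open>H_family\<close>.\<close>

definition m :: nat where "m = k - t + 1"

definition eps :: real where "eps = real (k - t) / real (n - t)"

text \<open>
  The number of \<open>k\<close>-subsets of \<open>{1..n}\<close> containing a given \<open>s\<close>-set. For \<open>s > k\<close>
  the binomial coefficient with its truncated subtractions would be \<open>1\<close> instead of \<open>0\<close>.
\<close>

definition b :: "nat \<Rightarrow> real" where
  "b s = (if s \<le> k then real ((n - s) choose (k - s)) else 0)"

lemma m_real: "real m = real k - real t + 1"
  using kt by (simp add: m_def)

lemma m_ge: "3 \<le> m"
  using kt by (simp add: m_def)

lemma n_ge1: "15 * (t + 2)\<^sup>2 * (k - t) \<le> n - t" and n_ge2: "10 * k\<^sup>2 \<le> n - t"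
  using n_ge by auto

lemma k_ge4: "4 \<le> k" using kt t2 by simp

lemma ten_k_le: "10 * k \<le> n - t"
proof -
  have "10 * k \<le> 10 * k\<^sup>2" using k_ge4 by (simp add: power2_eq_square)
  with n_ge2 show ?thesis by linarith
qed

lemma nt_pos: "0 < real (n - t)"
  using ten_k_le k_ge4 by linarith

lemma t_less_n: "t < n" "k < n"
  using ten_k_le k_ge4 by linarith+

lemma eps_pos: "0 < eps"
  using nt_pos kt by (simp add: eps_def)

lemma eps_le1: "15 * real (t + 2) ^ 2 * eps \<le> 1"
proof -
  have "real (15 * (t + 2)\<^sup>2 * (k - t)) \<le> real (n - t)" using n_ge1 by (rule of_nat_mono)
  then have "15 * real (t + 2) ^ 2 * real (k - t) \<le> real (n - t)" by simp
  then show ?thesis using nt_pos by (simp add: eps_def divide_simps)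
qed

lemma eps_le2: "10 * real k ^ 2 * eps \<le> real m - 1"
proof -
  have "real (10 * k\<^sup>2) \<le> real (n - t)" using n_ge2 by (rule of_nat_mono)
  then have "10 * real k ^ 2 \<le> real (n - t)" by simp
  then have "10 * real k ^ 2 * real (k - t) \<le> real (n - t) * real (k - t)"
    by (rule mult_right_mono) simp
  then show ?thesis using nt_pos by (simp add: eps_def divide_simps m_def mult.commute)
qed

lemma m_less_k: "m + 1 \<le> k"
  using kt t2 by (simp add: m_def)

lemma m2_eps: "10 * (real m)\<^sup>2 * eps \<le> real m - 1"
proof -
  have "(real m)\<^sup>2 \<le> (real k)\<^sup>2" using m_less_k by (intro power_mono) auto
  then have "10 * (real m)\<^sup>2 * eps \<le> 10 * real k ^ 2 * eps"
    using eps_pos by simp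
  with eps_le2 show ?thesis by linarith
qed

lemma m_eps: "10 * (real m * eps) \<le> 1"
proof -
  have "real m * (10 * (real m * eps)) \<le> real m * 1"
    using m2_eps by (simp add: power2_eq_square algebra_simps)
  then show ?thesis using m_ge by simp
qed

lemma b_nonneg: "0 \<le> b s"
  by (simp add: b_def)

lemma b_step:
  assumes "s < k"
  shows "b (Suc s) * real (n - s) = real (k - s) * b s"
proof -
  obtain r where r: "k - s = Suc r" using assms by (metis Suc_diff_Suc)
  obtain N where N: "n - s = Suc N" using assms t_less_n by (metis Suc_diff_Suc less_trans)
  have e: "n - Suc s = N" "k - Suc s = r" using r N by auto
  have "Suc r * (Suc N choose Suc r) = Suc N * (N choose r)"
    by (rule Suc_times_binomial)
  then have "real (Suc r) * real (Suc N choose Suc r) = real (Suc N) * real (N choose r)"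
    by (metis of_nat_mult)
  then show ?thesis using assms by (simp only: b_def e r N) (simp add: mult.commute)
qed

text \<open>The ratio (k - s) / (n - s) of consecutive degrees decreases in s because k < n, so its
  value \<open>eps\<close> at s = t bounds all later ones.\<close>

lemma b_Suc_le:
  assumes "t \<le> s"
  shows "b (Suc s) \<le> eps * b s"
proof (cases "s < k")
  case True
  have pos: "0 < real (n - s)" using True t_less_n by simp
  have "b (Suc s) = real (k - s) * b s / real (n - s)"
    using b_step[OF True] pos by (simp add: field_simps)
  also have "\<dots> = (real (k - s) / real (n - s)) * b s" by simp
  also have "real (k - s) / real (n - s) \<le> eps"
  proof -
    have "(real k - real s) * (real n - real t) \<le> (real k - real t) * (real n - real s)"
    proof -
      have "0 \<le> (real s - real t) * (real n - real k)" using assms t_less_n by simp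
      then show ?thesis by (simp add: algebra_simps)
    qed
    moreover have "real (k - s) = real k - real s" "real (n - s) = real n - real s"
      "real (k - t) = real k - real t" "real (n - t) = real n - real t"
      using True assms t_less_n by auto
    ultimately show ?thesis using pos nt_pos by (simp add: eps_def divide_simps mult.commute)
  qed
  finally show ?thesis using b_nonneg by (simp add: mult_right_mono)
next
  case False
  then show ?thesis using eps_pos b_nonneg[of s] by (simp add: b_def)
qed

lemma b_t1: "b (t + 1) = eps * b t"
  using b_step[of t] kt nt_pos by (simp add: eps_def field_simps)

lemma b_add_le: "t \<le> s \<Longrightarrow> b (s + j) \<le> eps ^ j * b s"
proof (induction j)
  case (Suc j)
  have "b (s + Suc j) \<le> eps * b (s + j)" using b_Suc_le[of "s + j"] Suc.prems by simp
  also have "\<dots> \<le> eps * (eps ^ j * b s)" using Suc eps_pos by (intro mult_left_mono) auto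
  finally show ?case by simp
qed simp

lemma b_pos: "s \<le> k \<Longrightarrow> 0 < b s"
  using t_less_n by (simp add: b_def zero_less_binomial)

lemma card_up_le:
  assumes "\<F> \<subseteq> nsets {1..n} k" "finite T"
  shows "real (card (up \<F> T)) \<le> b (card T)"
proof (cases "up \<F> T = {}")
  case True
  then show ?thesis using b_nonneg by simp
next
  case False
  then obtain F where F: "F \<in> \<F>" "T \<subseteq> F" by (auto simp: up_def)
  then have Fk: "F \<subseteq> {1..n}" "finite F" "card F = k" using assms by (auto simp: nsets_def)
  then have T: "T \<subseteq> {1..n}" "card T \<le> k" using F card_mono[of F T] by auto
  have "card (up \<F> T) \<le> card {F \<in> nsets {1..n} k. T \<subseteq> F}"
    using assms by (intro card_mono) (auto simp: up_def finite_imp_finite_nsets)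
  also have "\<dots> = (n - card T) choose (k - card T)"
    using T by (subst card_nsets_superset) auto
  finally show ?thesis using T by (simp add: b_def)
qed

text \<open>Each of the j steps replaces a set by at most m sets with one more point. The at most
  m^j sets reached have card T + j points and are counted by \<open>card_up_le\<close>.\<close>

lemma card_up_rec:
  assumes "\<G> \<subseteq> nsets {1..n} k" "finite T"
    and "\<And>T'. T \<subseteq> T' \<Longrightarrow> finite T' \<Longrightarrow> card T' < card T + j \<Longrightarrow> extends_by m \<G> T'"
  shows "real (card (up \<G> T)) \<le> real m ^ j * b (card T + j)"
  using assms(2,3)
proof (induction j arbitrary: T)
  case 0
  then show ?case using card_up_le[OF assms(1)] by simp
next
  case (Suc j)
  then obtain Y where Y: "finite Y" "card Y \<le> m" "Y \<inter> T = {}" "\<And>G. G\<in>up \<G> T \<Longrightarrow> G \<inter> Y \<noteq> {}"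
    using Suc.prems(2)[of T] Suc.prems(1) unfolding extends_by_def by (metis add_Suc_right less_add_Suc1 order_refl)
  have sub: "up \<G> T \<subseteq> (\<Union>y\<in>Y. up \<G> (insert y T))"
    using Y(4) by (fastforce simp: up_def)
  have each: "real (card (up \<G> (insert y T))) \<le> real m ^ j * b (card T + Suc j)" if "y \<in> Y" for y
  proof -
    have "y \<notin> T" using Y(3) that by auto
    then have c: "card (insert y T) = Suc (card T)" using Suc.prems(1) by simp
    have "real (card (up \<G> (insert y T))) \<le> real m ^ j * b (card (insert y T) + j)"
      by (rule Suc.IH) (use Suc.prems c in auto)
    then show ?thesis using c by simp
  qed
  have "finite (\<Union>y\<in>Y. up \<G> (insert y T))"
    using Y(1) finite_nsets_subset[OF assms(1)] finite_subset[OF up_subset] by blast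
  then have "real (card (up \<G> T)) \<le> real (card (\<Union>y\<in>Y. up \<G> (insert y T)))"
    using sub by (simp add: card_mono)
  also have "\<dots> \<le> real (card Y) * (real m ^ j * b (card T + Suc j))"
    by (rule card_UN_le_mult[OF Y(1) each])
  also have "\<dots> \<le> real m * (real m ^ j * b (card T + Suc j))"
    using Y(2) b_nonneg by (intro mult_right_mono) auto
  finally show ?case by simp
qed

end

section \<open>Products of trace classes\<close>

context params
begin

text \<open>The l-subsets of the cover C, joined to A, are the starting points, followed by j
  branching steps. Steps have to be supplied only at sets with trace exactly A: a superset of A with
  a further point of W lies in no member.\<close>

lemma card_traced_le:
  assumes "\<F> \<subseteq> nsets {1..n} k" "finite W" "A \<subseteq> W" "\<And>F. F \<in> \<F> \<Longrightarrow> F \<inter> W = A"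
    and "finite C" "C \<inter> W = {}" "\<And>F. F \<in> \<F> \<Longrightarrow> l \<le> card (F \<inter> C)"
    and ext: "\<And>T. T \<inter> W = A \<Longrightarrow> finite T \<Longrightarrow> card T < card A + l + j \<Longrightarrow> extends_by m \<F> T"
  shows "real (card \<F>) \<le> real (card C choose l) * (real m ^ j * b (card A + l + j))"
proof -
  have fA: "finite A" by (rule finite_subset[OF assms(3,2)])
  have sub: "\<F> \<subseteq> (\<Union>L\<in>nsets C l. up \<F> (A \<union> L))"
  proof
    fix F assume F: "F \<in> \<F>"
    then obtain L where "L \<subseteq> F \<inter> C" "card L = l" "finite L"
      using assms(7) obtain_subset_with_card_n by metis
    moreover have "A \<subseteq> F" using assms(4)[OF F] by auto
    ultimately show "F \<in> (\<Union>L\<in>nsets C l. up \<F> (A \<union> L))"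
      using F by (auto simp: up_def nsets_def)
  qed
  have each: "real (card (up \<F> (A \<union> L))) \<le> real m ^ j * b (card A + l + j)" if L: "L \<in> nsets C l" for L
  proof -
    have fL: "finite L" "A \<inter> L = {}" "card L = l" using L assms by (auto simp: nsets_def)
    then have c: "card (A \<union> L) = card A + l" using fA by (simp add: card_Un_disjoint)
    have "real (card (up \<F> (A \<union> L))) \<le> real m ^ j * b (card (A \<union> L) + j)"
    proof (rule card_up_rec)
      fix T assume T: "A \<union> L \<subseteq> T" "finite T" "card T < card (A \<union> L) + j"
      show "extends_by m \<F> T"
      proof (cases "T \<inter> W = A")
        case True
        then show ?thesis using ext T c by simp
      next
        case False
        have "up \<F> T = {}"
        proof (rule ccontr)
          assume "up \<F> T \<noteq> {}"
          then obtain F where F: "F \<in> \<F>" "T \<subseteq> F" by (auto simp: up_def)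
          then have "T \<inter> W \<subseteq> A" using assms(4)[OF F(1)] by auto
          with T(1) assms(3) False show False by auto
        qed
        then show ?thesis by (rule extends_by_empty)
      qed
    qed (use assms(1) fA fL in auto)
    then show ?thesis using c by simp
  qed
  have fin: "finite (nsets C l)" using assms(5) by (rule finite_imp_finite_nsets)
  have "finite (\<Union>L\<in>nsets C l. up \<F> (A \<union> L))"
    using fin finite_nsets_subset[OF assms(1)] finite_subset[OF up_subset] by blast
  then have "real (card \<F>) \<le> real (card (\<Union>L\<in>nsets C l. up \<F> (A \<union> L)))"
    using sub by (simp add: card_mono)
  also have "\<dots> \<le> real (card (nsets C l)) * (real m ^ j * b (card A + l + j))"
    by (rule card_UN_le_mult[OF fin each])
  finally show ?thesis using assms(5) by (simp add: card_nsets)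
qed

lemma m_eps_nonneg: "0 \<le> real m * eps"
  using eps_pos by simp

lemma two_m_eps_le: "2 * (real m * eps) \<le> 1 / 5"
  using m_eps by linarith

text \<open>
  The proof compares each family with a smallest set outside \<open>W\<close> that meets all members of
  the other family in \<open>l\<close> points: its size bounds from below the number of branching steps, and each
  step costs a factor \<open>m * eps\<close>.
\<close>

lemma card_mult_traces_le:
  assumes "\<F> \<subseteq> nsets {1..n} k" "\<G> \<subseteq> nsets {1..n} k" "cross_intersecting t \<F> \<G>"
    and "finite W" "A \<subseteq> W" "B \<subseteq> W"
    and trF: "\<And>F. F \<in> \<F> \<Longrightarrow> F \<inter> W = A" and trG: "\<And>G. G \<in> \<G> \<Longrightarrow> G \<inter> W = B"
    and l: "card (A \<inter> B) + l = t" "1 \<le> l"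
    and extG: "\<And>T. finite T \<Longrightarrow> card T < t + i \<Longrightarrow> extends_by m \<G> T"
  shows "real (card \<F>) * real (card \<G>)
    \<le> 4 ^ (l - 1) * (2 * (real m * eps)) ^ (i - (card B + l - t)) * (b (card A + l) * b (card B + l))"
proof (cases "\<F> = {} \<or> \<G> = {}")
  case True
  then show ?thesis using m_eps_nonneg b_nonneg by auto
next
  case False
  then obtain F0 G0 where FG0: "F0 \<in> \<F>" "G0 \<in> \<G>" by auto
  have fin: "finite A" "finite B"
    by (rule finite_subset[OF assms(5,4)], rule finite_subset[OF assms(6,4)])
  have finFG: "finite F" "finite G" if "F \<in> \<F>" "G \<in> \<G>" for F G
    using that assms(1,2) by (auto simp: nsets_def)
  have link: "l \<le> card (F \<inter> (G - W))" if FG: "F \<in> \<F>" "G \<in> \<G>" for F G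
  proof -
    have "F \<inter> G \<subseteq> (F \<inter> (G - W)) \<union> (A \<inter> B)" using trF[OF FG(1)] trG[OF FG(2)] by auto
    then have "card (F \<inter> G) \<le> card ((F \<inter> (G - W)) \<union> (A \<inter> B))"
      using finFG[OF FG] fin by (intro card_mono) auto
    also have "\<dots> \<le> card (F \<inter> (G - W)) + card (A \<inter> B)" by (rule card_Un_le)
    finally show ?thesis using assms(3) FG l(1) by (fastforce simp: cross_intersecting_def)
  qed
  \<comment> \<open>Covers are taken outside W, where members of the two families share at least l
    points. Any member of the other family, without W, is such a cover, so smallest ones
    exist.\<close>
  define lc where "lc \<H> C \<longleftrightarrow> finite C \<and> C \<inter> W = {} \<and> (\<forall>H\<in>\<H>. l \<le> card (H \<inter> C))" for \<H> C
  have exF: "lc \<F> (G0 - W)" using link FG0 finFG[OF FG0] by (auto simp: lc_def)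
  have exG: "lc \<G> (F0 - W)"
  proof -
    have "G \<inter> (F0 - W) = F0 \<inter> (G - W)" for G by auto
    then show ?thesis using link FG0 finFG[OF FG0] by (auto simp: lc_def)
  qed
  obtain C where C: "lc \<F> C" "\<And>C'. lc \<F> C' \<Longrightarrow> card C \<le> card C'"
    using ex_has_least_nat[of "lc \<F>" _ card] exF by metis
  obtain D where D: "lc \<G> D" "\<And>D'. lc \<G> D' \<Longrightarrow> card D \<le> card D'"
    using ex_has_least_nat[of "lc \<G>" _ card] exG by metis
  have size: "l \<le> card E" if "lc \<H> E" "H \<in> \<H>" for \<H> E H
    using that card_mono[of E "H \<inter> E"] by (fastforce simp: lc_def)
  \<comment> \<open>The excess sizes are crossed on purpose: a smallest cover D of \<G> makes a'
    branching steps available in \<F>, and a smallest cover C of \<F> makes b' steps available in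
    \<G>.\<close>
  define a' b' where "a' = card D - l" and "b' = card C - l"
  have cC: "card C = l + b'" and cD: "card D = l + a'"
    using size[OF C(1) FG0(1)] size[OF D(1) FG0(2)] by (auto simp: a'_def b'_def)
  define \<beta> where "\<beta> = card B + l - t"
  have cAB: "card (A \<inter> B) \<le> card A" "card (A \<inter> B) \<le> card B"
    using fin by (auto intro: card_mono)
  have \<beta>: "card B + l = t + \<beta>" using cAB l by (auto simp: \<beta>_def)
  have tk: "t \<le> k" using kt by simp
  \<comment> \<open>If the part of T outside W is too small to be a cover of \<H>', some member of
    \<H>' meets it in fewer than l points; inside W that member shares only
    \<open>A' \<inter> A''\<close> with T, so T is no t-cover.\<close>
  have step: "extends_by m \<H> T" if H: "\<H> \<subseteq> nsets {1..n} k" "\<H>' \<subseteq> nsets {1..n} k" "cross_intersecting t \<H> \<H>'"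
      and tr: "\<And>H. H \<in> \<H>' \<Longrightarrow> H \<inter> W = A'" "T \<inter> W = A''" "finite T" "card (A' \<inter> A'') + l = t" "finite A''"
      and no: "\<And>E. lc \<H>' E \<Longrightarrow> l + r \<le> card E" and sz: "card T < card A'' + l + r"
    for \<H> \<H>' T A' A'' r
  proof -
    have "card T = card A'' + card (T - W)"
      using tr(2,3) by (metis card_Diff_subset_Int card_mono finite_Int Int_lower1 le_add_diff_inverse)
    then have "\<not> lc \<H>' (T - W)" using no sz by (metis add.assoc add_less_cancel_left not_le)
    then obtain H where Hh: "H \<in> \<H>'" "card (H \<inter> (T - W)) < l"
      using tr(3) by (auto simp: lc_def not_le)
    have fH: "finite H" using Hh H(2) by (auto simp: nsets_def)
    have "H \<inter> T = (H \<inter> (T - W)) \<union> (A' \<inter> A'')" using tr(1)[OF Hh(1)] tr(2) by auto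
    then have "card (H \<inter> T) \<le> card (H \<inter> (T - W)) + card (A' \<inter> A'')" by (metis card_Un_le)
    then have "card (H \<inter> T) < t" using Hh(2) tr(4) by linarith
    then have "\<not> t_cover t \<H>' T" using Hh(1) by (auto simp: t_cover_def not_le)
    then have "extends_by (k - t + 1) \<H> T"
      by (rule extends_by_if_not_cover[OF cross_intersecting_sym[OF H(3)] H(2) _ tk])
    then show ?thesis by (simp add: m_def)
  qed
  have F: "real (card \<F>) \<le> real (card C choose l) * (real m ^ a' * b (card A + l + a'))"
  proof (rule card_traced_le[OF assms(1,4,5) trF])
    fix T assume T: "T \<inter> W = A" "finite T" "card T < card A + l + a'"
    show "extends_by m \<F> T"
      by (rule step[OF assms(1,2,3) trG T(1,2), of a'])
        (use T(3) l fin D(2) cD in \<open>auto simp: Int_commute\<close>)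
  qed (use C(1) in \<open>auto simp: lc_def\<close>)
  \<comment> \<open>There are two sources of steps from size card B + l = t + \<beta>: minimality of
    C gives b' steps, and \<open>extG\<close> applies below size t + i, which gives i -
    \<beta>.\<close>
  define j where "j = max b' (i - \<beta>)"
  have G: "real (card \<G>) \<le> real (card D choose l) * (real m ^ j * b (card B + l + j))"
  proof (rule card_traced_le[OF assms(2,4,6) trG])
    fix T assume T: "T \<inter> W = B" "finite T" "card T < card B + l + j"
    show "extends_by m \<G> T"
    proof (cases "card T < t + i")
      case True
      then show ?thesis using extG T by simp
    next
      case False
      then have "card T < card B + l + b'" using T(3) \<beta> by (auto simp: j_def max_def split: if_splits)
      then show ?thesis
        by (intro step[OF assms(2,1) cross_intersecting_sym[OF assms(3)] trF T(1,2), of b'])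
          (use l fin C(2) cC in auto)
    qed
  qed (use D(1) in \<open>auto simp: lc_def\<close>)
  let ?x = "real m * eps"
  have x: "0 \<le> ?x" "2 * ?x \<le> 1" using m_eps_nonneg two_m_eps_le by auto
  have F': "real (card \<F>) \<le> (2 ^ (l - 1) * 2 ^ b') * (?x ^ a' * b (card A + l))"
  proof -
    have "real (card C choose l) \<le> real (2 ^ (l + b' - 1))"
      using binomial_le_half_pow2[of "card C" l] cC l(2) by (intro of_nat_mono) simp
    moreover have "l + b' - 1 = (l - 1) + b'" using l(2) by simp
    ultimately have 1: "real (card C choose l) \<le> 2 ^ (l - 1) * 2 ^ b'" by (simp only: of_nat_power of_nat_numeral of_nat_mult power_add)
    have 2: "real m ^ a' * b (card A + l + a') \<le> real m ^ a' * (eps ^ a' * b (card A + l))"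
      using b_add_le[of "card A + l" a'] cAB l(1) by (intro mult_left_mono) auto
    have "real (card C choose l) * (real m ^ a' * b (card A + l + a'))
        \<le> (2 ^ (l - 1) * 2 ^ b') * (real m ^ a' * (eps ^ a' * b (card A + l)))"
      by (rule mult_mono[OF 1 2]) (use b_nonneg in auto)
    with F show ?thesis by (simp add: power_mult_distrib mult.assoc)
  qed
  have G': "real (card \<G>) \<le> (2 ^ (l - 1) * 2 ^ a') * (?x ^ j * b (card B + l))"
  proof -
    have "real (card D choose l) \<le> real (2 ^ (l + a' - 1))"
      using binomial_le_half_pow2[of "card D" l] cD l(2) by (intro of_nat_mono) simp
    moreover have "l + a' - 1 = (l - 1) + a'" using l(2) by simp
    ultimately have 1: "real (card D choose l) \<le> 2 ^ (l - 1) * 2 ^ a'" by (simp only: of_nat_power of_nat_numeral of_nat_mult power_add)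
    have 2: "real m ^ j * b (card B + l + j) \<le> real m ^ j * (eps ^ j * b (card B + l))"
      using b_add_le[of "card B + l" j] cAB l(1) by (intro mult_left_mono) auto
    have "real (card D choose l) * (real m ^ j * b (card B + l + j))
        \<le> (2 ^ (l - 1) * 2 ^ a') * (real m ^ j * (eps ^ j * b (card B + l)))"
      by (rule mult_mono[OF 1 2]) (use b_nonneg in auto)
    with G show ?thesis by (simp add: power_mult_distrib mult.assoc)
  qed
  have p4: "(2::real) ^ (l - 1) * 2 ^ (l - 1) = 4 ^ (l - 1)"
    by (simp flip: power_mult_distrib)
  have "real (card \<F>) * real (card \<G>)
      \<le> ((2 ^ (l - 1) * 2 ^ b') * (?x ^ a' * b (card A + l))) * ((2 ^ (l - 1) * 2 ^ a') * (?x ^ j * b (card B + l)))"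
    by (rule mult_mono[OF F' G']) (use x b_nonneg in auto)
  \<comment> \<open>The starting points of each family are paid for by the steps of the other: 2^b',
    from the choices in C, goes with the j \<ge> b' steps in \<G>, and 2^a', from D, with the a'
    steps in \<F>.\<close>
  also have "\<dots> = 4 ^ (l - 1) * ((2 ^ a' * ?x ^ a') * (2 ^ b' * ?x ^ j)) * (b (card A + l) * b (card B + l))"
    unfolding p4[symmetric] by (simp only: mult_ac)
  also have "\<dots> \<le> 4 ^ (l - 1) * (2 * ?x) ^ (i - \<beta>) * (b (card A + l) * b (card B + l))"
  proof -
    have "2 ^ a' * ?x ^ a' = (2 * ?x) ^ a'" by (simp add: power_mult_distrib)
    also have "\<dots> \<le> 1" using x by (intro power_le_one) auto
    finally have 1: "2 ^ a' * ?x ^ a' \<le> 1" .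
    have "2 ^ b' * ?x ^ j \<le> 2 ^ j * ?x ^ j" using x by (intro mult_right_mono) (auto simp: j_def)
    also have "\<dots> = (2 * ?x) ^ j" by (simp add: power_mult_distrib)
    also have "\<dots> \<le> (2 * ?x) ^ (i - \<beta>)" using x by (intro power_decreasing) (auto simp: j_def)
    finally have 2: "2 ^ b' * ?x ^ j \<le> (2 * ?x) ^ (i - \<beta>)" .
    have "(2 ^ a' * ?x ^ a') * (2 ^ b' * ?x ^ j) \<le> 1 * (2 * ?x) ^ (i - \<beta>)"
      using 1 2 x by (intro mult_mono) auto
    then show ?thesis using b_nonneg by (intro mult_right_mono mult_left_mono) auto
  qed
  finally show ?thesis by (simp add: \<beta>_def)
qed

end

lemma sum_card_traces:
  assumes "finite \<F>" "finite W"
  shows "(\<Sum>A\<in>Pow W. real (card (trace \<F> W A))) = real (card \<F>)"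
proof -
  have "(\<Sum>A\<in>Pow W. real (card (trace \<F> W A))) = (\<Sum>A\<in>Pow W. \<Sum>F\<in>{F \<in> \<F>. F \<inter> W = A}. 1)"
    by (simp add: trace_def)
  also have "\<dots> = (\<Sum>F\<in>\<F>. 1)"
    using assms by (intro sum.group) auto
  finally show ?thesis by simp
qed

text \<open>With truncated subtraction the exponents add up to the maximum of i and j; the excess is
  harmless because y \<le> 1.\<close>

lemma power_mult_power_le:
  fixes p q y :: real
  assumes "0 \<le> p" "0 \<le> q" "p \<le> y" "q \<le> y" "y \<le> 1"
  shows "p ^ (i - j) * q ^ j \<le> y ^ i"
proof -
  have "p ^ (i - j) * q ^ j \<le> y ^ (i - j) * y ^ j"
    using assms by (intro mult_mono power_mono) auto
  also have "\<dots> = y ^ (i - j + j)" by (simp add: power_add)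
  also have "\<dots> \<le> y ^ i" using assms by (intro power_decreasing) auto
  finally show ?thesis .
qed

section \<open>The product bound without small generators\<close>

context params
begin

text \<open>
  Up to lower order terms, the families \<open>H\<close> and \<open>A\<close> have \<open>m * b (t + 1)\<close> and
  \<open>(t + 2) * b (t + 1)\<close> members.
\<close>

definition leading_deg :: real where "leading_deg = max (real m) (real t + 2)"

lemma leading_deg_ge: "real m \<le> leading_deg" "real t + 2 \<le> leading_deg" "4 \<le> leading_deg"
  using t2 by (auto simp: leading_deg_def)

text \<open>One factor t + 2 of \<open>eps_le1\<close> is traded for its lower bound 4, and 60 = 15
  * 4.\<close>

lemma u_eps: "60 * ((real t + 2) * eps) \<le> 1"
proof -
  have "60 * ((real t + 2) * eps) \<le> 15 * (real t + 2) * ((real t + 2) * eps)"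
    using t2 eps_pos by (intro mult_right_mono) auto
  also have "\<dots> = 15 * real (t + 2) ^ 2 * eps" by (simp add: power2_eq_square algebra_simps)
  also have "\<dots> \<le> 1" by (rule eps_le1)
  finally show ?thesis .
qed

lemma u2_eps: "15 * (real t + 2)\<^sup>2 * eps \<le> 1"
  using eps_le1 by (simp add: add.commute)

text \<open>i - q steps lead from size t + q to t + i. For q \<ge> i there are none, and the bound
  is that of \<open>b_add_le\<close>.\<close>

lemma card_up_above:
  assumes "\<G> \<subseteq> nsets {1..n} k" "finite T" "card T = t + q"
    and ext: "\<And>T. finite T \<Longrightarrow> card T < t + i \<Longrightarrow> extends_by m \<G> T"
  shows "real (card (up \<G> T)) \<le> (real m * eps) ^ (i - q) * (eps ^ q * b t)"
proof -
  have "real (card (up \<G> T)) \<le> real m ^ (i - q) * b (card T + (i - q))"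
  proof (rule card_up_rec[OF assms(1,2)])
    fix T' assume T': "T \<subseteq> T'" "finite T'" "card T' < card T + (i - q)"
    have "card T \<le> card T'" using T' by (intro card_mono)
    then show "extends_by m \<G> T'" using ext T' assms(3) by auto
  qed
  also have "\<dots> \<le> real m ^ (i - q) * (eps ^ (q + (i - q)) * b t)"
    using b_add_le[of t "q + (i - q)"] assms(3) by (intro mult_left_mono) (auto simp: add.assoc)
  also have "\<dots> = (real m * eps) ^ (i - q) * (eps ^ q * b t)"
    by (simp add: power_mult_distrib power_add)
  finally show ?thesis .
qed

text \<open>4/3 is 2 (t + 2) \<eta> for the weight \<eta> used below. Together with the factor 1/10
  of the local constant \<open>E\<close> there, the rounding 4.4 yields 11/25.\<close>

lemma exp_four_thirds: "exp (4 / 3) \<le> (4.4 :: real)"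
proof -
  have "exp (1 / 3 :: real) \<le> 1 + 1 / 3 + (1 / 3)\<^sup>2"
    by (rule exp_bound) auto
  then have "exp (1 / 3 :: real) ^ 4 \<le> (13 / 9) ^ 4"
    by (intro power_mono) (auto simp: power2_eq_square)
  moreover have "exp (1 / 3 :: real) ^ 4 = exp (4 / 3)"
    by (simp flip: exp_of_nat_mult)
  ultimately show ?thesis by (simp add: eval_nat_numeral)
qed

text \<open>
  Here \<open>\<F>\<close> may be as large as a family of \<open>m\<close> stars, but \<open>\<G>\<close> has no generators of size
  \<open>t + 1\<close>.  The classes of \<open>\<F>\<close> and \<open>\<G>\<close> according to their traces on \<open>W\<close> are compared
  with the kernel \<open>\<eta> ^ card (A \<triangle> B)\<close>, \<open>\<eta> = 2 / (3 (t + 2))\<close>.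
\<close>

lemma card_mult_le_if_no_small_generator:
  assumes "\<F> \<subseteq> nsets {1..n} k" "\<G> \<subseteq> nsets {1..n} k" "cross_intersecting t \<F> \<G>"
    and W: "finite W" "card W \<le> t + i" "2 \<le> i" "t_cover t \<F> W"
    and extF: "\<And>T. finite T \<Longrightarrow> card T < t + 1 \<Longrightarrow> extends_by m \<F> T"
    and extG: "\<And>T. finite T \<Longrightarrow> card T < t + i \<Longrightarrow> extends_by m \<G> T"
  shows "real (card \<F>) * real (card \<G>) \<le> 11 / 25 * leading_deg\<^sup>2 * (b (t + 1))\<^sup>2"
proof -
  define u where "u = real t + 2"
  \<comment> \<open>\<eta> is the price of a point lying in exactly one of two traces, and
    \<open>eps = \<omega> * \<eta>\<close>: every prescribed element pays its \<eta> and leaves a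
    small factor \<omega>.\<close>
  define \<eta> where "\<eta> = 2 / (3 * u)"
  define \<omega> where "\<omega> = 3 / 2 * u * eps"
  define x where "x = real m * eps"
  define E where "E = (1 / 10) * leading_deg\<^sup>2 * eps\<^sup>2"
  \<comment> \<open>The geometric factor offsets the growth of the kernel bound with W: each of the
    i - 2 points beyond t + 2 costs at most exp (1/3) \<le> 5.\<close>
  define C where "C = (1 / 5) ^ (i - 2) * E * (b t)\<^sup>2"
  have u: "4 \<le> u" using t2 by (simp add: u_def)
  have \<eta>: "0 < \<eta>" "\<eta> \<le> 1" using u by (auto simp: \<eta>_def divide_simps)
  have eps_eq: "eps = \<omega> * \<eta>" using u by (simp add: \<omega>_def \<eta>_def)
  have ue: "60 * (u * eps) \<le> 1" and u2e: "15 * u\<^sup>2 * eps \<le> 1"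
    using u_eps u2_eps by (auto simp: u_def)
  have \<omega>: "0 < \<omega>" "\<omega> \<le> 1 / 40"
    using ue u eps_pos by (auto simp: \<omega>_def)
  have x: "0 \<le> x" "x \<le> 1 / 10" using m_eps m_eps_nonneg by (auto simp: x_def)
  have E0: "0 \<le> E" by (simp add: E_def)
  have leading_deg: "real m \<le> leading_deg" "u \<le> leading_deg" using leading_deg_ge by (auto simp: u_def)
  have n1: "\<omega> * (2 * x)\<^sup>2 \<le> E"
  proof -
    have "60 * (u * eps) * (real m)\<^sup>2 \<le> 1 * leading_deg\<^sup>2"
      using ue leading_deg by (intro mult_mono power_mono) auto
    then have "6 * (u * eps) * (real m)\<^sup>2 * eps\<^sup>2 \<le> (1 / 10) * leading_deg\<^sup>2 * eps\<^sup>2"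
      by (intro mult_right_mono) auto
    then show ?thesis by (simp add: \<omega>_def x_def E_def power2_eq_square algebra_simps)
  qed
  have n2: "\<omega> ^ 3 \<le> E"
  proof -
    have "u * (15 * u\<^sup>2 * eps) \<le> u * 1" using u2e u by (intro mult_left_mono) auto
    then have "15 * (u ^ 3 * eps) \<le> u" by (simp add: power2_eq_square power3_eq_cube mult_ac)
    moreover have "4 * u \<le> u * u" using u by (intro mult_right_mono) auto
    moreover have "u * u \<le> leading_deg\<^sup>2" unfolding power2_eq_square using leading_deg u by (intro mult_mono) auto
    ultimately have "27 / 8 * (u ^ 3 * eps) \<le> (1 / 10) * leading_deg\<^sup>2" using u by linarith
    then have "27 / 8 * u ^ 3 * eps \<le> (1 / 10) * leading_deg\<^sup>2" by simp
    then have "27 / 8 * u ^ 3 * eps * eps\<^sup>2 \<le> (1 / 10) * leading_deg\<^sup>2 * eps\<^sup>2"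
      by (intro mult_right_mono) auto
    then show ?thesis by (simp add: \<omega>_def E_def power2_eq_square power3_eq_cube algebra_simps)
  qed
  have n3: "x ^ 3 \<le> E"
  proof -
    have "x * x\<^sup>2 \<le> 1 / 10 * x\<^sup>2" using x by (intro mult_right_mono) auto
    also have "\<dots> = 1 / 10 * (real m)\<^sup>2 * eps\<^sup>2" by (simp add: x_def power2_eq_square)
    also have "\<dots> \<le> E" unfolding E_def using leading_deg by (intro mult_right_mono mult_left_mono power_mono) auto
    finally show ?thesis by (simp add: power2_eq_square power3_eq_cube)
  qed
  \<comment> \<open>y and z dominate the factors in the two cases below, traces sharing fewer than t
    points and traces sharing at least t. \<open>n1\<close>, \<open>n2\<close> and \<open>n3\<close>
    bound \<omega> y^2 and z^3 by \<open>E\<close>, whichever value the maximum takes.\<close>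
  define y z where "y = max (2 * x) \<omega>" and "z = max x \<omega>"
  have y: "0 \<le> y" "y \<le> 1 / 5" and z: "0 \<le> z" "z \<le> 1 / 5" using x \<omega> by (auto simp: y_def z_def)
  have split_i: "v ^ i \<le> (1 / 5) ^ (i - 2) * v\<^sup>2" if "0 \<le> v" "v \<le> 1 / 5" for v :: real
  proof -
    have "v ^ i = v ^ (i - 2) * v\<^sup>2" using W(3) by (metis le_add_diff_inverse2 power_add)
    also have "\<dots> \<le> (1 / 5) ^ (i - 2) * v\<^sup>2"
      using that by (intro mult_right_mono power_mono) auto
    finally show ?thesis .
  qed
  have yi: "\<omega> * y ^ i \<le> (1 / 5) ^ (i - 2) * E"
  proof -
    have "\<omega> * y\<^sup>2 \<le> E" using n1 n2 by (auto simp: y_def max_def power2_eq_square power3_eq_cube)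
    then have le: "(1 / 5) ^ (i - 2) * (\<omega> * y\<^sup>2) \<le> (1 / 5) ^ (i - 2) * E"
      by (intro mult_left_mono) auto
    have "\<omega> * y ^ i \<le> \<omega> * ((1 / 5) ^ (i - 2) * y\<^sup>2)"
      using split_i[OF y] \<omega> by (intro mult_left_mono) auto
    with le show ?thesis by (simp only: mult.left_commute)
  qed
  have zi: "z * z ^ i \<le> (1 / 5) ^ (i - 2) * E"
  proof -
    have "z * z\<^sup>2 \<le> E" using n2 n3 by (auto simp: z_def max_def power2_eq_square power3_eq_cube)
    then have le: "(1 / 5) ^ (i - 2) * (z * z\<^sup>2) \<le> (1 / 5) ^ (i - 2) * E"
      by (intro mult_left_mono) auto
    have "z * z ^ i \<le> z * ((1 / 5) ^ (i - 2) * z\<^sup>2)"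
      using split_i[OF z] z by (intro mult_left_mono) auto
    with le show ?thesis by (simp only: mult.left_commute)
  qed
  have tk: "t \<le> k" using kt by simp
  define f g where "f A = real (card (trace \<F> W A))" and "g B = real (card (trace \<G> W B))" for A B
  have fin: "finite \<F>" "finite \<G>" using assms(1,2) finite_nsets_subset by auto
  have "(\<Sum>A\<in>Pow W. f A) * (\<Sum>B\<in>Pow W. g B) \<le> C * (1 + \<eta>) ^ (2 * card W)"
  proof (rule trace_kernel_bound)
    fix A B assume AB: "A \<subseteq> W" "B \<subseteq> W"
    have fAB: "finite A" "finite B" using AB W(1) by (auto intro: finite_subset)
    have cA: "card A = card (A \<inter> B) + card (A - B)" and cB: "card B = card (A \<inter> B) + card (B - A)"
      using fAB by (metis card_Int_Diff) (metis fAB card_Int_Diff Int_commute)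
    let ?s = "card (A - B) + card (B - A)"
    have C0: "0 \<le> C" using E0 by (simp add: C_def)
    show "f A * g B \<le> C * \<eta> ^ ?s"
    proof -
      consider "card A < t" | "t \<le> card A" "card (A \<inter> B) < t" | "t \<le> card (A \<inter> B)" by linarith
      then show ?thesis
      proof cases
        case 1
        have "trace \<F> W A = {}" using 1 W(4) by (auto simp: trace_def t_cover_def)
        then show ?thesis using C0 \<eta> by (simp add: f_def)
      next
        case 2
        define l where "l = t - card (A \<inter> B)"
        define \<alpha> \<beta> where "\<alpha> = card (A - B)" and "\<beta> = card (B - A)"
        have l: "card (A \<inter> B) + l = t" "1 \<le> l" using 2 by (auto simp: l_def)
        have cl: "card A + l = t + \<alpha>" "card B + l = t + \<beta>" "l \<le> \<alpha>"
          using cA cB l 2 by (auto simp: \<alpha>_def \<beta>_def)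
        have "f A * g B \<le> 4 ^ (l - 1) * (2 * (real m * eps)) ^ (i - (card B + l - t)) *
            (b (card A + l) * b (card B + l))"
          unfolding f_def g_def
        proof (rule card_mult_traces_le[OF _ _ _ W(1) AB _ _ l])
          show "trace \<F> W A \<subseteq> nsets {1..n} k" "trace \<G> W B \<subseteq> nsets {1..n} k"
            using assms(1,2) trace_subset by blast+
          show "cross_intersecting t (trace \<F> W A) (trace \<G> W B)"
            by (rule cross_intersecting_mono[OF assms(3) trace_subset trace_subset])
          show "extends_by m (trace \<G> W B) T" if "finite T" "card T < t + i" for T
            by (rule extends_by_mono[OF extG[OF that] trace_subset])
        qed (auto simp: trace_def)
        then have "f A * g B \<le> 4 ^ (l - 1) * (2 * x) ^ (i - \<beta>) * (b (t + \<alpha>) * b (t + \<beta>))"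
          by (simp add: cl x_def)
        also have "\<dots> \<le> 4 ^ (l - 1) * (2 * x) ^ (i - \<beta>) * ((eps ^ \<alpha> * b t) * (eps ^ \<beta> * b t))"
          using b_add_le[of t] b_nonneg x eps_pos by (intro mult_left_mono mult_mono) auto
        also have "\<dots> = (4 ^ (l - 1) * \<omega> ^ \<alpha>) * ((2 * x) ^ (i - \<beta>) * \<omega> ^ \<beta>) * (b t)\<^sup>2 * \<eta> ^ (\<alpha> + \<beta>)"
          by (simp add: eps_eq power_mult_distrib power_add power2_eq_square algebra_simps)
        also have "\<dots> \<le> (\<omega> * y ^ i) * (b t)\<^sup>2 * \<eta> ^ (\<alpha> + \<beta>)"
        proof -
          \<comment> \<open>A has at least t points, hence l \<le> \<alpha>; as 4 \<omega> \<le> 1,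
            the factor 4 ^ (l - 1) is absorbed and one \<omega> is left.\<close>
          have "4 ^ (l - 1) * \<omega> ^ \<alpha> \<le> 4 ^ (\<alpha> - 1) * \<omega> ^ \<alpha>"
            using cl(3) \<omega> by (intro mult_right_mono power_increasing) auto
          also have "\<dots> = (4 * \<omega>) ^ (\<alpha> - 1) * \<omega>"
            using cl(3) l(2) by (cases \<alpha>) (auto simp: power_mult_distrib)
          also have "\<dots> \<le> 1 * \<omega>" using \<omega> by (intro mult_right_mono power_le_one) auto
          finally have "4 ^ (l - 1) * \<omega> ^ \<alpha> \<le> \<omega>" by simp
          moreover have "(2 * x) ^ (i - \<beta>) * \<omega> ^ \<beta> \<le> y ^ i"
            using x \<omega> y by (intro power_mult_power_le) (auto simp: y_def)
          ultimately have "(4 ^ (l - 1) * \<omega> ^ \<alpha>) * ((2 * x) ^ (i - \<beta>) * \<omega> ^ \<beta>) \<le> \<omega> * y ^ i"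
            using \<omega> x y by (intro mult_mono) auto
          then show ?thesis using \<eta> by (intro mult_right_mono) auto
        qed
        also have "\<dots> \<le> C * \<eta> ^ (\<alpha> + \<beta>)"
          unfolding C_def using yi \<eta> by (intro mult_right_mono) auto
        finally show ?thesis by (simp add: \<alpha>_def \<beta>_def)
      next
        case 3
        define p q where "p = card A - t" and "q = card B - t"
        have cp: "card A = t + p" "card B = t + q" using cA cB 3 by (auto simp: p_def q_def)
        \<comment> \<open>Common points beyond t pay \<eta> twice in p + q, although the kernel does
          not ask for them; since \<eta> \<le> 1 this only helps.\<close>
        have s: "?s \<le> p + q" using cA cB 3 by (auto simp: p_def q_def)
        have "f A \<le> real (card (up \<F> A))" unfolding f_def
          using fin finite_subset[OF up_subset] by (auto intro!: card_mono simp: trace_def up_def)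
        also have "\<dots> \<le> x ^ (1 - p) * (eps ^ p * b t)"
          unfolding x_def by (rule card_up_above[OF assms(1) fAB(1) cp(1) extF])
        finally have fA: "f A \<le> x ^ (1 - p) * (eps ^ p * b t)" .
        have "g B \<le> real (card (up \<G> B))" unfolding g_def
          using fin finite_subset[OF up_subset] by (auto intro!: card_mono simp: trace_def up_def)
        also have "\<dots> \<le> x ^ (i - q) * (eps ^ q * b t)"
          unfolding x_def by (rule card_up_above[OF assms(2) fAB(2) cp(2) extG])
        finally have gB: "g B \<le> x ^ (i - q) * (eps ^ q * b t)" .
        have "f A * g B \<le> (x ^ (1 - p) * (eps ^ p * b t)) * (x ^ (i - q) * (eps ^ q * b t))"
          by (rule mult_mono[OF fA gB]) (use x eps_pos b_nonneg in \<open>auto simp: g_def\<close>)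
        also have "\<dots> = (x ^ (1 - p) * \<omega> ^ p) * (x ^ (i - q) * \<omega> ^ q) * (b t)\<^sup>2 * \<eta> ^ (p + q)"
          by (simp add: eps_eq power_mult_distrib power_add power2_eq_square algebra_simps)
        also have "\<dots> \<le> (z ^ 1 * z ^ i) * (b t)\<^sup>2 * \<eta> ^ (p + q)"
          using x \<omega> z \<eta> by (intro mult_right_mono mult_mono power_mult_power_le) (auto simp: z_def)
        also have "\<dots> \<le> C * \<eta> ^ (p + q)"
          unfolding C_def using zi \<eta> by (intro mult_right_mono) auto
        also have "\<dots> \<le> C * \<eta> ^ ?s"
          using s \<eta> C0 by (intro mult_left_mono power_decreasing) auto
        finally show ?thesis .
      qed
    qed
  qed (use W(1) \<eta> E0 in \<open>auto simp: f_def g_def C_def\<close>)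
  then have "real (card \<F>) * real (card \<G>) \<le> C * (1 + \<eta>) ^ (2 * card W)"
    unfolding f_def g_def using fin W(1) by (simp add: sum_card_traces)
  also have "\<dots> \<le> C * (4.4 * 5 ^ (i - 2))"
  proof -
    have "(1 + \<eta>) ^ (2 * card W) \<le> exp \<eta> ^ (2 * card W)"
      using \<eta> by (intro power_mono) auto
    also have "\<dots> = exp (real (2 * card W) * \<eta>)" by (simp only: exp_of_nat_mult)
    also have "\<dots> \<le> exp (4 / 3 + real (i - 2) / 3)"
    proof -
      have "real (card W) \<le> real t + real i" using W(2) by linarith
      then have "real (2 * card W) * \<eta> \<le> 2 * (u + real (i - 2)) * \<eta>"
        using W(3) \<eta> by (intro mult_right_mono) (auto simp: u_def)
      also have "\<dots> = 4 / 3 + 4 / (3 * u) * real (i - 2)" using u by (simp add: \<eta>_def field_simps)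
      also have "4 / (3 * u) * real (i - 2) \<le> 1 / 3 * real (i - 2)"
        using u by (intro mult_right_mono) (auto simp: divide_simps)
      finally show ?thesis by simp
    qed
    also have "\<dots> = exp (4 / 3) * exp (1 / 3) ^ (i - 2)"
      by (simp add: exp_add flip: exp_of_nat_mult)
    also have "\<dots> \<le> 4.4 * 5 ^ (i - 2)"
    proof -
      have "exp (1 / 3 :: real) \<le> exp (4 / 3)" by simp
      then have "exp (1 / 3 :: real) \<le> 5" using exp_four_thirds by linarith
      then show ?thesis using exp_four_thirds by (intro mult_mono power_mono) auto
    qed
    finally show ?thesis using E0 by (intro mult_left_mono) (auto simp: C_def)
  qed
  also have "\<dots> = 4.4 * E * (b t)\<^sup>2 * ((1 / 5) ^ (i - 2) * 5 ^ (i - 2))"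
    by (simp add: C_def)
  also have "(1 / 5) ^ (i - 2) * 5 ^ (i - 2) = (1 :: real)"
    by (simp flip: power_mult_distrib)
  finally show ?thesis by (simp add: E_def b_t1[simplified] power_mult_distrib)
qed

end

section \<open>Cardinalities of the extremal families\<close>

text \<open>Sort the (r + 1)-subsets of M points by the first of j marked points that they
  contain.\<close>

lemma choose_Suc_telescope:
  "j \<le> M \<Longrightarrow> M choose Suc r = ((M - j) choose Suc r) + (\<Sum>i<j. (M - 1 - i) choose r)"
proof (induction j)
  case (Suc j)
  then have "M - j = Suc (M - 1 - j)" by simp
  then have "(M - j) choose Suc r = ((M - 1 - j) choose r) + ((M - Suc j) choose Suc r)"
    by simp
  with Suc show ?case by simp
qed simp

lemma choose_diff_lower:
  "i \<le> N \<Longrightarrow> real (N choose Suc r) - real i * real ((N - 1) choose r) \<le> real ((N - i) choose Suc r)"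
proof (induction i)
  case (Suc i)
  have "N - i = Suc (N - Suc i)" using Suc by simp
  then have "(N - i) choose Suc r = ((N - Suc i) choose r) + ((N - Suc i) choose Suc r)" by simp
  moreover have "(N - Suc i) choose r \<le> (N - 1) choose r" by (rule binomial_right_mono) simp
  ultimately show ?case using Suc by (simp add: algebra_simps)
qed simp

text \<open>Each Pascal step loses at least 1. So weak a gain already separates
  \<open>card_H\<close> from \<open>card_A\<close> when their leading terms agree.\<close>

lemma choose_diff_upper:
  "i + r \<le> N \<Longrightarrow> ((N - i) choose Suc r) + i \<le> N choose Suc r"
proof (induction i)
  case (Suc i)
  have "N - i = Suc (N - Suc i)" using Suc by simp
  then have "(N - i) choose Suc r = ((N - Suc i) choose r) + ((N - Suc i) choose Suc r)" by simp
  moreover have "1 \<le> (N - Suc i) choose r"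
    using zero_less_binomial[of r "N - Suc i"] Suc.prems by linarith
  ultimately show ?case using Suc by linarith
qed simp

context params
begin

definition star_meet :: "nat set \<Rightarrow> nat set \<Rightarrow> nat set set" where
  "star_meet X Y = {F \<in> nsets {1..n} k. X \<subseteq> F \<and> F \<inter> Y \<noteq> {}}"

definition h0 :: nat where "h0 = ((n - t) choose (k - t)) - ((n - t - m) choose (k - t))"

definition card_H :: nat where "card_H = h0 + t"

definition card_A :: nat where
  "card_A = (t + 2) * ((n - t - 2) choose (k - t - 1)) + ((n - t - 2) choose (k - t - 2))"

lemma m_le: "m \<le> n - t"
  using ten_k_le m_less_k by linarith

lemma card_avoid:
  assumes "X \<subseteq> {1..n}" "Y \<subseteq> {1..n}" "X \<inter> Y = {}" "card X \<le> k"
  shows "card {F \<in> nsets {1..n} k. X \<subseteq> F \<and> F \<inter> Y = {}} = (n - card Y - card X) choose (k - card X)"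
proof -
  have "{F \<in> nsets {1..n} k. X \<subseteq> F \<and> F \<inter> Y = {}} = {F \<in> nsets ({1..n} - Y) k. X \<subseteq> F}"
    by (auto simp: nsets_def)
  moreover have "card ({1..n} - Y) = n - card Y"
    using assms(2) finite_subset[OF assms(2)] by (simp add: card_Diff_subset)
  ultimately show ?thesis using assms card_nsets_superset[of X "{1..n} - Y" k] by auto
qed

lemma card_star_meet:
  assumes "X \<subseteq> {1..n}" "Y \<subseteq> {1..n}" "X \<inter> Y = {}" "card X = t" "card Y = m"
  shows "card (star_meet X Y) = h0"
proof -
  let ?S = "{F \<in> nsets {1..n} k. X \<subseteq> F}" and ?D = "{F \<in> nsets {1..n} k. X \<subseteq> F \<and> F \<inter> Y = {}}"
  have "star_meet X Y = ?S - ?D" by (auto simp: star_meet_def)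
  moreover have "finite ?S" by (simp add: finite_imp_finite_nsets)
  ultimately have "card (star_meet X Y) = card ?S - card ?D"
    using card_Diff_subset[of ?D ?S] finite_subset[of ?D ?S] by auto
  moreover have "card ?S = (n - t) choose (k - t)"
    using assms kt by (subst card_nsets_superset) auto
  moreover have "card ?D = (n - m - t) choose (k - t)"
    using card_avoid[OF assms(1,2,3)] assms kt by simp
  ultimately show ?thesis by (simp add: h0_def add.commute)
qed

lemma card_H_family:
  assumes "X \<in> nsets {1..n} t" "K \<in> nsets {1..n} (k + 1)" "L \<in> nsets {1..n} (k + 1)" "X \<subseteq> K" "X \<subseteq> L"
  shows "card (H_family n k X K L) = card_H"
proof -
  have X: "X \<subseteq> {1..n}" "finite X" "card X = t" and K: "finite K" "card K = k + 1"
    and L: "L \<subseteq> {1..n}" "finite L" "card L = k + 1"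
    using assms by (auto simp: nsets_def)
  have "card (L - X) = m" using X L assms(5) kt by (simp add: card_Diff_subset m_def)
  then have "card (star_meet X (L - X)) = h0" using X L by (intro card_star_meet) auto
  moreover have "card {K - {x} | x. x \<in> X} = t"
  proof -
    have "{K - {x} | x. x \<in> X} = (\<lambda>x. K - {x}) ` X" by auto
    moreover have "inj_on (\<lambda>x. K - {x}) X" using assms(4) by (auto simp: inj_on_def)
    ultimately show ?thesis using X by (simp add: card_image)
  qed
  moreover have "star_meet X (L - X) \<inter> {K - {x} | x. x \<in> X} = {}"
    by (auto simp: star_meet_def)
  moreover have "finite (star_meet X (L - X))"
    by (simp add: star_meet_def finite_imp_finite_nsets)
  moreover have "H_family n k X K L = star_meet X (L - X) \<union> {K - {x} | x. x \<in> X}"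
    by (simp add: H_family_def star_meet_def)
  moreover have "finite {K - {x} | x. x \<in> X}" using X by simp
  ultimately show ?thesis by (simp add: card_Un_disjoint card_H_def)
qed

lemma card_A_family:
  assumes "Z \<in> nsets {1..n} (t + 2)"
  shows "card (A_family n k t Z) = card_A"
proof -
  have Z: "Z \<subseteq> {1..n}" "finite Z" "card Z = t + 2" using assms by (auto simp: nsets_def)
  let ?S = "{F \<in> nsets {1..n} k. Z \<subseteq> F}"
  let ?D = "\<lambda>z. {F \<in> nsets {1..n} k. Z - {z} \<subseteq> F \<and> F \<inter> {z} = {}}"
  have "A_family n k t Z = ?S \<union> (\<Union>z\<in>Z. ?D z)"
  proof (intro equalityI subsetI)
    fix F assume F: "F \<in> A_family n k t Z"
    then have Fk: "F \<in> nsets {1..n} k" "t + 1 \<le> card (F \<inter> Z)" by (auto simp: A_family_def)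
    show "F \<in> ?S \<union> (\<Union>z\<in>Z. ?D z)"
    proof (cases "Z \<subseteq> F")
      case False
      then obtain z where z: "z \<in> Z" "z \<notin> F" by auto
      have "F \<inter> Z = Z - {z}"
        by (rule card_subset_eq) (use Z z Fk card_mono[of "Z - {z}" "F \<inter> Z"] in auto)
      then show ?thesis using z Fk by auto
    qed (use Fk in auto)
  next
    fix F assume F: "F \<in> ?S \<union> (\<Union>z\<in>Z. ?D z)"
    then obtain z where z: "F \<in> nsets {1..n} k" "Z - {z} \<subseteq> F" by auto
    have "t + 1 \<le> card (Z - {z})" using Z by (simp add: card_Diff_singleton_if)
    also have "\<dots> \<le> card (F \<inter> Z)" using z Z by (intro card_mono) auto
    finally show "F \<in> A_family n k t Z" using z by (simp add: A_family_def)
  qed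
  moreover have fin: "finite ?S" "finite (?D z)" for z by (auto simp: finite_imp_finite_nsets)
  have "card (?S \<union> (\<Union>z\<in>Z. ?D z)) = card ?S + card (\<Union>z\<in>Z. ?D z)"
    using fin Z by (intro card_Un_disjoint) auto
  moreover have "card (\<Union>z\<in>Z. ?D z) = (\<Sum>z\<in>Z. card (?D z))"
    using fin Z by (intro card_UN_disjoint) auto
  moreover have "card ?S = (n - t - 2) choose (k - t - 2)"
    using Z kt by (subst card_nsets_superset) auto
  moreover have "card (?D z) = (n - t - 2) choose (k - t - 1)" if "z \<in> Z" for z
  proof -
    have "Z - {z} \<subseteq> {1..n}" "{z} \<subseteq> {1..n}" "(Z - {z}) \<inter> {z} = {}" "card (Z - {z}) = t + 1"
      using that Z by (auto simp: card_Diff_singleton_if)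
    then show ?thesis using card_avoid[of "Z - {z}" "{z}"] kt by simp
  qed
  ultimately show ?thesis using Z by (simp add: card_A_def)
qed

lemma b_t1_nat: "b (t + 1) = real ((n - t - 1) choose (k - t - 1))"
  and b_t2_nat: "b (t + 2) = real ((n - t - 2) choose (k - t - 2))"
  using kt by (auto simp: b_def)

lemma B_pos: "0 < b (t + 1)"
  using kt by (intro b_pos) simp

lemma b_t2_le: "b (t + 2) \<le> eps * b (t + 1)"
  using b_Suc_le[of "t + 1"] by simp

lemma card_A_real: "real card_A = (real t + 2) * b (t + 1) - (real t + 1) * b (t + 2)"
proof -
  have "n - t - 1 = Suc (n - t - 2)" "k - t - 1 = Suc (k - t - 2)"
    using kt t_less_n by auto
  then have "(n - t - 1) choose (k - t - 1)
      = ((n - t - 2) choose (k - t - 2)) + ((n - t - 2) choose (k - t - 1))" by simp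
  then show ?thesis unfolding card_A_def b_t1_nat b_t2_nat by (simp add: algebra_simps)
qed

lemma h0_sum: "h0 = (\<Sum>i<m. (n - t - 1 - i) choose (k - t - 1))"
proof -
  have "k - t = Suc (k - t - 1)" using kt by simp
  then show ?thesis
    unfolding h0_def using choose_Suc_telescope[OF m_le, of "k - t - 1"] by simp
qed

text \<open>The i-th term of \<open>h0_sum\<close> is at least
  \<open>b (t + 1) - i * b (t + 2)\<close>; summing i over i < m gives m (m - 1) / 2.\<close>

lemma card_H_lower: "real m * b (t + 1) - real m * (real m - 1) / 2 * (eps * b (t + 1)) \<le> real card_H"
proof -
  have "real m * b (t + 1) - real m * (real m - 1) / 2 * b (t + 2) = (\<Sum>i<m. b (t + 1) - real i * b (t + 2))"
  proof -
    have "(\<Sum>i<j. real i) = real j * (real j - 1) / 2" for j :: nat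
      by (induction j) (auto simp: field_simps)
    from this[of m] show ?thesis by (simp add: sum_subtractf flip: sum_distrib_right)
  qed
  also have "\<dots> \<le> (\<Sum>i<m. real ((n - t - 1 - i) choose (k - t - 1)))"
  proof (rule sum_mono)
    fix i assume "i \<in> {..<m}"
    then have "i \<le> n - t - 1" using m_le by auto
    from choose_diff_lower[OF this, of "k - t - 2"]
    show "b (t + 1) - real i * b (t + 2) \<le> real ((n - t - 1 - i) choose (k - t - 1))"
    proof -
      have "k - t - 1 = Suc (k - t - 2)" "n - t - 1 - 1 = n - t - 2" using kt by auto
      then show ?thesis using choose_diff_lower[OF \<open>i \<le> n - t - 1\<close>, of "k - t - 2"]
        by (simp only: b_t1_nat b_t2_nat)
    qed
  qed
  also have "\<dots> = real h0" by (simp add: h0_sum)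
  finally have "real m * b (t + 1) - real m * (real m - 1) / 2 * b (t + 2) \<le> real card_H"
    by (simp add: card_H_def)
  moreover have "real m * (real m - 1) / 2 * b (t + 2) \<le> real m * (real m - 1) / 2 * (eps * b (t + 1))"
    using b_t2_le m_ge by (intro mult_left_mono) auto
  ultimately show ?thesis by linarith
qed

text \<open>At m = t + 2 the leading terms agree. The term of \<open>h0_sum\<close> with index i + 1
  falls short of its counterpart in \<open>card_A\<close> by at least i, in total by at least 1 + t,
  which outweighs the t sets K - {x}.\<close>

lemma card_H_less_card_A:
  assumes "m \<le> t + 2"
  shows "card_H < card_A"
proof -
  let ?c = "\<lambda>i. (n - t - 1 - i) choose (k - t - 1)"
  have "h0 \<le> (\<Sum>i<t + 2. ?c i)" unfolding h0_sum using assms by (intro sum_mono2) auto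
  also have "\<dots> = ?c 0 + (\<Sum>i<t + 1. ?c (Suc i))"
    using sum.lessThan_Suc_shift[of ?c "t + 1"] by simp
  finally have 1: "h0 \<le> ?c 0 + (\<Sum>i<t + 1. ?c (Suc i))" .
  have "(\<Sum>i<t + 1. ?c (Suc i) + i) \<le> (\<Sum>i<t + 1. (n - t - 2) choose (k - t - 1))"
  proof (rule sum_mono)
    fix i assume i: "i \<in> {..<t + 1}"
    have "i + (k - t - 2) \<le> n - t - 2" using i ten_k_le kt by auto
    from choose_diff_upper[OF this]
    show "?c (Suc i) + i \<le> (n - t - 2) choose (k - t - 1)" using kt by (simp add: numeral_2_eq_2 Suc_diff_Suc)
  qed
  then have 2: "(\<Sum>i<t + 1. ?c (Suc i)) + (\<Sum>i<t + 1. i) \<le> (t + 1) * ((n - t - 2) choose (k - t - 1))"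
    by (simp add: sum.distrib)
  have "(\<Sum>i<t + 1. i) \<ge> (\<Sum>i\<in>{1, t}. i)" using t2 by (intro sum_mono2) auto
  then have 3: "t + 1 \<le> (\<Sum>i<t + 1. i)" using t2 by simp
  have "n - t - 1 = Suc (n - t - 2)" "k - t - 1 = Suc (k - t - 2)"
    using kt t_less_n by auto
  then have 4: "?c 0 = ((n - t - 2) choose (k - t - 2)) + ((n - t - 2) choose (k - t - 1))" by simp
  show ?thesis using 1 2 3 4 by (simp add: card_H_def card_A_def)
qed

text \<open>\<open>m \<le> t + 2\<close> means \<open>k \<le> 2 * t + 1\<close>, so this is the
  bound claimed in the respective range of k. By \<open>target_ge\<close> it is the larger of the
  two sizes.\<close>

definition target :: nat where "target = (if m \<le> t + 2 then card_A else card_H)"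

text \<open>A relative loss of at most \<open>eps\<close> in \<open>card_A\<close> costs at most 2
  (t + 2)^2 eps \<le> 2/15 in the square.\<close>

lemma target_sq_small:
  assumes "m \<le> t + 2"
  shows "((real t + 2)\<^sup>2 - 2 / 15) * (b (t + 1))\<^sup>2 \<le> (real target)\<^sup>2" "leading_deg = real t + 2"
proof -
  have mr: "real m \<le> real t + 2" using assms by linarith
  then show "leading_deg = real t + 2" by (simp add: leading_deg_def)
  let ?u = "real t + 2" and ?B = "b (t + 1)"
  have "(real t + 1) * b (t + 2) \<le> ?u * (eps * ?B)"
    using b_t2_le b_nonneg by (intro mult_mono) auto
  then have "(?u - ?u * eps) * ?B \<le> real card_A" using card_A_real by (simp add: algebra_simps)
  moreover have "0 \<le> ?u - ?u * eps" using u_eps by linarith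
  ultimately have "((?u - ?u * eps) * ?B)\<^sup>2 \<le> (real card_A)\<^sup>2"
    using b_nonneg by (intro power_mono) auto
  moreover have "?u\<^sup>2 - 2 / 15 \<le> (?u - ?u * eps)\<^sup>2"
  proof -
    have "(?u - ?u * eps)\<^sup>2 = ?u\<^sup>2 - 2 * (?u\<^sup>2 * eps) + (?u * eps)\<^sup>2" by (simp add: power2_eq_square algebra_simps)
    moreover have "15 * (?u\<^sup>2 * eps) \<le> 1" using u2_eps by (simp add: mult.assoc)
    ultimately show ?thesis using zero_le_power2[of "?u * eps"] by linarith
  qed
  then have "(?u\<^sup>2 - 2 / 15) * ?B\<^sup>2 \<le> (?u - ?u * eps)\<^sup>2 * ?B\<^sup>2" by (intro mult_right_mono) auto
  ultimately show "(?u\<^sup>2 - 2 / 15) * ?B\<^sup>2 \<le> (real target)\<^sup>2"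
    using assms by (simp add: target_def power_mult_distrib)
qed

text \<open>A relative loss of at most m * eps / 2, from \<open>card_H_lower\<close>, costs at most
  m^3 * eps in the square.\<close>

lemma target_sq_large:
  assumes "t + 3 \<le> m"
  shows "((real m)\<^sup>2 - real m ^ 3 * eps) * (b (t + 1))\<^sup>2 \<le> (real target)\<^sup>2" "leading_deg = real m"
proof -
  have mr: "real t + 3 \<le> real m" using assms by linarith
  then show "leading_deg = real m" by (simp add: leading_deg_def)
  let ?B = "b (t + 1)" and ?m = "real m"
  have "?m * (?m - 1) / 2 * (eps * ?B) \<le> ?m * ?m / 2 * (eps * ?B)"
    using eps_pos b_nonneg by (intro mult_right_mono) (auto intro: mult_left_mono)
  then have "?m * ?B - ?m * ?m / 2 * (eps * ?B) \<le> real card_H" using card_H_lower by linarith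
  then have "(?m - ?m * ?m / 2 * eps) * ?B \<le> real card_H" by (simp add: left_diff_distrib mult.assoc)
  moreover have "0 \<le> ?m - ?m * ?m / 2 * eps"
  proof -
    have "?m * (10 * (?m * eps)) \<le> ?m * 1" using m_eps by (intro mult_left_mono) auto
    moreover have "0 \<le> ?m * ?m * eps" using eps_pos by simp
    ultimately show ?thesis by (simp add: algebra_simps)
  qed
  ultimately have "((?m - ?m * ?m / 2 * eps) * ?B)\<^sup>2 \<le> (real card_H)\<^sup>2"
    using b_nonneg by (intro power_mono) auto
  moreover have "?m\<^sup>2 - ?m ^ 3 * eps \<le> (?m - ?m * ?m / 2 * eps)\<^sup>2"
  proof -
    have "(?m - ?m * ?m / 2 * eps)\<^sup>2 = ?m\<^sup>2 - ?m ^ 3 * eps + (?m * ?m / 2 * eps)\<^sup>2"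
      by (simp add: power2_eq_square power3_eq_cube algebra_simps)
    then show ?thesis by simp
  qed
  then have "(?m\<^sup>2 - ?m ^ 3 * eps) * ?B\<^sup>2 \<le> (?m - ?m * ?m / 2 * eps)\<^sup>2 * ?B\<^sup>2" by (intro mult_right_mono) auto
  ultimately show "(?m\<^sup>2 - ?m ^ 3 * eps) * ?B\<^sup>2 \<le> (real target)\<^sup>2"
    using assms by (simp add: target_def power_mult_distrib)
qed

lemma target_sq_lower: "0.9 * leading_deg\<^sup>2 * (b (t + 1))\<^sup>2 \<le> (real target)\<^sup>2"
proof (cases "m \<le> t + 2")
  case True
  have "2 / 15 \<le> 0.1 * (4 * 4 :: real)" by simp
  also have "\<dots> \<le> 0.1 * (real t + 2)\<^sup>2" unfolding power2_eq_square using t2 by (intro mult_left_mono mult_mono) auto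
  finally have "0.9 * (real t + 2)\<^sup>2 \<le> (real t + 2)\<^sup>2 - 2 / 15" by simp
  then have "0.9 * (real t + 2)\<^sup>2 * (b (t + 1))\<^sup>2 \<le> ((real t + 2)\<^sup>2 - 2 / 15) * (b (t + 1))\<^sup>2"
    by (intro mult_right_mono) auto
  then show ?thesis using target_sq_small[OF True] by simp
next
  case False
  then have m3: "t + 3 \<le> m" by simp
  have "(real m)\<^sup>2 * (10 * (real m * eps)) \<le> (real m)\<^sup>2 * 1" using m_eps by (intro mult_left_mono) auto
  then have "0.9 * (real m)\<^sup>2 \<le> (real m)\<^sup>2 - real m ^ 3 * eps" by (simp add: power2_eq_square power3_eq_cube)
  then have "0.9 * (real m)\<^sup>2 * (b (t + 1))\<^sup>2 \<le> ((real m)\<^sup>2 - real m ^ 3 * eps) * (b (t + 1))\<^sup>2"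
    by (intro mult_right_mono) auto
  then show ?thesis using target_sq_large[OF m3] by simp
qed

lemma less_target_sq_if:
  assumes "p \<le> c * (b (t + 1))\<^sup>2" "c < 0.9 * leading_deg\<^sup>2"
  shows "p < (real target)\<^sup>2"
proof -
  have "c * (b (t + 1))\<^sup>2 < 0.9 * leading_deg\<^sup>2 * (b (t + 1))\<^sup>2"
    using assms(2) B_pos by (intro mult_strict_right_mono) auto
  with assms(1) target_sq_lower show ?thesis by linarith
qed

text \<open>The leading coefficients differ by at least 1, and \<open>card_H\<close> loses at most
  m^2 * eps / 2. For m \<le> 2 (t + 2) the condition on n with (t + 2)^2 makes this small; for
  larger m the gap m - (t + 2) exceeds m / 2 and the condition with k^2 suffices. The same division
  recurs in later estimates.\<close>

lemma card_A_less_card_H: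
  assumes "t + 3 \<le> m"
  shows "card_A < card_H"
proof -
  let ?B = "b (t + 1)" and ?m = "real m" and ?u = "real t + 2"
  have mr: "?u + 1 \<le> ?m" using assms by linarith
  have "real card_A \<le> ?u * ?B" using card_A_real b_nonneg[of "t + 2"] by simp
  moreover have "?u * ?B < (?m - ?m * (?m - 1) / 2 * eps) * ?B"
  proof (rule mult_strict_right_mono[OF _ B_pos])
    have "?m * (?m - 1) / 2 * eps \<le> ?m\<^sup>2 / 2 * eps"
      using eps_pos by (intro mult_right_mono) (auto simp: power2_eq_square intro: mult_left_mono)
    moreover have "?m\<^sup>2 / 2 * eps < ?m - ?u"
    proof (cases "?m \<le> 2 * ?u")
      case True
      have "?m\<^sup>2 * eps \<le> (2 * ?u)\<^sup>2 * eps" using True eps_pos by (intro mult_right_mono power_mono) auto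
      also have "\<dots> = 4 * (?u\<^sup>2 * eps)" by (simp only: power_mult_distrib) simp
      finally show ?thesis using u2_eps mr by simp
    next
      case False
      then show ?thesis using m2_eps by simp
    qed
    ultimately show "?u < ?m - ?m * (?m - 1) / 2 * eps" by linarith
  qed
  ultimately show ?thesis using card_H_lower by (simp add: algebra_simps)
qed

end

section \<open>Generators of a maximal pair\<close>

lemma card_eq_Suc_diff_singleton:
  assumes "finite S" "A \<subseteq> S" "card S \<le> card A + 1" "A \<noteq> S"
  obtains x where "x \<in> S" "A = S - {x}"
proof -
  obtain x where x: "x \<in> S" "x \<notin> A" using assms by auto
  have "A \<subseteq> S - {x}" using assms(2) x by auto
  moreover have "card (S - {x}) \<le> card A" using assms(1,3) x by simp
  ultimately have "A = S - {x}" using assms(1) by (intro card_seteq) auto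
  then show ?thesis using x that by blast
qed

lemma Int_eq_or_Diff_singleton:
  assumes "finite S" "card S \<le> card (F \<inter> S) + 1"
  shows "S \<subseteq> F \<or> (\<exists>x\<in>S. F \<inter> S = S - {x})"
  using card_eq_Suc_diff_singleton[OF assms(1) _ assms(2)] by (metis inf.absorb_iff2 inf_le2)

lemma real_card_Un_le: "real (card (A \<union> B)) \<le> real (card A) + real (card B)"
  using card_Un_le[of A B] by linarith

definition link :: "'a set set \<Rightarrow> 'a set \<Rightarrow> 'a set" where
  "link \<P> X = {y. y \<notin> X \<and> insert y X \<in> \<P>}"

context params
begin

text \<open>Coefficient of \<open>b (t + 1)\<close> for the members containing no generator of the
  other family: a t-set branched twice contributes m^2 * eps, and t sets of size t + 1 branched once
  contribute m * eps each (\<open>card_no_gen_le\<close>).\<close>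

definition rest_coeff :: real where "rest_coeff = ((real m)\<^sup>2 + real t * real m) * eps"

definition gens :: "nat set set \<Rightarrow> nat set set" where
  "gens \<F> = {S \<in> nsets {1..n} (t + 1). t_cover t \<F> S}"

lemma gensD:
  assumes "S \<in> gens \<F>"
  shows "S \<subseteq> {1..n}" "finite S" "card S = t + 1" "t_cover t \<F> S"
  using assms by (auto simp: gens_def nsets_def)

lemma finite_gens: "finite (gens \<F>)"
  by (simp add: gens_def finite_imp_finite_nsets)

lemma finite_link_gens: "finite (link (gens \<F>) X)"
  by (rule finite_subset[of _ "{1..n}"]) (auto simp: link_def dest: gensD(1))

lemma linkD:
  assumes "y \<in> link (gens \<F>) X"
  shows "X \<subseteq> {1..n}" "finite X" "card X = t" "y \<in> {1..n}" "y \<notin> X" "insert y X \<in> gens \<F>"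
proof -
  have y: "y \<notin> X" "insert y X \<in> gens \<F>" using assms by (auto simp: link_def)
  then show "X \<subseteq> {1..n}" "finite X" "y \<in> {1..n}" "y \<notin> X" "insert y X \<in> gens \<F>"
    using gensD[OF y(2)] by auto
  then show "card X = t" using gensD(3)[OF y(2)] y(1) by simp
qed

end

locale closed_pair = params +
  fixes \<F> \<G> :: "nat set set"
  assumes F_sub: "\<F> \<subseteq> nsets {1..n} k" and G_sub: "\<G> \<subseteq> nsets {1..n} k"
    and cross: "cross_intersecting t \<F> \<G>"
    and F_closed: "\<And>A. A \<in> nsets {1..n} k \<Longrightarrow> \<forall>B\<in>\<G>. t \<le> card (A \<inter> B) \<Longrightarrow> A \<in> \<F>"
    and G_closed: "\<And>B. B \<in> nsets {1..n} k \<Longrightarrow> \<forall>A\<in>\<F>. t \<le> card (A \<inter> B) \<Longrightarrow> B \<in> \<G>"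
    and F_nontriv: "\<And>T. finite T \<Longrightarrow> card T \<le> t \<Longrightarrow> \<not> t_cover t \<F> T"
    and G_nontriv: "\<And>T. finite T \<Longrightarrow> card T \<le> t \<Longrightarrow> \<not> t_cover t \<G> T"
begin

text \<open>The locale is symmetric, so each one-sided lemma below also serves the other family,
  through the interpretation \<open>sw\<close>.\<close>

lemma swap: "closed_pair n k t \<G> \<F>"
proof
  show "A \<in> \<G>" if "A \<in> nsets {1..n} k" "\<forall>B\<in>\<F>. t \<le> card (A \<inter> B)" for A
    using that by (intro G_closed) (auto simp: Int_commute)
  show "B \<in> \<F>" if "B \<in> nsets {1..n} k" "\<forall>A\<in>\<G>. t \<le> card (A \<inter> B)" for B
    using that by (intro F_closed) (auto simp: Int_commute)
qed (use F_sub G_sub cross_intersecting_sym[OF cross] F_nontriv G_nontriv in auto)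

lemma FG_finite: "finite \<F>" "finite \<G>"
  using F_sub G_sub finite_nsets_subset by auto

lemma F_mem: "F \<in> \<F> \<Longrightarrow> F \<subseteq> {1..n} \<and> finite F \<and> card F = k"
  using F_sub by (auto simp: nsets_def)

lemma G_mem: "G \<in> \<G> \<Longrightarrow> G \<subseteq> {1..n} \<and> finite G \<and> card G = k"
  using G_sub by (auto simp: nsets_def)

lemma cross_card: "F \<in> \<F> \<Longrightarrow> G \<in> \<G> \<Longrightarrow> t \<le> card (F \<inter> G)"
  using cross by (auto simp: cross_intersecting_def)

lemma t_le_k: "t \<le> k"
  using kt by simp

lemma ext_G: "\<not> t_cover t \<F> T \<Longrightarrow> extends_by m \<G> T"
  using extends_by_if_not_cover[OF cross F_sub _ t_le_k] by (simp add: m_def)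

lemma ext_F: "\<not> t_cover t \<G> T \<Longrightarrow> extends_by m \<F> T"
  using extends_by_if_not_cover[OF cross_intersecting_sym[OF cross] G_sub _ t_le_k] by (simp add: m_def)

lemma ext_F_small: "finite T \<Longrightarrow> card T < t + 1 \<Longrightarrow> extends_by m \<F> T"
  using G_nontriv by (intro ext_F) auto

text \<open>Points of T outside {1..n} do not help to cover, so the rest of T is still a cover; by
  nontriviality it has t + 1 points, hence is all of T.\<close>

lemma small_cover_gens:
  assumes "finite T" "card T < t + 2" "t_cover t \<F> T"
  shows "T \<in> gens \<F>"
proof -
  have "F \<inter> (T \<inter> {1..n}) = F \<inter> T" if "F \<in> \<F>" for F using F_mem[OF that] by auto
  then have "t_cover t \<F> (T \<inter> {1..n})" using assms(3) by (simp add: t_cover_def)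
  then have "\<not> card (T \<inter> {1..n}) \<le> t" using F_nontriv[of "T \<inter> {1..n}"] assms(1) by auto
  then have c: "card T \<le> card (T \<inter> {1..n})" using assms(2) by simp
  then have "T \<inter> {1..n} = T"
    using assms(1) by (intro card_subset_eq) (auto intro: le_antisym card_mono)
  then show ?thesis using assms c \<open>\<not> card (T \<inter> {1..n}) \<le> t\<close>
    by (auto simp: gens_def nsets_def)
qed

text \<open>A set T with fewer than t + 2 points is either no cover, and branches, or a generator,
  and then lies in no member of \<G>'. So such families can be branched up to size t + 2.\<close>

lemma ext_G_no_gen:
  assumes "\<G>' \<subseteq> \<G>" "\<And>S. S \<in> gens \<F> \<Longrightarrow> up \<G>' S = {}" "finite T" "card T < t + 2"
  shows "extends_by m \<G>' T"
proof (cases "t_cover t \<F> T")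
  case True
  then show ?thesis using assms by (intro extends_by_empty assms(2) small_cover_gens)
next
  case False
  then show ?thesis using ext_G extends_by_mono assms(1) by blast
qed

lemma gens_up:
  assumes "S \<in> gens \<F>" "A \<in> nsets {1..n} k" "S \<subseteq> A"
  shows "A \<in> \<G>"
proof (rule G_closed[OF assms(2)], rule ballI)
  fix F assume F: "F \<in> \<F>"
  have "t \<le> card (F \<inter> S)" using gensD(4)[OF assms(1)] F by (auto simp: t_cover_def)
  also have "\<dots> \<le> card (F \<inter> A)" using F_mem[OF F] assms(3) by (intro card_mono) auto
  finally show "t \<le> card (F \<inter> A)" .
qed

text \<open>Pad S to a k-set with points outside S and R, for which n is large enough. Maximality
  puts it into \<G>, and R must meet it in t points, all of them in S.\<close>

lemma gens_cross:
  assumes "S \<in> gens \<F>" "R \<in> gens \<G>"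
  shows "t \<le> card (R \<inter> S)"
proof -
  note S = gensD[OF assms(1)] and R = gensD[OF assms(2)]
  have "card (S \<union> R) \<le> 2 * k" using card_Un_le[of S R] S R kt by linarith
  moreover have "card ({1..n} - (S \<union> R)) = n - card (S \<union> R)"
    using S R by (subst card_Diff_subset) auto
  ultimately have "k - (t + 1) \<le> card ({1..n} - (S \<union> R))"
    using ten_k_le by linarith
  then obtain D where D: "D \<subseteq> {1..n} - (S \<union> R)" "card D = k - (t + 1)" "finite D"
    by (meson obtain_subset_with_card_n)
  have "card (S \<union> D) = k"
    using D S kt by (subst card_Un_disjoint) auto
  then have "S \<union> D \<in> nsets {1..n} k" using S D by (auto simp: nsets_def)
  then have "S \<union> D \<in> \<G>" using gens_up[OF assms(1)] by auto
  then have "t \<le> card ((S \<union> D) \<inter> R)" using R(4) by (auto simp: t_cover_def)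
  also have "(S \<union> D) \<inter> R = R \<inter> S" using D by auto
  finally show ?thesis .
qed

text \<open>Every member of \<G> is a t-cover of \<F>. A smallest t-cover W has at least t + 2
  points, and its minimality lets \<G> branch up to size card W, as the product bound
  requires.\<close>

lemma less_target_if_no_gens:
  assumes "gens \<F> = {}"
  shows "real (card \<F>) * real (card \<G>) < (real target)\<^sup>2"
proof -
  have "\<G> \<noteq> {}" using G_nontriv[of "{}"] by (auto simp: t_cover_def)
  then obtain G where G: "G \<in> \<G>" by auto
  have "finite G \<and> t_cover t \<F> G" using G_mem[OF G] cross_card G by (auto simp: t_cover_def)
  then obtain W where W: "finite W" "t_cover t \<F> W"
    and least: "\<And>T. finite T \<Longrightarrow> t_cover t \<F> T \<Longrightarrow> card W \<le> card T"
    using ex_has_least_nat[of "\<lambda>T. finite T \<and> t_cover t \<F> T" G card] by blast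
  have "t + 2 \<le> card W" using small_cover_gens[OF W(1) _ W(2)] assms by (metis empty_iff not_le)
  define i where "i = card W - t"
  have i: "card W = t + i" "2 \<le> i" using \<open>t + 2 \<le> card W\<close> by (auto simp: i_def)
  have "real (card \<F>) * real (card \<G>) \<le> 11 / 25 * leading_deg\<^sup>2 * (b (t + 1))\<^sup>2"
  proof (rule card_mult_le_if_no_small_generator[OF F_sub G_sub cross W(1) _ i(2) W(2)])
    show "extends_by m \<G> T" if "finite T" "card T < t + i" for T
      using least[OF that(1)] that i by (intro ext_G) auto
  qed (use i ext_F_small in auto)
  then show ?thesis by (rule less_target_sq_if) (use leading_deg_ge in auto)
qed

lemma gens_up_card: "R \<in> gens \<G> \<Longrightarrow> real (card (up \<F> R)) \<le> b (t + 1)"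
  using card_up_le[OF F_sub, of R] gensD[of R \<G>] by simp

text \<open>A generator R of the other family has t + 1 points and meets both sets in at least t of
  them, so it meets their intersection in at least t - 1.\<close>

lemma gens_Int_card:
  assumes "S1 \<in> gens \<F>" "S2 \<in> gens \<F>" "S1 \<noteq> S2" "gens \<G> \<noteq> {}"
  shows "card (S1 \<inter> S2) = t \<or> card (S1 \<inter> S2) = t - 1"
proof -
  obtain R where R: "R \<in> gens \<G>" using assms by auto
  note S1 = gensD[OF assms(1)] and S2 = gensD[OF assms(2)] and R' = gensD[OF R]
  have "card (R \<inter> S1) + card (R \<inter> S2) = card (R \<inter> S1 \<union> R \<inter> S2) + card (R \<inter> S1 \<inter> (R \<inter> S2))"
    using R' by (intro card_Un_Int) auto
  moreover have "card (R \<inter> S1 \<union> R \<inter> S2) \<le> card R" using R' by (intro card_mono) auto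
  moreover have "card (R \<inter> S1 \<inter> (R \<inter> S2)) \<le> card (S1 \<inter> S2)" using S1 by (intro card_mono) auto
  ultimately have "t - 1 \<le> card (S1 \<inter> S2)"
    using gens_cross[OF assms(1) R] gens_cross[OF assms(2) R] R' by linarith
  moreover have "card (S1 \<inter> S2) < card S1"
  proof (rule psubset_card_mono)
    have "\<not> S1 \<subseteq> S2" using card_subset_eq[of S2 S1] S1 S2 assms(3) by auto
    then show "S1 \<inter> S2 \<subset> S1" by auto
  qed (use S1 in simp)
  ultimately show ?thesis using S1 by linarith
qed

lemma pair_gens_near:
  assumes "S1 \<in> gens \<F>" "S2 \<in> gens \<F>" "card (S1 \<inter> S2) = t"
  obtains y1 y2 where "y1 \<noteq> y2" "y1 \<notin> S1 \<inter> S2" "y2 \<notin> S1 \<inter> S2"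
    "S1 = insert y1 (S1 \<inter> S2)" "S2 = insert y2 (S1 \<inter> S2)"
proof -
  note S1 = gensD[OF assms(1)] and S2 = gensD[OF assms(2)]
  obtain y1 where y1: "y1 \<in> S1" "S1 \<inter> S2 = S1 - {y1}"
    by (rule card_eq_Suc_diff_singleton[of S1 "S1 \<inter> S2"]) (use S1 assms in auto)
  obtain y2 where y2: "y2 \<in> S2" "S1 \<inter> S2 = S2 - {y2}"
    by (rule card_eq_Suc_diff_singleton[of S2 "S1 \<inter> S2"]) (use S2 assms in auto)
  show ?thesis by (rule that[of y1 y2]) (use y1 y2 in auto)
qed

text \<open>If F misses x in X, then x is the one point that F may miss in each of the two (t +
  1)-sets, so y1 and y2 lie in F.\<close>

lemma covers_near_pair:
  assumes "t \<le> card (F \<inter> insert y1 X)" "t \<le> card (F \<inter> insert y2 X)"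
    and "finite X" "card X = t" "y1 \<notin> X" "y2 \<notin> X"
  shows "X \<subseteq> F \<or> (\<exists>x\<in>X. F \<inter> X = X - {x} \<and> insert y1 (insert y2 (X - {x})) \<subseteq> F)"
proof (cases "X \<subseteq> F")
  case False
  have mem: "y \<in> F \<and> (\<exists>x\<in>X. F \<inter> X = X - {x})" if y: "t \<le> card (F \<inter> insert y X)" "y \<notin> X" for y
  proof -
    have "insert y X \<subseteq> F \<or> (\<exists>x\<in>insert y X. F \<inter> insert y X = insert y X - {x})"
      using assms y by (intro Int_eq_or_Diff_singleton) auto
    then obtain x where x: "x \<in> insert y X" "F \<inter> insert y X = insert y X - {x}" using False by auto
    moreover have "x \<noteq> y" using x False y by auto
    ultimately have "y \<in> F" "x \<in> X" "F \<inter> X = X - {x}" by auto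
    then show ?thesis by blast
  qed
  show ?thesis using mem[OF assms(1,5)] mem[OF assms(2,6)] by blast
qed simp

text \<open>F may miss one point of each set. A missed common point uses up both allowances;
  otherwise F still contains one of the two points of each difference.\<close>

lemma covers_far_pair:
  assumes "t \<le> card (F \<inter> S1)" "t \<le> card (F \<inter> S2)"
    and "finite S1" "card S1 = t + 1" "finite S2" "card S2 = t + 1" "card (S1 \<inter> S2) = t - 1"
  shows "(\<exists>a\<in>S1 - S2. \<exists>c\<in>S2 - S1. insert a (insert c (S1 \<inter> S2)) \<subseteq> F)
    \<or> (\<exists>x\<in>S1 \<inter> S2. (S1 \<union> S2) - {x} \<subseteq> F)"
proof -
  have 1: "S1 \<subseteq> F \<or> (\<exists>x\<in>S1. F \<inter> S1 = S1 - {x})"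
    using assms by (intro Int_eq_or_Diff_singleton) auto
  have 2: "S2 \<subseteq> F \<or> (\<exists>x\<in>S2. F \<inter> S2 = S2 - {x})"
    using assms by (intro Int_eq_or_Diff_singleton) auto
  have c: "card (S1 - S2) = 2" "card (S2 - S1) = 2"
    using assms t2 by (simp_all add: card_Diff_subset_Int Int_commute)
  show ?thesis
  proof (cases "S1 \<inter> S2 \<subseteq> F")
    case True
    have "\<exists>a\<in>S1 - S2. a \<in> F"
    proof (rule ccontr)
      assume "\<not> ?thesis"
      then have "F \<inter> S1 \<subseteq> S1 \<inter> S2" by auto
      then have "card (F \<inter> S1) \<le> card (S1 \<inter> S2)" using assms by (intro card_mono) auto
      then show False using assms t2 by linarith
    qed
    moreover have "\<exists>a\<in>S2 - S1. a \<in> F"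
    proof (rule ccontr)
      assume "\<not> ?thesis"
      then have "F \<inter> S2 \<subseteq> S1 \<inter> S2" by auto
      then have "card (F \<inter> S2) \<le> card (S1 \<inter> S2)" using assms by (intro card_mono) auto
      then show False using assms t2 by linarith
    qed
    ultimately show ?thesis using True by auto
  next
    case False
    then obtain x where x: "x \<in> S1 \<inter> S2" "x \<notin> F" by auto
    then obtain x1 where x1: "x1 \<in> S1" "F \<inter> S1 = S1 - {x1}" using 1 by auto
    obtain x2 where x2: "x2 \<in> S2" "F \<inter> S2 = S2 - {x2}" using 2 x by auto
    have e: "x1 = x" "x2 = x" using x x1(2) x2(2) by auto
    have "S1 - {x} \<subseteq> F" "S2 - {x} \<subseteq> F" using x1(2) x2(2) e by auto
    then have "(S1 \<union> S2) - {x} \<subseteq> F" by auto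
    then show ?thesis using x(1) by (intro disjI2 bexI[of _ x])
  qed
qed

text \<open>The members of \<F>' are branched up to size t + 2 from the sets that two generators
  force into them: for a near pair one t-set and t sets of size t + 1, for a far pair four sets of
  size t + 1 and t - 1 sets of size t + 2.\<close>

lemma card_no_gen_le:
  assumes S: "S1 \<in> gens \<F>" "S2 \<in> gens \<F>" "S1 \<noteq> S2" "gens \<G> \<noteq> {}"
    and F': "\<F>' \<subseteq> \<F>" "\<And>R. R \<in> gens \<G> \<Longrightarrow> up \<F>' R = {}"
  shows "real (card \<F>') \<le> rest_coeff * b (t + 1)"
proof -
  interpret sw: closed_pair n k t \<G> \<F> by (rule swap)
  let ?B = "b (t + 1)"
  have subF': "\<F>' \<subseteq> nsets {1..n} k" using F' F_sub by auto
  have finF': "finite \<F>'" using F' FG_finite finite_subset by blast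
  have fup: "finite (up \<F>' T)" for T using finite_subset[OF up_subset finF'] .
  have ext: "extends_by m \<F>' T" if "finite T" "card T < t + 2" for T
    by (rule sw.ext_G_no_gen[OF F' that])
  have up_q: "real (card (up \<F>' T)) \<le> (real m * eps) ^ (2 - q) * (eps ^ q * b t)"
    if "finite T" "card T = t + q" for T q
    by (rule card_up_above[OF subF' that ext])
  have up0: "real (card (up \<F>' T)) \<le> (real m)\<^sup>2 * eps * ?B" if "finite T" "card T = t" for T
    using up_q[of T 0] that b_t1 by (simp add: power2_eq_square algebra_simps)
  have up1: "real (card (up \<F>' T)) \<le> real m * eps * ?B" if "finite T" "card T = t + 1" for T
    using up_q[of T 1] that b_t1 by (simp add: algebra_simps)
  have up2: "real (card (up \<F>' T)) \<le> eps * ?B" if "finite T" "card T = t + 2" for T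
    using up_q[of T 2] that b_t1 by (simp add: power2_eq_square algebra_simps)
  note S1 = gensD[OF S(1)] and S2 = gensD[OF S(2)]
  have cov: "t \<le> card (F \<inter> S1)" "t \<le> card (F \<inter> S2)" if "F \<in> \<F>'" for F
    using that F' S1 S2 by (auto simp: t_cover_def)
  from gens_Int_card[OF S] show ?thesis
  proof
    assume ct: "card (S1 \<inter> S2) = t"
    define X where "X = S1 \<inter> S2"
    obtain y1 y2 where y: "y1 \<noteq> y2" "y1 \<notin> X" "y2 \<notin> X" "S1 = insert y1 X" "S2 = insert y2 X"
      unfolding X_def using pair_gens_near[OF S(1,2) ct] by metis
    have X: "finite X" "card X = t" using S1 ct by (auto simp: X_def)
    let ?T = "\<lambda>x. insert y1 (insert y2 (X - {x}))"
    have sub: "\<F>' \<subseteq> up \<F>' X \<union> (\<Union>x\<in>X. up \<F>' (?T x))"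
    proof
      fix F assume F: "F \<in> \<F>'"
      have "X \<subseteq> F \<or> (\<exists>x\<in>X. F \<inter> X = X - {x} \<and> ?T x \<subseteq> F)"
        using cov[OF F] X y by (intro covers_near_pair) auto
      then show "F \<in> up \<F>' X \<union> (\<Union>x\<in>X. up \<F>' (?T x))" using F by (auto simp: up_def)
    qed
    have cT: "card (?T x) = t + 1" "finite (?T x)" if "x \<in> X" for x
      using that X y t2 by (auto simp: card_Diff_singleton_if)
    have "real (card \<F>') \<le> real (card (up \<F>' X \<union> (\<Union>x\<in>X. up \<F>' (?T x))))"
      using sub fup X by (auto intro!: card_mono)
    also have "\<dots> \<le> real (card (up \<F>' X)) + real (card (\<Union>x\<in>X. up \<F>' (?T x)))"
      by (rule real_card_Un_le)
    also have "\<dots> \<le> (real m)\<^sup>2 * eps * ?B + real (card X) * (real m * eps * ?B)"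
      using X cT by (intro add_mono up0 card_UN_le_mult up1) auto
    finally show ?thesis using X by (simp add: rest_coeff_def algebra_simps)
  next
    assume ct: "card (S1 \<inter> S2) = t - 1"
    define I where "I = (S1 - S2) \<times> (S2 - S1)"
    let ?T = "\<lambda>p. insert (fst p) (insert (snd p) (S1 \<inter> S2))" and ?U = "\<lambda>x. (S1 \<union> S2) - {x}"
    have sub: "\<F>' \<subseteq> (\<Union>p\<in>I. up \<F>' (?T p)) \<union> (\<Union>x\<in>S1 \<inter> S2. up \<F>' (?U x))"
    proof
      fix F assume F: "F \<in> \<F>'"
      from covers_far_pair[OF cov[OF F] S1(2,3) S2(2,3) ct]
      show "F \<in> (\<Union>p\<in>I. up \<F>' (?T p)) \<union> (\<Union>x\<in>S1 \<inter> S2. up \<F>' (?U x))"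
      proof
        assume "\<exists>a\<in>S1 - S2. \<exists>c\<in>S2 - S1. insert a (insert c (S1 \<inter> S2)) \<subseteq> F"
        then obtain a c where "(a, c) \<in> I" "?T (a, c) \<subseteq> F" by (auto simp: I_def)
        then have "F \<in> (\<Union>p\<in>I. up \<F>' (?T p))" using F by (intro UN_I[of "(a, c)"]) (auto simp: up_def)
        then show ?thesis by blast
      qed (use F in \<open>auto simp: up_def\<close>)
    qed
    have c2: "card (S1 - S2) = 2" "card (S2 - S1) = 2"
      using S1 S2 ct t2 by (simp_all add: card_Diff_subset_Int Int_commute)
    then have cI: "finite I" "card I = 4" using S1 S2 by (auto simp: I_def card_cartesian_product)
    have cT: "card (?T p) = t + 1" "finite (?T p)" if "p \<in> I" for p
      using that S1 S2 ct t2 by (auto simp: I_def card_insert_if)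
    have "card (S1 \<union> S2) = t + 3" using card_Un_Int[OF S1(2) S2(2)] S1 S2 ct t2 by simp
    then have cU: "card (?U x) = t + 2" "finite (?U x)" if "x \<in> S1 \<inter> S2" for x
      using that S1 S2 by (auto simp: card_Diff_singleton_if)
    have "real (card \<F>') \<le> real (card ((\<Union>p\<in>I. up \<F>' (?T p)) \<union> (\<Union>x\<in>S1 \<inter> S2. up \<F>' (?U x))))"
      by (rule of_nat_mono, rule card_mono[OF _ sub]) (use fup cI S1 in auto)
    also have "\<dots> \<le> real (card (\<Union>p\<in>I. up \<F>' (?T p))) + real (card (\<Union>x\<in>S1 \<inter> S2. up \<F>' (?U x)))"
      by (rule real_card_Un_le)
    also have "\<dots> \<le> real (card I) * (real m * eps * ?B) + real (card (S1 \<inter> S2)) * (eps * ?B)"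
      using cI cT cU S1 by (intro add_mono card_UN_le_mult up1 up2) auto
    also have "\<dots> = (4 * real m + (real t - 1)) * (eps * ?B)"
      using cI ct t2 by (simp add: of_nat_diff algebra_simps)
    also have "\<dots> \<le> ((real m)\<^sup>2 + real t * real m) * (eps * ?B)"
    proof (rule mult_right_mono)
      have m3: "3 \<le> real m" and tr: "2 \<le> real t" using m_ge t2 by auto
      \<comment> \<open>Expanded: m^2 + t m \<ge> 4 m + 3 (t - 1).\<close>
      have "0 \<le> (real m - 3) * (real m + real t - 1)" using m3 tr by (intro mult_nonneg_nonneg) auto
      then show "4 * real m + (real t - 1) \<le> (real m)\<^sup>2 + real t * real m"
        using m3 tr by (simp add: power2_eq_square algebra_simps)
    qed (use eps_pos b_nonneg in auto)
    finally show ?thesis by (simp add: rest_coeff_def algebra_simps)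
  qed
qed

lemma card_le_gens:
  assumes S: "S1 \<in> gens \<F>" "S2 \<in> gens \<F>" "S1 \<noteq> S2" "gens \<G> \<noteq> {}"
  shows "real (card \<F>) \<le> (real (card (gens \<G>)) + rest_coeff) * b (t + 1)"
proof -
  define \<F>' where "\<F>' = {F \<in> \<F>. \<forall>R\<in>gens \<G>. \<not> R \<subseteq> F}"
  have "\<F> \<subseteq> (\<Union>R\<in>gens \<G>. up \<F> R) \<union> \<F>'" by (auto simp: \<F>'_def up_def)
  then have "card \<F> \<le> card ((\<Union>R\<in>gens \<G>. up \<F> R) \<union> \<F>')"
    using finite_gens FG_finite finite_subset[OF up_subset] by (intro card_mono) (auto simp: \<F>'_def)
  also have "\<dots> \<le> card (\<Union>R\<in>gens \<G>. up \<F> R) + card \<F>'" by (rule card_Un_le)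
  finally have "real (card \<F>) \<le> real (card (\<Union>R\<in>gens \<G>. up \<F> R)) + real (card \<F>')" by linarith
  also have "\<dots> \<le> real (card (gens \<G>)) * b (t + 1) + rest_coeff * b (t + 1)"
    by (intro add_mono card_UN_le_mult finite_gens gens_up_card card_no_gen_le[OF S])
      (auto simp: \<F>'_def up_def)
  finally show ?thesis by (simp add: algebra_simps)
qed

text \<open>A generator of \<G> either contains X = S1 \<inter> S2, and is counted by the link, or
  contains, hence equals, one of the t sets in the second alternative of
  \<open>covers_near_pair\<close>.\<close>

lemma card_gens_near:
  assumes "S1 \<in> gens \<F>" "S2 \<in> gens \<F>" "card (S1 \<inter> S2) = t"
  shows "card (gens \<G>) \<le> card (link (gens \<G>) (S1 \<inter> S2)) + t"
proof -
  note S1 = gensD[OF assms(1)] and S2 = gensD[OF assms(2)]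
  define X where "X = S1 \<inter> S2"
  obtain y1 y2 where y: "y1 \<noteq> y2" "y1 \<notin> X" "y2 \<notin> X" "S1 = insert y1 X" "S2 = insert y2 X"
    unfolding X_def using pair_gens_near[OF assms] by metis
  have X: "finite X" "card X = t" using S1 assms by (auto simp: X_def)
  let ?T = "\<lambda>x. insert y1 (insert y2 (X - {x}))"
  have sub: "gens \<G> \<subseteq> (\<lambda>y. insert y X) ` link (gens \<G>) X \<union> ?T ` X"
  proof
    fix R assume R: "R \<in> gens \<G>"
    note R' = gensD[OF R]
    have "X \<subseteq> R \<or> (\<exists>x\<in>X. R \<inter> X = X - {x} \<and> ?T x \<subseteq> R)"
      using gens_cross[OF assms(1) R] gens_cross[OF assms(2) R] X y by (intro covers_near_pair) auto
    then show "R \<in> (\<lambda>y. insert y X) ` link (gens \<G>) X \<union> ?T ` X"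
    proof
      assume XR: "X \<subseteq> R"
      obtain z where "z \<in> R" "X = R - {z}"
        by (rule card_eq_Suc_diff_singleton[of R X]) (use R' X XR in auto)
      then have "z \<in> link (gens \<G>) X" "R = insert z X" using R by (auto simp: link_def insert_absorb)
      then show ?thesis by auto
    next
      assume "\<exists>x\<in>X. R \<inter> X = X - {x} \<and> ?T x \<subseteq> R"
      then obtain x where x: "x \<in> X" "?T x \<subseteq> R" by auto
      have "card (?T x) = t + 1" using x X y t2 by (auto simp: card_Diff_singleton_if)
      then have "?T x = R" using x R' by (intro card_subset_eq) auto
      then show ?thesis using x by auto
    qed
  qed
  have "card (gens \<G>) \<le> card ((\<lambda>y. insert y X) ` link (gens \<G>) X \<union> ?T ` X)"
    using sub finite_link_gens X by (intro card_mono) auto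
  also have "\<dots> \<le> card ((\<lambda>y. insert y X) ` link (gens \<G>) X) + card (?T ` X)" by (rule card_Un_le)
  also have "\<dots> \<le> card (link (gens \<G>) X) + card X"
    using finite_link_gens X by (intro add_mono card_image_le)
  finally show ?thesis using X by (simp add: X_def)
qed

text \<open>In \<open>covers_far_pair\<close> the second alternative would force t + 2 points into a
  (t + 1)-set; the first one determines the generator by one of 2 * 2 choices.\<close>

lemma gens_far:
  assumes "S1 \<in> gens \<F>" "S2 \<in> gens \<F>" "card (S1 \<inter> S2) = t - 1"
  shows "gens \<G> \<subseteq> (\<lambda>p. insert (fst p) (insert (snd p) (S1 \<inter> S2))) ` ((S1 - S2) \<times> (S2 - S1))"
    and "card (gens \<G>) \<le> 4"
proof -
  note S1 = gensD[OF assms(1)] and S2 = gensD[OF assms(2)]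
  have cU: "card (S1 \<union> S2) = t + 3" using card_Un_Int[OF S1(2) S2(2)] S1 S2 assms(3) t2 by simp
  have c2: "card (S1 - S2) = 2" "card (S2 - S1) = 2"
    using S1 S2 assms t2 by (simp_all add: card_Diff_subset_Int Int_commute)
  show sub: "gens \<G> \<subseteq> (\<lambda>p. insert (fst p) (insert (snd p) (S1 \<inter> S2))) ` ((S1 - S2) \<times> (S2 - S1))"
  proof
    fix R assume R: "R \<in> gens \<G>"
    note R' = gensD[OF R]
    have "(\<exists>a\<in>S1 - S2. \<exists>c\<in>S2 - S1. insert a (insert c (S1 \<inter> S2)) \<subseteq> R)
      \<or> (\<exists>x\<in>S1 \<inter> S2. (S1 \<union> S2) - {x} \<subseteq> R)"
      by (rule covers_far_pair[OF gens_cross[OF assms(1) R] gens_cross[OF assms(2) R] S1(2,3) S2(2,3) assms(3)])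
    moreover have "\<not> (S1 \<union> S2) - {x} \<subseteq> R" if "x \<in> S1 \<inter> S2" for x
      using card_mono[of R "(S1 \<union> S2) - {x}"] R' that cU by (auto simp: card_Diff_singleton_if)
    ultimately obtain a c where ac: "a \<in> S1 - S2" "c \<in> S2 - S1" "insert a (insert c (S1 \<inter> S2)) \<subseteq> R"
      by auto
    have "card (insert a (insert c (S1 \<inter> S2))) = t + 1"
      using ac S1 S2 assms t2 by (auto simp: card_insert_if)
    then have "insert a (insert c (S1 \<inter> S2)) = R" using ac R' by (intro card_subset_eq) auto
    then show "R \<in> (\<lambda>p. insert (fst p) (insert (snd p) (S1 \<inter> S2))) ` ((S1 - S2) \<times> (S2 - S1))"
      using ac by (intro image_eqI[of _ _ "(a, c)"]) auto
  qed
  have "card (gens \<G>) \<le> card ((S1 - S2) \<times> (S2 - S1))"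
    using S1 S2 by (intro surj_card_le[OF _ sub]) auto
  then show "card (gens \<G>) \<le> 4" using c2 by (simp add: card_cartesian_product)
qed

end

section \<open>A single generator\<close>

lemma real_card_UN_le_sum:
  "finite I \<Longrightarrow> real (card (\<Union>i\<in>I. A i)) \<le> (\<Sum>i\<in>I. real (card (A i)))"
  using card_UN_le[of I A] by (metis of_nat_le_iff of_nat_sum)

text \<open>Two diagonal products above c would multiply to more than c^2, but the same four factors
  form two off-diagonal products of at most c each. So at most one diagonal product exceeds c, and
  it is at most M E.\<close>

lemma diagonal_sum_bound:
  fixes f g :: "'a \<Rightarrow> real"
  assumes "finite I" "\<And>a. 0 \<le> f a" "\<And>a. 0 \<le> g a" "\<And>a. a \<in> I \<Longrightarrow> f a \<le> M" "\<And>a. a \<in> I \<Longrightarrow> g a \<le> E"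
    and "0 \<le> M" "0 \<le> E" "0 \<le> c" "\<And>a b. a \<in> I \<Longrightarrow> b \<in> I \<Longrightarrow> a \<noteq> b \<Longrightarrow> f a * g b \<le> c"
  shows "(\<Sum>a\<in>I. f a * g a) \<le> M * E + real (card I) * c"
proof (cases "\<exists>a0\<in>I. c < f a0 * g a0")
  case False
  then have "(\<Sum>a\<in>I. f a * g a) \<le> (\<Sum>a\<in>I. c)" by (intro sum_mono) auto
  then show ?thesis using assms(6,7) by (simp add: add_increasing)
next
  case True
  then obtain a0 where a0: "a0 \<in> I" "c < f a0 * g a0" by auto
  have "f a * g a \<le> c" if a: "a \<in> I - {a0}" for a
  proof (rule ccontr)
    assume "\<not> f a * g a \<le> c"
    then have "c * c < (f a * g a) * (f a0 * g a0)" using a0 assms(8) by (intro mult_strict_mono) auto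
    also have "\<dots> = (f a * g a0) * (f a0 * g a)" by simp
    also have "\<dots> \<le> c * c" using a a0 assms by (intro mult_mono) auto
    finally show False by simp
  qed
  then have "(\<Sum>a\<in>I - {a0}. f a * g a) \<le> (\<Sum>a\<in>I - {a0}. c)" by (rule sum_mono)
  also have "\<dots> \<le> real (card I) * c" using assms(1,8) by (auto intro!: mult_right_mono card_mono)
  finally have "(\<Sum>a\<in>I - {a0}. f a * g a) \<le> real (card I) * c" .
  moreover have "f a0 * g a0 \<le> M * E" using a0 assms by (intro mult_mono) auto
  ultimately show ?thesis using a0(1) assms(1) by (simp add: sum.remove[of I a0])
qed

text \<open>Meant for B members containing a generator S and, for each a in S, those missing just a.
  Only the mixed terms and a single diagonal product involve M and E; all other pairs cost
  c.\<close>

lemma cross_sum_bound: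
  fixes f g :: "'a \<Rightarrow> real"
  assumes "finite I" "\<And>a. 0 \<le> f a" "\<And>a. 0 \<le> g a" "\<And>a. a \<in> I \<Longrightarrow> f a \<le> M" "\<And>a. a \<in> I \<Longrightarrow> g a \<le> E"
    and "0 \<le> M" "0 \<le> E" "0 \<le> c" "\<And>a b. a \<in> I \<Longrightarrow> b \<in> I \<Longrightarrow> a \<noteq> b \<Longrightarrow> f a * g b \<le> c" "0 \<le> B"
  defines "N \<equiv> real (card I)"
  shows "(B + (\<Sum>a\<in>I. f a)) * (B + (\<Sum>a\<in>I. g a)) \<le> B\<^sup>2 + N * B * (M + E) + N * (N + 1) * c + M * E"
proof -
  have "(\<Sum>a\<in>I. f a) * (\<Sum>b\<in>I. g b) = (\<Sum>a\<in>I. \<Sum>b\<in>I. f a * g b)" by (rule sum_product)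
  also have "\<dots> \<le> (\<Sum>a\<in>I. f a * g a + N * c)"
  proof (rule sum_mono)
    fix a assume a: "a \<in> I"
    have "(\<Sum>b\<in>I. f a * g b) = f a * g a + (\<Sum>b\<in>I - {a}. f a * g b)"
      using a assms(1) by (simp add: sum.remove)
    also have "(\<Sum>b\<in>I - {a}. f a * g b) \<le> (\<Sum>b\<in>I - {a}. c)" using a assms by (intro sum_mono) auto
    also have "\<dots> \<le> N * c" unfolding N_def using assms(1,8) by (auto intro!: mult_right_mono card_mono)
    finally show "(\<Sum>b\<in>I. f a * g b) \<le> f a * g a + N * c" by simp
  qed
  also have "\<dots> = (\<Sum>a\<in>I. f a * g a) + N * (N * c)" by (simp add: sum.distrib N_def)
  also have "\<dots> \<le> (M * E + N * c) + N * (N * c)"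
    using diagonal_sum_bound[OF assms(1-9)] by (simp add: N_def)
  finally have 1: "(\<Sum>a\<in>I. f a) * (\<Sum>b\<in>I. g b) \<le> M * E + N * c + N * (N * c)" .
  have "(\<Sum>a\<in>I. f a) \<le> N * M" unfolding N_def using assms by (intro sum_bounded_above) auto
  then have 2: "B * (\<Sum>a\<in>I. f a) \<le> B * (N * M)" using assms(10) by (rule mult_left_mono)
  have "(\<Sum>a\<in>I. g a) \<le> N * E" unfolding N_def using assms by (intro sum_bounded_above) auto
  then have 3: "B * (\<Sum>a\<in>I. g a) \<le> B * (N * E)" using assms(10) by (rule mult_left_mono)
  show ?thesis using 1 2 3 by (simp add: power2_eq_square algebra_simps)
qed

context params
begin

lemma card_le_traces:
  assumes "\<H> \<subseteq> nsets {1..n} k" "finite S" "card S = t + 1" "t_cover t \<H> S"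
  shows "real (card \<H>) \<le> b (t + 1) + (\<Sum>a\<in>S. real (card (trace \<H> S (S - {a}))))"
proof -
  have sub: "\<H> \<subseteq> up \<H> S \<union> (\<Union>a\<in>S. trace \<H> S (S - {a}))"
  proof
    fix F assume F: "F \<in> \<H>"
    then have "S \<subseteq> F \<or> (\<exists>a\<in>S. F \<inter> S = S - {a})"
      using assms by (intro Int_eq_or_Diff_singleton) (auto simp: t_cover_def)
    then show "F \<in> up \<H> S \<union> (\<Union>a\<in>S. trace \<H> S (S - {a}))" using F by (auto simp: up_def trace_def)
  qed
  have fin: "finite \<H>" by (rule finite_nsets_subset[OF assms(1)])
  have "real (card \<H>) \<le> real (card (up \<H> S \<union> (\<Union>a\<in>S. trace \<H> S (S - {a}))))"
    using fin finite_subset[OF up_subset fin] finite_subset[OF trace_subset fin] assms(2)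
    by (intro of_nat_mono card_mono[OF _ sub]) auto
  also have "\<dots> \<le> real (card (up \<H> S)) + real (card (\<Union>a\<in>S. trace \<H> S (S - {a})))"
    by (rule real_card_Un_le)
  also have "\<dots> \<le> b (t + 1) + (\<Sum>a\<in>S. real (card (trace \<H> S (S - {a}))))"
    using card_up_le[OF assms(1,2)] assms(2,3) by (intro add_mono real_card_UN_le_sum) auto
  finally show ?thesis .
qed

text \<open>q is what \<open>cross_sum_bound\<close> gives for t + 1 indices. Its main term (t + 1)
  m falls short of \<open>leading_deg\<close>^2 by at least \<open>leading_deg\<close>; this gap
  absorbs the other terms and the loss in \<open>target\<close>.\<close>

lemma one_generator_numeric:
  defines "q \<equiv> 1 + (real t + 1) * (real m + (real m)\<^sup>2 * eps)
    + (real t + 1) * (real t + 2) * (2 * (real m * eps)) + real m ^ 3 * eps"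
  shows "q * (b (t + 1))\<^sup>2 < (real target)\<^sup>2"
proof -
  define u where "u = real t + 2"
  define w where "w = u\<^sup>2 * eps"
  let ?m = "real m"
  have u: "4 \<le> u" using t2 by (simp add: u_def)
  have w: "15 * w \<le> 1" "0 \<le> w" using u2_eps eps_pos by (auto simp: w_def u_def mult.assoc)
  have m3: "3 \<le> ?m" using m_ge by simp
  have q: "q = 1 + (u - 1) * ?m + (u - 1) * (?m\<^sup>2 * eps) + 2 * ((u - 1) * (u * ?m * eps)) + ?m * (?m\<^sup>2 * eps)"
    by (simp add: q_def u_def power2_eq_square power3_eq_cube algebra_simps)
  have nn: "0 \<le> ?m\<^sup>2 * eps" "0 \<le> u * ?m * eps" using eps_pos u by auto
  have B2: "0 < (b (t + 1))\<^sup>2" using B_pos by simp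
  show ?thesis
  proof (cases "m \<le> t + 2")
    case True
    then have mu: "?m \<le> u" by (simp add: u_def)
    have a: "?m\<^sup>2 * eps \<le> w" unfolding w_def using mu eps_pos by (intro mult_right_mono power_mono) auto
    have c: "u * ?m * eps \<le> w" unfolding w_def power2_eq_square using mu u eps_pos
      by (intro mult_right_mono mult_left_mono) auto
    have "(u - 1) * ?m \<le> (u - 1) * u" using mu u by (intro mult_left_mono) auto
    moreover have "(u - 1) * (?m\<^sup>2 * eps) \<le> u * w" using a u w nn by (intro mult_mono) auto
    moreover have "(u - 1) * (u * ?m * eps) \<le> u * w" using c u w nn by (intro mult_mono) auto
    moreover have "?m * (?m\<^sup>2 * eps) \<le> u * w" using a u w nn mu by (intro mult_mono) auto
    moreover have "u * (15 * w) \<le> u * 1" using w u by (intro mult_left_mono) auto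
    moreover have "(u - 1) * u = u\<^sup>2 - u" by (simp add: power2_eq_square algebra_simps)
    ultimately have "q < u\<^sup>2 - 2 / 15" using u unfolding q by linarith
    then have "q * (b (t + 1))\<^sup>2 < (u\<^sup>2 - 2 / 15) * (b (t + 1))\<^sup>2" using B2 by (rule mult_strict_right_mono)
    then show ?thesis using target_sq_small[OF True] by (simp add: u_def)
  next
    case False
    then have m_ge3: "t + 3 \<le> m" by simp
    then have mu: "u + 1 \<le> ?m" by (simp add: u_def)
    have cube: "?m ^ 3 * eps = ?m * (?m\<^sup>2 * eps)" by (simp add: power2_eq_square power3_eq_cube)
    have "q < ?m\<^sup>2 - ?m ^ 3 * eps"
    proof (cases "?m \<le> 2 * u")
      case True
      have a: "?m\<^sup>2 * eps \<le> 4 * w"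
      proof -
        have "?m\<^sup>2 * eps \<le> (2 * u)\<^sup>2 * eps" using True eps_pos by (intro mult_right_mono power_mono) auto
        then show ?thesis by (simp add: w_def power2_eq_square)
      qed
      have c: "u * ?m * eps \<le> 2 * w"
      proof -
        have "u * ?m * eps \<le> u * (2 * u) * eps" using True u eps_pos
          by (intro mult_right_mono mult_left_mono) auto
        then show ?thesis by (simp add: w_def power2_eq_square)
      qed
      have "(u - 1) * ?m \<le> (?m - 2) * ?m" using mu by (intro mult_right_mono) auto
      moreover have "(u - 1) * (?m\<^sup>2 * eps) \<le> ?m * (2 * w)"
      proof -
        have "(u - 1) * (?m\<^sup>2 * eps) \<le> u * (?m\<^sup>2 * eps)" using nn by (intro mult_right_mono) auto
        also have "\<dots> = ?m * (u * ?m * eps)" by (simp add: power2_eq_square)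
        also have "\<dots> \<le> ?m * (2 * w)" using c by (intro mult_left_mono) auto
        finally show ?thesis .
      qed
      moreover have "(u - 1) * (u * ?m * eps) \<le> ?m * (2 * w)" by (rule mult_mono) (use c u w nn mu in auto)
      moreover have "?m * (?m\<^sup>2 * eps) \<le> ?m * (4 * w)" using a by (intro mult_left_mono) auto
      moreover have "?m * (15 * w) \<le> ?m * 1" using w by (intro mult_left_mono) auto
      moreover have "(?m - 2) * ?m = ?m\<^sup>2 - 2 * ?m" by (simp add: power2_eq_square algebra_simps)
      ultimately show ?thesis using m3 unfolding q cube by linarith
    next
      case False
      have a: "10 * (?m\<^sup>2 * eps) \<le> ?m" using m2_eps by (simp add: mult.assoc)
      have "(u - 1) * ?m \<le> (?m / 2 - 1) * ?m" using False by (intro mult_right_mono) auto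
      moreover have "(u - 1) * (?m\<^sup>2 * eps) \<le> ?m / 2 * (?m / 10)" using a False nn u by (intro mult_mono) auto
      moreover have "(u - 1) * (u * ?m * eps) \<le> ?m * w"
      proof -
        have "(u - 1) * (u * ?m * eps) \<le> u * (u * ?m * eps)" using nn by (intro mult_right_mono) auto
        then show ?thesis by (simp add: w_def power2_eq_square algebra_simps)
      qed
      moreover have "?m * (?m\<^sup>2 * eps) \<le> ?m * (?m / 10)" using a by (intro mult_left_mono) auto
      moreover have "?m * (15 * w) \<le> ?m * 1" using w by (intro mult_left_mono) auto
      moreover have "(?m / 2 - 1) * ?m = ?m\<^sup>2 / 2 - ?m" "?m / 2 * (?m / 10) = ?m\<^sup>2 / 20" "?m * (?m / 10) = ?m\<^sup>2 / 10"
        by (simp_all add: power2_eq_square algebra_simps)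
      moreover have "3 * ?m \<le> ?m\<^sup>2" unfolding power2_eq_square using m3 by (intro mult_right_mono) auto
      ultimately show ?thesis using m3 unfolding q cube by linarith
    qed
    then have "q * (b (t + 1))\<^sup>2 < (?m\<^sup>2 - ?m ^ 3 * eps) * (b (t + 1))\<^sup>2" using B2 by (rule mult_strict_right_mono)
    then show ?thesis using target_sq_large[OF m_ge3] by simp
  qed
qed

text \<open>11/25 from the product bound and 1/60 for the term with eps leave more than 0.4
  \<open>leading_deg\<close>^2 for 2 m.\<close>

lemma one_generator_asym_numeric:
  defines "q \<equiv> 2 * real m + (real t + 1) * ((real m)\<^sup>2 * eps) + 11 / 25 * leading_deg\<^sup>2"
  shows "q * (b (t + 1))\<^sup>2 < (real target)\<^sup>2"
proof -
  have B2: "0 < (b (t + 1))\<^sup>2" using B_pos by simp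
  let ?m = "real m" and ?u = "real t + 2"
  have "(real t + 1) * (?m\<^sup>2 * eps) \<le> ?u * (?m\<^sup>2 * eps)"
    using eps_pos by (intro mult_right_mono) auto
  also have "\<dots> = ?m\<^sup>2 * (?u * eps)" by simp
  finally have "(real t + 1) * (?m\<^sup>2 * eps) \<le> ?m\<^sup>2 * (?u * eps)" .
  moreover have "?m\<^sup>2 * (60 * (?u * eps)) \<le> ?m\<^sup>2 * 1" using u_eps by (intro mult_left_mono) auto
  moreover have "?m\<^sup>2 \<le> leading_deg\<^sup>2" using leading_deg_ge by (intro power_mono) auto
  ultimately have q: "q \<le> 2 * ?m + leading_deg\<^sup>2 / 60 + 11 / 25 * leading_deg\<^sup>2" unfolding q_def by linarith
  show ?thesis
  proof (cases "m \<le> t + 2")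
    case True
    have d: "leading_deg = ?u" by (rule target_sq_small(2)[OF True])
    have mu: "?m \<le> ?u" using True by linarith
    have u: "4 \<le> ?u" using t2 by simp
    have "4 * ?u \<le> ?u\<^sup>2" unfolding power2_eq_square using u by (intro mult_right_mono) auto
    then have "2 * ?m + ?u\<^sup>2 / 60 + 11 / 25 * ?u\<^sup>2 < ?u\<^sup>2 - 2 / 15" using mu u
    proof -
      have "2 * ?m + v / 60 + 11 / 25 * v < v - 2 / 15" if "4 * w \<le> v" "?m \<le> w" "4 \<le> w" for v w :: real
        using that by linarith
      then show ?thesis using \<open>4 * ?u \<le> ?u\<^sup>2\<close> mu u by blast
    qed
    then have "q < ?u\<^sup>2 - 2 / 15" using q unfolding d by (rule le_less_trans[rotated])
    then have "q * (b (t + 1))\<^sup>2 < (?u\<^sup>2 - 2 / 15) * (b (t + 1))\<^sup>2" using B2 by (rule mult_strict_right_mono)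
    then show ?thesis using target_sq_small(1)[OF True] by linarith
  next
    case False
    then have m3: "t + 3 \<le> m" by simp
    have d: "leading_deg = ?m" by (rule target_sq_large(2)[OF m3])
    have m5: "5 \<le> ?m" using m3 t2 by linarith
    have "5 * ?m \<le> ?m\<^sup>2" unfolding power2_eq_square using m5 by (intro mult_right_mono) auto
    then have "q < 0.9 * leading_deg\<^sup>2" using q m5 unfolding d by linarith
    then show ?thesis by (rule less_target_sq_if[OF order_refl])
  qed
qed

end

context closed_pair
begin

text \<open>Members of \<G> not containing S contain no generator of \<F>, which gives them an extra
  branching step. If S also covers \<G>, both families split by the point of S that a member misses.
  If not, some G1 in \<G> meets S in fewer than t points and lets most parts of \<F> branch
  twice.\<close>

lemma less_target_if_one_gen:
  assumes one: "gens \<F> = {S}"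
  shows "real (card \<F>) * real (card \<G>) < (real target)\<^sup>2"
proof -
  have Sg: "S \<in> gens \<F>" using one by simp
  note S = gensD[OF Sg]
  let ?B = "b (t + 1)"
  have B0: "0 \<le> ?B" by (rule b_nonneg)
  have upF: "real (card (up \<F> (S - {a}))) \<le> real m * ?B" if "a \<in> S" for a
  proof -
    have "real (card (up \<F> (S - {a}))) \<le> (real m * eps) ^ (1 - 0) * (eps ^ 0 * b t)"
      by (rule card_up_above[OF F_sub]) (use S that ext_F_small in auto)
    then show ?thesis using b_t1 by (simp add: mult.assoc)
  qed
  show ?thesis
  proof (cases "S \<in> gens \<G>")
    case True
    define f g where "f a = real (card (trace \<F> S (S - {a})))"
      and "g a = real (card (trace \<G> S (S - {a})))" for a
    have extg: "extends_by m (trace \<G> S (S - {a})) T" if "a \<in> S" "finite T" "card T < t + 2" for a T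
      by (rule ext_G_no_gen[OF trace_subset _ that(2,3)]) (use that(1) one in \<open>auto simp: up_def trace_def\<close>)
    have tsub: "trace \<F> S A \<subseteq> nsets {1..n} k" "trace \<G> S A \<subseteq> nsets {1..n} k" for A
      using trace_subset F_sub G_sub by blast+
    have fM: "f a \<le> real m * ?B" if a: "a \<in> S" for a
    proof -
      have "card (trace \<F> S (S - {a})) \<le> card (up \<F> (S - {a}))"
        using FG_finite finite_subset[OF up_subset] by (intro card_mono) (auto simp: trace_def up_def)
      then show ?thesis using upF[OF a] by (simp add: f_def)
    qed
    have gE: "g a \<le> (real m)\<^sup>2 * eps * ?B" if a: "a \<in> S" for a
    proof -
      have "up (trace \<G> S (S - {a})) (S - {a}) = trace \<G> S (S - {a})" by (auto simp: up_def trace_def)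
      moreover have "real (card (up (trace \<G> S (S - {a})) (S - {a}))) \<le> (real m * eps) ^ (2 - 0) * (eps ^ 0 * b t)"
        by (rule card_up_above[OF tsub(2)]) (use S a extg[OF a] in auto)
      ultimately show ?thesis using b_t1 by (simp add: g_def power2_eq_square algebra_simps)
    qed
    \<comment> \<open>\<open>card_mult_traces_le\<close> with l = 1 and i = 2: the traces share t -
      1 points, and one extra step of \<G> remains, whence the factor 2 m * eps.\<close>
    have fg: "f a * g c \<le> 2 * (real m * eps) * ?B\<^sup>2" if ac: "a \<in> S" "c \<in> S" "a \<noteq> c" for a c
    proof -
      have cd: "card (S - {a}) = t" "card (S - {c}) = t" using ac S by auto
      have "(S - {a}) \<inter> (S - {c}) = S - {a, c}" by auto
      moreover have "card (S - {a, c}) = t - 1" using ac S by (subst card_Diff_subset) auto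
      ultimately have l: "card ((S - {a}) \<inter> (S - {c})) + 1 = t" using t2 by simp
      have "f a * g c \<le> 4 ^ (1 - 1) * (2 * (real m * eps)) ^ (2 - (card (S - {c}) + 1 - t)) *
          (b (card (S - {a}) + 1) * b (card (S - {c}) + 1))"
        unfolding f_def g_def
      proof (rule card_mult_traces_le[OF tsub _ S(2) _ _ _ _ l])
        show "cross_intersecting t (trace \<F> S (S - {a})) (trace \<G> S (S - {c}))"
          by (rule cross_intersecting_mono[OF cross trace_subset trace_subset])
      qed (use extg[OF ac(2)] in \<open>auto simp: trace_def\<close>)
      then show ?thesis using cd by (simp add: power2_eq_square)
    qed
    have card_le: "real (card \<F>) \<le> ?B + (\<Sum>a\<in>S. f a)" "real (card \<G>) \<le> ?B + (\<Sum>a\<in>S. g a)"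
      unfolding f_def g_def using card_le_traces[OF F_sub S(2,3,4)]
        card_le_traces[OF G_sub S(2,3) gensD(4)[OF True]] by auto
    have "real (card \<F>) * real (card \<G>) \<le> (?B + (\<Sum>a\<in>S. f a)) * (?B + (\<Sum>a\<in>S. g a))"
      by (rule mult_mono[OF card_le]) (use B0 in \<open>auto simp: f_def g_def intro!: add_nonneg_nonneg sum_nonneg\<close>)
    also have "\<dots> \<le> ?B\<^sup>2 + real (card S) * ?B * (real m * ?B + (real m)\<^sup>2 * eps * ?B)
        + real (card S) * (real (card S) + 1) * (2 * (real m * eps) * ?B\<^sup>2)
        + (real m * ?B) * ((real m)\<^sup>2 * eps * ?B)"
      by (rule cross_sum_bound[OF S(2) _ _ fM gE _ _ _ fg])
        (use B0 eps_pos in \<open>auto simp: f_def g_def\<close>)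
    also have "\<dots> = (1 + (real t + 1) * (real m + (real m)\<^sup>2 * eps)
        + (real t + 1) * (real t + 2) * (2 * (real m * eps)) + real m ^ 3 * eps) * ?B\<^sup>2"
      using S by (simp add: power2_eq_square power3_eq_cube algebra_simps)
    also have "\<dots> < (real target)\<^sup>2" by (rule one_generator_numeric)
    finally show ?thesis .
  next
    case False
    then have "\<not> t_cover t \<G> S" using Sg by (auto simp: gens_def)
    then obtain G1 where G1: "G1 \<in> \<G>" "card (G1 \<inter> S) < t" by (auto simp: t_cover_def not_le)
    have G1k: "finite G1" using G_mem[OF G1(1)] by simp
    \<comment> \<open>S' collects the points for which a second step is not guaranteed: for the
      others, S - {a} with any further point still meets G1 in fewer than t points. If S' is
      nonempty, G1 meets S in exactly t - 1 points and S' lies among the two points of S -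
      G1.\<close>
    define S' where "S' = {a \<in> S. t - 1 \<le> card (G1 \<inter> (S - {a}))}"
    let ?M = "real m * ?B" and ?E = "(real m)\<^sup>2 * eps * ?B"
    have E0: "0 \<le> ?E" using eps_pos B0 by simp
    have S': "finite S'" "card S' \<le> 2"
    proof -
      show "finite S'" using S by (simp add: S'_def)
      show "card S' \<le> 2"
      proof (cases "S' = {}")
        case False
        then obtain a0 where "a0 \<in> S'" by auto
        then have "t - 1 \<le> card (G1 \<inter> (S - {a0}))" by (simp add: S'_def)
        also have "\<dots> \<le> card (G1 \<inter> S)" using G1k by (intro card_mono) auto
        finally have c: "card (G1 \<inter> S) = t - 1" using G1(2) t2 by simp
        have "S' \<subseteq> S - G1"
        proof
          fix a assume a: "a \<in> S'"
          have "a \<notin> G1"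
          proof
            assume "a \<in> G1"
            then have "G1 \<inter> (S - {a}) = (G1 \<inter> S) - {a}" "a \<in> G1 \<inter> S" using a by (auto simp: S'_def)
            then have "card (G1 \<inter> (S - {a})) = card (G1 \<inter> S) - 1" by (simp add: card_Diff_singleton)
            then have "t - 1 \<le> t - 1 - 1" using a c by (simp add: S'_def)
            then show False using t2 by linarith
          qed
          then show "a \<in> S - G1" using a by (simp add: S'_def)
        qed
        then have "card S' \<le> card (S - G1)" using S by (intro card_mono) auto
        also have "\<dots> = 2" using S c t2 by (simp add: card_Diff_subset_Int Int_commute)
        finally show ?thesis .
      qed simp
    qed
    have upE: "real (card (up \<F> (S - {a}))) \<le> ?E" if a: "a \<in> S - S'" for a
    proof -
      have lt: "card (G1 \<inter> (S - {a})) < t - 1" using a by (auto simp: S'_def)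
      have "real (card (up \<F> (S - {a}))) \<le> real m ^ 2 * b (card (S - {a}) + 2)"
      proof (rule card_up_rec[OF F_sub])
        fix T assume T: "S - {a} \<subseteq> T" "finite T" "card T < card (S - {a}) + 2"
        have "card (T - (S - {a})) \<le> 1" using T S by (subst card_Diff_subset) auto
        moreover have "card (G1 \<inter> T) \<le> card (G1 \<inter> (S - {a})) + card (T - (S - {a}))"
        proof -
          have "card (G1 \<inter> T) \<le> card (G1 \<inter> (S - {a}) \<union> (T - (S - {a})))"
            using T G1k by (intro card_mono) auto
          also have "\<dots> \<le> card (G1 \<inter> (S - {a})) + card (T - (S - {a}))" by (rule card_Un_le)
          finally show ?thesis .
        qed
        ultimately have "card (G1 \<inter> T) < t" using lt by linarith
        then show "extends_by m \<F> T" using G1(1) by (intro ext_F) (auto simp: t_cover_def not_le)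
      qed (use S in auto)
      also have "\<dots> \<le> real m ^ 2 * (eps * ?B)"
        using b_t2_le a S by (intro mult_left_mono) auto
      finally show ?thesis by (simp add: mult.assoc)
    qed
    have sub: "\<F> \<subseteq> (\<Union>a\<in>S'. up \<F> (S - {a})) \<union> (\<Union>a\<in>S - S'. up \<F> (S - {a}))"
    proof
      fix F assume F: "F \<in> \<F>"
      have "S \<subseteq> F \<or> (\<exists>x\<in>S. F \<inter> S = S - {x})"
        using S F by (intro Int_eq_or_Diff_singleton) (auto simp: t_cover_def)
      moreover obtain a0 where "a0 \<in> S" using S by fastforce
      ultimately obtain a where "a \<in> S" "S - {a} \<subseteq> F" by blast
      then show "F \<in> (\<Union>a\<in>S'. up \<F> (S - {a})) \<union> (\<Union>a\<in>S - S'. up \<F> (S - {a}))"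
        using F by (auto simp: up_def)
    qed
    have fup: "finite (up \<F> T)" for T using finite_subset[OF up_subset] FG_finite by blast
    have "real (card \<F>) \<le> real (card ((\<Union>a\<in>S'. up \<F> (S - {a})) \<union> (\<Union>a\<in>S - S'. up \<F> (S - {a}))))"
      by (rule of_nat_mono, rule card_mono[OF _ sub]) (use fup S S' in auto)
    also have "\<dots> \<le> real (card (\<Union>a\<in>S'. up \<F> (S - {a}))) + real (card (\<Union>a\<in>S - S'. up \<F> (S - {a})))"
      by (rule real_card_Un_le)
    also have "\<dots> \<le> real (card S') * ?M + real (card (S - S')) * ?E"
      using S S' upF upE by (intro add_mono card_UN_le_mult) (auto simp: S'_def)
    also have "\<dots> \<le> 2 * ?M + (real t + 1) * ?E"
    proof (intro add_mono mult_right_mono)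
      have "card (S - S') \<le> card S" using S by (intro card_mono) auto
      then show "real (card (S - S')) \<le> real t + 1" using S by simp
    qed (use S' E0 B0 in auto)
    finally have cF: "real (card \<F>) \<le> 2 * ?M + (real t + 1) * ?E" .
    \<comment> \<open>At most \<open>b (t + 1)\<close> members of \<G> contain S. The rest contain
      no generator, so the product bound applies to them with the cover S and i = 2.\<close>
    define \<G>' where "\<G>' = {G \<in> \<G>. \<not> S \<subseteq> G}"
    have prod': "real (card \<F>) * real (card \<G>') \<le> 11 / 25 * leading_deg\<^sup>2 * ?B\<^sup>2"
    proof (rule card_mult_le_if_no_small_generator[of _ _ S 2])
      show "extends_by m \<G>' T" if "finite T" "card T < t + 2" for T
        by (rule ext_G_no_gen[OF _ _ that]) (use one in \<open>auto simp: \<G>'_def up_def\<close>)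
      show "cross_intersecting t \<F> \<G>'"
        by (rule cross_intersecting_mono[OF cross]) (auto simp: \<G>'_def)
    qed (use F_sub G_sub S ext_F_small in \<open>auto simp: \<G>'_def\<close>)
    have "\<G> \<subseteq> up \<G> S \<union> \<G>'" by (auto simp: up_def \<G>'_def)
    then have "card \<G> \<le> card (up \<G> S \<union> \<G>')"
      using FG_finite finite_subset[OF up_subset] by (intro card_mono) (auto simp: \<G>'_def)
    then have "real (card \<G>) \<le> ?B + real (card \<G>')"
      using real_card_Un_le[of "up \<G> S" \<G>'] card_up_le[OF G_sub S(2)] S(3) by simp
    then have "real (card \<F>) * real (card \<G>) \<le> real (card \<F>) * (?B + real (card \<G>'))"
      by (intro mult_left_mono) auto
    also have "\<dots> = real (card \<F>) * ?B + real (card \<F>) * real (card \<G>')" by (simp add: algebra_simps)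
    also have "\<dots> \<le> (2 * ?M + (real t + 1) * ?E) * ?B + 11 / 25 * leading_deg\<^sup>2 * ?B\<^sup>2"
      by (intro add_mono mult_right_mono cF B0 prod')
    also have "\<dots> = (2 * real m + (real t + 1) * ((real m)\<^sup>2 * eps) + 11 / 25 * leading_deg\<^sup>2) * ?B\<^sup>2"
      by (simp add: power2_eq_square algebra_simps)
    also have "\<dots> < (real target)\<^sup>2" by (rule one_generator_asym_numeric)
    finally show ?thesis .
  qed
qed

end

section \<open>Several generators\<close>

text \<open>Deleting a point of R \<inter> Z still leaves t points.\<close>

lemma card_Int_ge_Suc:
  assumes "finite Z" "1 \<le> t" "Z \<noteq> {}" "\<And>z. z \<in> Z \<Longrightarrow> t \<le> card (R \<inter> (Z - {z}))"
  shows "t + 1 \<le> card (R \<inter> Z)"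
proof (cases "R \<inter> Z = {}")
  case True
  then obtain z where "z \<in> Z" "R \<inter> (Z - {z}) = {}" using assms(3) by auto
  then show ?thesis using assms(4)[of z] assms(2) by simp
next
  case False
  then obtain z where z: "z \<in> R \<inter> Z" by auto
  have "R \<inter> (Z - {z}) = R \<inter> Z - {z}" by auto
  then have "t \<le> card (R \<inter> Z) - 1" using assms(4)[of z] z by (simp add: card_Diff_singleton)
  moreover have "0 < card (R \<inter> Z)" using False assms(1) by (simp add: card_gt_0_iff)
  ultimately show ?thesis by linarith
qed

section \<open>Numerical estimates for several generators\<close>

context params
begin

lemma rest_coeff_nonneg: "0 \<le> rest_coeff"
  using eps_pos by (simp add: rest_coeff_def)

text \<open>m + t = k + 1 turns \<open>rest_coeff\<close> into m (k + 1) eps. After multiplication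
  by k^2, the bounds 10 k^2 eps \<le> m - 1 \<le> k - 1 and (k + 1) (k - 1) \<le> k^2
  finish.\<close>

lemma rest_coeff_le_m: "10 * rest_coeff \<le> real m"
proof -
  let ?k = "real k" and ?m = "real m"
  have tk: "real t = ?k + 1 - ?m" using m_real by simp
  have "?k\<^sup>2 * (10 * rest_coeff) = ?m * (?k + 1) * (10 * ?k\<^sup>2 * eps)"
    by (simp add: rest_coeff_def tk power2_eq_square algebra_simps)
  also have "\<dots> \<le> ?m * (?k + 1) * (?m - 1)" using eps_le2 by (intro mult_left_mono) auto
  also have "\<dots> \<le> ?m * (?k + 1) * (?k - 1)" using m_less_k by (intro mult_left_mono) auto
  also have "\<dots> \<le> ?k\<^sup>2 * ?m" by (simp add: power2_eq_square algebra_simps)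
  finally show ?thesis using k_ge4 by simp
qed

lemma rest_coeff_small: "m \<le> t + 2 \<Longrightarrow> 15 * rest_coeff \<le> 2"
proof -
  assume "m \<le> t + 2"
  then have mu: "real m \<le> real t + 2" by linarith
  have "(real m)\<^sup>2 + real t * real m \<le> (real t + 2)\<^sup>2 + (real t + 2) * (real t + 2)"
    using mu by (intro add_mono mult_mono power_mono) auto
  then have "rest_coeff \<le> (2 * (real t + 2)\<^sup>2) * eps" unfolding rest_coeff_def using eps_pos
    by (intro mult_right_mono) (auto simp: power2_eq_square)
  then show ?thesis using u2_eps by simp
qed

lemma two_generators_numeric:
  "(real m + real t + rest_coeff) * (2 + rest_coeff) * (b (t + 1))\<^sup>2 < (real target)\<^sup>2"
proof (rule less_target_sq_if[OF order_refl])
  let ?u = "real t + 2" and ?m = "real m"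
  show "(?m + real t + rest_coeff) * (2 + rest_coeff) < 0.9 * leading_deg\<^sup>2"
  proof (cases "m \<le> t + 2")
    case True
    have "(?m + real t + rest_coeff) * (2 + rest_coeff) \<le> (2 * ?u - 2 + 2 / 15) * (2 + 2 / 15)"
      using True rest_coeff_small[OF True] rest_coeff_nonneg by (intro mult_mono) auto
    also have "\<dots> < 0.9 * ?u\<^sup>2"
    proof -
      \<comment> \<open>The square supplies v^2 \<ge> 8 v - 16, the tangent at 4, the smallest value
        of t + 2, and makes the inequality linear.\<close>
      have aux: "0 \<le> (v - 4)\<^sup>2 \<Longrightarrow> 4 \<le> v \<Longrightarrow> (2 * v - 2 + 2 / 15) * (2 + 2 / 15) < 0.9 * v\<^sup>2" for v :: real
        by (simp add: power2_eq_square algebra_simps)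
      show ?thesis by (rule aux) (use t2 in auto)
    qed
    finally show ?thesis using target_sq_small(2)[OF True] by simp
  next
    case False
    then have m3: "t + 3 \<le> m" by simp
    then have mr: "real t + 3 \<le> ?m" "5 \<le> ?m" using t2 by linarith+
    have "(?m + real t + rest_coeff) * (2 + rest_coeff) \<le> (2 * ?m - 3 + ?m / 10) * (2 + ?m / 10)"
      using mr rest_coeff_le_m rest_coeff_nonneg by (intro mult_mono) auto
    also have "\<dots> < 0.9 * ?m\<^sup>2"
    proof -
      have aux: "0 \<le> (v - 3)\<^sup>2 \<Longrightarrow> 5 \<le> v \<Longrightarrow> (2 * v - 3 + v / 10) * (2 + v / 10) < 0.9 * v\<^sup>2" for v :: real
        by (simp add: power2_eq_square field_simps)
      show ?thesis by (rule aux) (use mr in auto)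
    qed
    finally show ?thesis using target_sq_large(2)[OF m3] by simp
  qed
qed

text \<open>One generator fewer than t + 2 on one side leaves (t + 2) (t + 1), short of (t + 2)^2 by
  t + 2; this gap absorbs \<open>rest_coeff\<close>.\<close>

lemma few_generators_numeric:
  "(real t + 2 + rest_coeff) * (real t + 1 + rest_coeff) * (b (t + 1))\<^sup>2 < (real target)\<^sup>2"
proof -
  let ?u = "real t + 2" and ?m = "real m"
  have B2: "0 < (b (t + 1))\<^sup>2" using B_pos by simp
  show ?thesis
  proof (cases "m \<le> t + 2")
    case True
    have "(?u + rest_coeff) * (real t + 1 + rest_coeff) \<le> (?u + 2 / 15) * (?u - 1 + 2 / 15)"
      using rest_coeff_small[OF True] rest_coeff_nonneg by (intro mult_mono) auto
    also have "\<dots> < ?u\<^sup>2 - 2 / 15"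
    proof -
      have aux: "4 \<le> v \<Longrightarrow> (v + 2 / 15) * (v - 1 + 2 / 15) < v\<^sup>2 - 2 / 15" for v :: real
        by (simp add: power2_eq_square field_simps)
      show ?thesis by (rule aux) (use t2 in auto)
    qed
    finally have "(?u + rest_coeff) * (real t + 1 + rest_coeff) * (b (t + 1))\<^sup>2 < (?u\<^sup>2 - 2 / 15) * (b (t + 1))\<^sup>2"
      using B2 by (rule mult_strict_right_mono)
    then show ?thesis using target_sq_small(1)[OF True] by linarith
  next
    case False
    then have m3: "t + 3 \<le> m" by simp
    then have mr: "real t + 3 \<le> ?m" "5 \<le> ?m" using t2 by linarith+
    have cube: "?m ^ 3 * eps = ?m * (?m\<^sup>2 * eps)" by (simp add: power2_eq_square power3_eq_cube)
    have "(?u + rest_coeff) * (real t + 1 + rest_coeff) < ?m\<^sup>2 - ?m ^ 3 * eps"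
    proof (cases "?m \<le> 2 * ?u")
      case True
      have a: "?m\<^sup>2 * eps \<le> (2 * ?u)\<^sup>2 * eps" using True eps_pos by (intro mult_right_mono power_mono) auto
      also have "(2 * ?u)\<^sup>2 * eps = 4 * (?u\<^sup>2 * eps)" by (simp only: power_mult_distrib) simp
      finally have a: "?m\<^sup>2 * eps \<le> 4 / 15" using u2_eps by (simp add: mult.assoc)
      have "real t * ?m * eps \<le> ?u * (2 * ?u) * eps" using True eps_pos
        by (intro mult_right_mono mult_mono) auto
      also have "\<dots> = 2 * (?u\<^sup>2 * eps)" by (simp add: power2_eq_square)
      finally have c: "real t * ?m * eps \<le> 2 / 15" using u2_eps by (simp add: mult.assoc)
      have e: "rest_coeff \<le> 2 / 5" using a c by (simp add: rest_coeff_def algebra_simps)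
      have "(?u + rest_coeff) * (real t + 1 + rest_coeff) \<le> (?m - 1 + 2 / 5) * (?m - 2 + 2 / 5)"
        using e rest_coeff_nonneg mr by (intro mult_mono) auto
      also have "\<dots> < ?m\<^sup>2 - ?m * (4 / 15)"
        using mr by (simp add: power2_eq_square field_simps)
      also have "\<dots> \<le> ?m\<^sup>2 - ?m ^ 3 * eps"
        unfolding cube using a by (intro diff_left_mono mult_left_mono) auto
      finally show ?thesis .
    next
      case False
      have "(?u + rest_coeff) * (real t + 1 + rest_coeff) \<le> (?m / 2 + ?m / 10) * (?m / 2 + ?m / 10)"
        using False rest_coeff_le_m rest_coeff_nonneg by (intro mult_mono) auto
      also have "\<dots> < ?m\<^sup>2 - ?m * (?m / 10)"
        using mr by (simp add: power2_eq_square field_simps)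
      also have "\<dots> \<le> ?m\<^sup>2 - ?m ^ 3 * eps"
        unfolding cube using m2_eps by (intro diff_left_mono mult_left_mono) auto
      finally show ?thesis .
    qed
    then have "(?u + rest_coeff) * (real t + 1 + rest_coeff) * (b (t + 1))\<^sup>2 < (?m\<^sup>2 - ?m ^ 3 * eps) * (b (t + 1))\<^sup>2"
      using B2 by (rule mult_strict_right_mono)
    then show ?thesis using target_sq_large(1)[OF m3] by linarith
  qed
qed

end

section \<open>Stars with large links, and the two extremal structures\<close>

context closed_pair
begin

text \<open>F keeps t points of each generator \<open>insert y X\<close>. A point of X missing from
  F is the only one that F may miss there, so F contains y.\<close>

lemma F_nonstar:
  assumes "F \<in> \<F>" "\<not> X \<subseteq> F" "link (gens \<F>) X \<noteq> {}"
  shows "link (gens \<F>) X \<subseteq> F" "\<exists>x\<in>X. F \<inter> X = X - {x}"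
proof -
  have main: "y \<in> F \<and> (\<exists>x\<in>X. F \<inter> X = X - {x})" if y: "y \<in> link (gens \<F>) X" for y
  proof -
    note Y = linkD[OF y] and S = gensD[OF linkD(6)[OF y]]
    have "insert y X \<subseteq> F \<or> (\<exists>x\<in>insert y X. F \<inter> insert y X = insert y X - {x})"
      using S assms(1) by (intro Int_eq_or_Diff_singleton) (auto simp: t_cover_def)
    then obtain x where x: "x \<in> insert y X" "F \<inter> insert y X = insert y X - {x}" using assms(2) by auto
    moreover have "x \<noteq> y" using x assms(2) Y(5) by auto
    ultimately have "y \<in> F" "x \<in> X" "F \<inter> X = X - {x}" using Y(5) by auto
    then show ?thesis by blast
  qed
  then show "link (gens \<F>) X \<subseteq> F" "\<exists>x\<in>X. F \<inter> X = X - {x}" using assms(3) by auto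
qed

lemma ex_F_nonstar:
  assumes "link (gens \<F>) X \<noteq> {}"
  obtains F where "F \<in> \<F>" "\<not> X \<subseteq> F"
proof -
  obtain y where "y \<in> link (gens \<F>) X" using assms by auto
  note Y = linkD[OF this]
  have "\<not> t_cover t \<F> X" using F_nontriv[of X] Y by simp
  then obtain F where F: "F \<in> \<F>" "card (F \<inter> X) < t" by (auto simp: t_cover_def not_le)
  then have "\<not> X \<subseteq> F" using Y(3) by (auto simp: inf.absorb2)
  then show ?thesis using F that by blast
qed

text \<open>By \<open>F_nonstar\<close>, F has t - 1 points in X and so k - t + 1 = m outside. A
  member of \<G> containing X must make up for the missing point in F - X.\<close>

lemma nonstar_Diff:
  assumes "F \<in> \<F>" "\<not> X \<subseteq> F" "link (gens \<F>) X \<noteq> {}"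
  shows "X \<inter> (F - X) = {}" "card (F - X) = m" "F - X \<subseteq> {1..n}" "link (gens \<F>) X \<subseteq> F - X"
    and "up \<G> X \<subseteq> star_meet X (F - X)"
proof -
  obtain y where "y \<in> link (gens \<F>) X" using assms by auto
  note Y = linkD[OF this]
  obtain x where x: "x \<in> X" "F \<inter> X = X - {x}" using F_nonstar(2)[OF assms] by auto
  then have c: "card (F \<inter> X) = t - 1" using Y by simp
  show "card (F - X) = m" using F_mem[OF assms(1)] c kt t2 by (simp add: card_Diff_subset_Int m_def)
  show "X \<inter> (F - X) = {}" by auto
  show "F - X \<subseteq> {1..n}" using F_mem[OF assms(1)] by auto
  show "link (gens \<F>) X \<subseteq> F - X" using F_nonstar(1)[OF assms] by (auto simp: link_def)
  show "up \<G> X \<subseteq> star_meet X (F - X)"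
  proof
    fix G assume "G \<in> up \<G> X"
    then have G: "G \<in> \<G>" "X \<subseteq> G" by (auto simp: up_def)
    have "G \<inter> (F - X) \<noteq> {}"
    proof
      assume "G \<inter> (F - X) = {}"
      then have "F \<inter> G \<subseteq> F \<inter> X" by auto
      then have "card (F \<inter> G) \<le> t - 1" using c F_mem[OF assms(1)] card_mono[of "F \<inter> X" "F \<inter> G"] by auto
      then show False using cross_card[OF assms(1) G(1)] t2 by linarith
    qed
    then show "G \<in> star_meet X (F - X)" using G G_sub by (auto simp: star_meet_def)
  qed
qed

lemma card_up_G_le_h0:
  assumes "link (gens \<F>) X \<noteq> {}"
  shows "card (up \<G> X) \<le> h0"
proof -
  obtain y where "y \<in> link (gens \<F>) X" using assms by auto
  note Y = linkD[OF this]
  obtain F where F: "F \<in> \<F>" "\<not> X \<subseteq> F" using ex_F_nonstar[OF assms] .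
  note D = nonstar_Diff[OF F assms]
  have "card (up \<G> X) \<le> card (star_meet X (F - X))"
    using D(5) by (intro card_mono) (auto simp: star_meet_def finite_imp_finite_nsets)
  also have "\<dots> = h0" using card_star_meet[OF Y(1) D(3,1) Y(3) D(2)] .
  finally show ?thesis .
qed

text \<open>Pick y in F1 - X but not in F2 - X. The k-sets that contain X and y and avoid F2 - X
  meet F1 - X, yet cannot lie in \<G>; there are at least (1 - m * eps) B \<ge> 0.9 B of them, where
  B = \<open>b (t + 1)\<close>.\<close>

lemma card_up_G_two_rests:
  assumes "F1 \<in> \<F>" "\<not> X \<subseteq> F1" "F2 \<in> \<F>" "\<not> X \<subseteq> F2" "F1 - X \<noteq> F2 - X" "link (gens \<F>) X \<noteq> {}"
  shows "real (card (up \<G> X)) + 0.9 * b (t + 1) \<le> real h0"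
proof -
  obtain y0 where "y0 \<in> link (gens \<F>) X" using assms by auto
  note Y = linkD[OF this]
  note D1 = nonstar_Diff[OF assms(1,2,6)] and D2 = nonstar_Diff[OF assms(3,4,6)]
  have "\<not> F1 - X \<subseteq> F2 - X"
    using D1(2) D2(2) assms(5) card_subset_eq[of "F2 - X" "F1 - X"] F_mem[OF assms(3)] by auto
  then obtain y where y: "y \<in> F1 - X" "y \<notin> F2 - X" by auto
  let ?D = "{A \<in> nsets {1..n} k. insert y X \<subseteq> A \<and> A \<inter> (F2 - X) = {}}"
  have fin: "finite (star_meet X (F1 - X))" by (simp add: star_meet_def finite_imp_finite_nsets)
  have "?D \<subseteq> star_meet X (F1 - X)" using y by (auto simp: star_meet_def)
  moreover have "up \<G> X \<subseteq> star_meet X (F1 - X)" by (rule D1(5))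
  moreover have "up \<G> X \<inter> ?D = {}" using D2(5) by (auto simp: star_meet_def)
  ultimately have "card (up \<G> X \<union> ?D) \<le> card (star_meet X (F1 - X))" "card (up \<G> X \<union> ?D) = card (up \<G> X) + card ?D"
    using fin finite_subset[OF _ fin] by (auto intro!: card_mono card_Un_disjoint)
  then have "card (up \<G> X) + card ?D \<le> h0"
    using card_star_meet[OF Y(1) D1(3,1) Y(3) D1(2)] by simp
  moreover have "card ?D = (n - m - (t + 1)) choose (k - (t + 1))"
    using card_avoid[of "insert y X" "F2 - X"] Y D1(3) D2(2,3) y kt by auto
  moreover have "b (t + 1) - real m * b (t + 2) \<le> real ((n - m - (t + 1)) choose (k - (t + 1)))"
  proof -
    have "m \<le> n - t - 1" using ten_k_le m_less_k by linarith
    from choose_diff_lower[OF this, of "k - t - 2"]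
    have "real ((n - t - 1) choose Suc (k - t - 2)) - real m * real ((n - t - 1 - 1) choose (k - t - 2))
      \<le> real ((n - t - 1 - m) choose Suc (k - t - 2))" .
    moreover have "Suc (k - t - 2) = k - t - 1" "n - t - 1 - 1 = n - t - 2"
      "n - t - 1 - m = n - m - (t + 1)" "k - (t + 1) = k - t - 1" using kt by auto
    ultimately show ?thesis by (simp only: b_t1_nat b_t2_nat)
  qed
  moreover have "real m * b (t + 2) \<le> 0.1 * b (t + 1)"
  proof -
    have "real m * b (t + 2) \<le> real m * (eps * b (t + 1))" using b_t2_le by (intro mult_left_mono) auto
    also have "\<dots> = (real m * eps) * b (t + 1)" by simp
    also have "\<dots> \<le> 0.1 * b (t + 1)" using m_eps b_nonneg by (intro mult_right_mono) auto
    finally show ?thesis .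
  qed
  ultimately show ?thesis by linarith
qed

text \<open>A member missing x in X contains X - {x} and three link points, in all t + 2 prescribed
  points. This is the reason for the threshold 3 in the case distinction.\<close>

lemma card_F_nonstar_le:
  assumes "3 \<le> card (link (gens \<F>) X)"
  shows "real (card {F \<in> \<F>. \<not> X \<subseteq> F}) \<le> real t * b (t + 2)"
proof -
  have ne: "link (gens \<F>) X \<noteq> {}" using assms by auto
  then obtain y where "y \<in> link (gens \<F>) X" by auto
  note Y = linkD[OF this]
  obtain Y3 where Y3: "Y3 \<subseteq> link (gens \<F>) X" "card Y3 = 3" "finite Y3"
    using assms by (meson obtain_subset_with_card_n)
  have dis: "Y3 \<inter> X = {}" using Y3(1) by (auto simp: link_def)
  have sub: "{F \<in> \<F>. \<not> X \<subseteq> F} \<subseteq> (\<Union>x\<in>X. up \<F> (X - {x} \<union> Y3))"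
  proof
    fix F assume "F \<in> {F \<in> \<F>. \<not> X \<subseteq> F}"
    then have F: "F \<in> \<F>" "\<not> X \<subseteq> F" by auto
    obtain x where "x \<in> X" "F \<inter> X = X - {x}" using F_nonstar(2)[OF F ne] by auto
    moreover have "Y3 \<subseteq> F" using F_nonstar(1)[OF F ne] Y3 by auto
    ultimately show "F \<in> (\<Union>x\<in>X. up \<F> (X - {x} \<union> Y3))" using F by (auto simp: up_def)
  qed
  have each: "real (card (up \<F> (X - {x} \<union> Y3))) \<le> b (t + 2)" if "x \<in> X" for x
  proof -
    have "card (X - {x} \<union> Y3) = card (X - {x}) + card Y3"
      using dis Y Y3 by (intro card_Un_disjoint) auto
    then have "card (X - {x} \<union> Y3) = t + 2" using that Y Y3 t2 by simp
    then show ?thesis using card_up_le[OF F_sub, of "X - {x} \<union> Y3"] Y Y3 by simp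
  qed
  have "real (card {F \<in> \<F>. \<not> X \<subseteq> F}) \<le> real (card (\<Union>x\<in>X. up \<F> (X - {x} \<union> Y3)))"
    using FG_finite finite_subset[OF up_subset] Y
    by (intro of_nat_mono card_mono[OF _ sub]) auto
  also have "\<dots> \<le> real (card X) * b (t + 2)" by (rule card_UN_le_mult[OF Y(2) each])
  finally show ?thesis using Y by simp
qed

lemma card_F_split: "card \<F> = card (up \<F> X) + card {F \<in> \<F>. \<not> X \<subseteq> F}"
proof -
  have "\<F> = up \<F> X \<union> {F \<in> \<F>. \<not> X \<subseteq> F}" "up \<F> X \<inter> {F \<in> \<F>. \<not> X \<subseteq> F} = {}"
    by (auto simp: up_def)
  moreover have "finite (up \<F> X)" "finite {F \<in> \<F>. \<not> X \<subseteq> F}"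
    using FG_finite finite_subset[OF up_subset] by auto
  ultimately show ?thesis using card_Un_disjoint by metis
qed

lemma t_b_t2_le: "60 * (real t * b (t + 2)) \<le> b (t + 1)"
proof -
  have "real t * b (t + 2) \<le> (real t + 2) * (eps * b (t + 1))"
    using b_t2_le b_nonneg by (intro mult_mono) auto
  then have "60 * (real t * b (t + 2)) \<le> 60 * ((real t + 2) * eps) * b (t + 1)" by simp
  also have "\<dots> \<le> 1 * b (t + 1)" using u_eps b_nonneg by (intro mult_right_mono) auto
  finally show ?thesis by simp
qed

text \<open>With B = \<open>b (t + 1)\<close>, each family has at most B / 60 members outside the
  star of X, far fewer than the 0.9 B that \<G> loses inside it.\<close>

lemma less_card_H_if_two_rests:
  assumes "3 \<le> card (link (gens \<F>) X)" "3 \<le> card (link (gens \<G>) X)"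
    and "F1 \<in> \<F>" "\<not> X \<subseteq> F1" "F2 \<in> \<F>" "\<not> X \<subseteq> F2" "F1 - X \<noteq> F2 - X"
  shows "real (card \<F>) * real (card \<G>) < (real card_H)\<^sup>2"
proof -
  interpret sw: closed_pair n k t \<G> \<F> by (rule swap)
  have ne: "link (gens \<F>) X \<noteq> {}" "link (gens \<G>) X \<noteq> {}" using assms by auto
  let ?B = "b (t + 1)" and ?h = "real h0"
  have B: "0 < ?B" by (rule B_pos)
  have F: "real (card \<F>) \<le> ?h + ?B / 60"
    using card_F_split[of X] sw.card_up_G_le_h0[OF ne(2)] card_F_nonstar_le[OF assms(1)] t_b_t2_le by linarith
  have two: "real (card (up \<G> X)) + 0.9 * ?B \<le> ?h"
    by (rule card_up_G_two_rests[OF assms(3-7) ne(1)])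
  then have G: "real (card \<G>) \<le> ?h - 0.9 * ?B + ?B / 60"
    using sw.card_F_split[of X] sw.card_F_nonstar_le[OF assms(2)] t_b_t2_le by linarith
  have h: "0.9 * ?B \<le> ?h" using two by linarith
  have "real (card \<F>) * real (card \<G>) \<le> (?h + ?B / 60) * (?h - 0.9 * ?B + ?B / 60)"
    using F G h B by (intro mult_mono) auto
  also have "\<dots> < ?h\<^sup>2"
  proof -
    have "(h + B / 60) * (h - 0.9 * B + B / 60) < h\<^sup>2" if "0 < B" "0.9 * B \<le> h" for h B :: real
    proof -
      have "(h + B / 60) * (h - 0.9 * B + B / 60) = h\<^sup>2 - 13 / 15 * (h * B) - 53 / 3600 * B\<^sup>2"
        by (simp add: power2_eq_square field_simps)
      moreover have "0 < h * B" using that by (intro mult_pos_pos) auto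
      moreover have "0 \<le> B\<^sup>2" by simp
      ultimately show ?thesis by linarith
    qed
    then show ?thesis using B h by blast
  qed
  also have "\<dots> \<le> (real card_H)\<^sup>2" by (intro power_mono) (auto simp: card_H_def)
  finally show ?thesis .
qed

lemma nonstar_eq:
  assumes "F \<in> \<F>" "\<not> X \<subseteq> F" "link (gens \<F>) X \<noteq> {}"
  shows "\<exists>x\<in>X. F = (X \<union> (F - X)) - {x}"
proof -
  obtain x where x: "x \<in> X" "F \<inter> X = X - {x}" using F_nonstar(2)[OF assms] by auto
  then have "F = (X \<union> (F - X)) - {x}" by auto
  then show ?thesis using x by blast
qed

definition H_form :: bool where
  "H_form \<longleftrightarrow> (\<exists>X \<in> nsets {1..n} t. \<exists>K \<in> nsets {1..n} (k + 1). \<exists>L \<in> nsets {1..n} (k + 1).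
     X \<subseteq> K \<inter> L \<and> card (K \<inter> L) \<ge> t + 2 \<and> \<F> = H_family n k X K L \<and> \<G> = H_family n k X L K)"

definition A_form :: bool where
  "A_form \<longleftrightarrow> (\<exists>Z \<in> nsets {1..n} (t + 2). \<F> = A_family n k t Z \<and> \<G> = A_family n k t Z)"

lemma subset_H_family:
  assumes "link (gens \<F>) X \<noteq> {}" "link (gens \<G>) X \<noteq> {}" "G0 \<in> \<G>" "\<not> X \<subseteq> G0"
    and "\<And>F. F \<in> \<F> \<Longrightarrow> \<not> X \<subseteq> F \<Longrightarrow> F - X = K0"
  shows "\<F> \<subseteq> H_family n k X (X \<union> K0) (X \<union> (G0 - X))"
proof
  interpret sw: closed_pair n k t \<G> \<F> by (rule swap)
  fix F assume F: "F \<in> \<F>"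
  show "F \<in> H_family n k X (X \<union> K0) (X \<union> (G0 - X))"
  proof (cases "X \<subseteq> F")
    case True
    then have "F \<in> star_meet X (G0 - X)"
      using sw.nonstar_Diff(5)[OF assms(3,4,2)] F by (auto simp: up_def)
    moreover have "(X \<union> (G0 - X)) - X = G0 - X" by auto
    ultimately show ?thesis by (simp add: star_meet_def H_family_def)
  next
    case False
    then obtain x where "x \<in> X" "F = (X \<union> K0) - {x}"
      using nonstar_eq[OF F False assms(1)] assms(5)[OF F False] by auto
    then show ?thesis by (auto simp: H_family_def)
  qed
qed

text \<open>If all members of a family not containing X agree outside X, they are sets K - {x}. When
  this holds for both families, each lies in an \<open>H_family\<close>, and cardinality decides;
  otherwise \<open>less_card_H_if_two_rests\<close> applies.\<close>

lemma both_rich: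
  assumes "3 \<le> card (link (gens \<F>) X)" "3 \<le> card (link (gens \<G>) X)"
  shows "real (card \<F>) * real (card \<G>) < (real card_H)\<^sup>2 \<or> H_form"
proof -
  interpret sw: closed_pair n k t \<G> \<F> by (rule swap)
  have ne: "link (gens \<F>) X \<noteq> {}" "link (gens \<G>) X \<noteq> {}" using assms by auto
  then obtain y where "y \<in> link (gens \<F>) X" by auto
  note Y = linkD[OF this]
  obtain F0 where F0: "F0 \<in> \<F>" "\<not> X \<subseteq> F0" using ex_F_nonstar[OF ne(1)] .
  obtain G0 where G0: "G0 \<in> \<G>" "\<not> X \<subseteq> G0" using sw.ex_F_nonstar[OF ne(2)] .
  show ?thesis
  proof (cases "\<exists>F\<in>\<F>. \<not> X \<subseteq> F \<and> F - X \<noteq> F0 - X")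
    case True
    then obtain F where "F \<in> \<F>" "\<not> X \<subseteq> F" "F - X \<noteq> F0 - X" by auto
    then show ?thesis using less_card_H_if_two_rests[OF assms _ _ F0] by blast
  next
    case F_one: False
    show ?thesis
    proof (cases "\<exists>G\<in>\<G>. \<not> X \<subseteq> G \<and> G - X \<noteq> G0 - X")
      case True
      then obtain G where "G \<in> \<G>" "\<not> X \<subseteq> G" "G - X \<noteq> G0 - X" by auto
      then have "real (card \<G>) * real (card \<F>) < (real card_H)\<^sup>2"
        using sw.less_card_H_if_two_rests[OF assms(2,1) _ _ G0] by blast
      then show ?thesis by (simp add: mult.commute)
    next
      case G_one: False
      define K L where "K = X \<union> (F0 - X)" and "L = X \<union> (G0 - X)"
      note DF = nonstar_Diff[OF F0 ne(1)] and DG = sw.nonstar_Diff[OF G0 ne(2)]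
      have cK: "card K = k + 1" "card L = k + 1"
        unfolding K_def L_def
        using card_Un_disjoint[OF Y(2) _ DF(1)] card_Un_disjoint[OF Y(2) _ DG(1)]
          DF(2) DG(2) F_mem[OF F0(1)] G_mem[OF G0(1)] Y(3) kt by (auto simp: m_def)
      have KL: "X \<in> nsets {1..n} t" "K \<in> nsets {1..n} (k + 1)" "L \<in> nsets {1..n} (k + 1)" "X \<subseteq> K" "X \<subseteq> L"
        using Y cK DF(3) DG(3) F_mem[OF F0(1)] G_mem[OF G0(1)] by (auto simp: nsets_def K_def L_def)
      have subs: "\<F> \<subseteq> H_family n k X K L" "\<G> \<subseteq> H_family n k X L K"
        unfolding K_def L_def
        by (rule subset_H_family[OF ne G0], use F_one in blast)
          (rule sw.subset_H_family[OF ne(2,1) F0], use G_one in blast)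
      have cH: "card (H_family n k X K L) = card_H" "card (H_family n k X L K) = card_H"
        using card_H_family[OF KL(1,2,3,4,5)] card_H_family[OF KL(1,3,2,5,4)] by auto
      have hpos: "0 < card_H" using t2 by (simp add: card_H_def)
      have fH: "finite (H_family n k X K L)" "finite (H_family n k X L K)"
        by (rule card_ge_0_finite, simp add: cH hpos)+
      have le: "card \<F> \<le> card_H" "card \<G> \<le> card_H"
        using card_mono[OF fH(1) subs(1)] card_mono[OF fH(2) subs(2)] cH by auto
      show ?thesis
      proof (cases "card \<F> = card_H \<and> card \<G> = card_H")
        case True
        then have eq: "\<F> = H_family n k X K L" "\<G> = H_family n k X L K"
          using card_subset_eq[OF fH(1) subs(1)] card_subset_eq[OF fH(2) subs(2)] cH by auto
        \<comment> \<open>t \<ge> 2 provides distinct points x, z of X. The members K - {x} and L -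
          {z} share exactly card (K \<inter> L) - 2 points, which forces the lower bound t +
          2.\<close>
        obtain x where x: "x \<in> X" using Y(3) t2 by fastforce
        have "X - {x} \<noteq> {}" using Y(2,3) t2 x by (metis One_nat_def card.empty card_Diff_singleton diff_is_0_eq not_less_eq_eq numeral_2_eq_2)
        then obtain z where z: "z \<in> X" "z \<noteq> x" by auto
        have "K - {x} \<in> \<F>" "L - {z} \<in> \<G>" unfolding eq using x z by (auto simp: H_family_def)
        then have "t \<le> card ((K - {x}) \<inter> (L - {z}))" by (rule cross_card)
        also have "(K - {x}) \<inter> (L - {z}) = K \<inter> L - {x, z}" by auto
        also have "card (K \<inter> L - {x, z}) = card (K \<inter> L) - 2"
          using x z KL by (subst card_Diff_subset) auto
        finally have "t + 2 \<le> card (K \<inter> L)" using t2 by linarith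
        then have H_form unfolding H_form_def using KL eq by blast
        then show ?thesis ..
      next
        case False
        then have "card \<F> * card \<G> < card_H * card_H"
          using le hpos by (metis le_neq_implies_less mult_le_less_imp_less mult_less_le_imp_less le0 nat_mult_less_cancel1 mult_less_mono2 le_less_trans mult_le_mono1 mult_le_mono2)
        then have "real (card \<F> * card \<G>) < real (card_H * card_H)" by (rule of_nat_less_iff[THEN iffD2])
        then show ?thesis by (simp add: power2_eq_square)
      qed
    qed
  qed
qed

text \<open>A generator missing a point of X would contain all link points, at least three, and t -
  1 points of X: too many for t + 1.\<close>

lemma gens_F_star:
  assumes "3 \<le> card (link (gens \<G>) X)" "S \<in> gens \<F>"
  shows "X \<subseteq> S"
proof (rule ccontr)
  assume n: "\<not> X \<subseteq> S"
  note S = gensD[OF assms(2)]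
  have mem: "y \<in> S \<and> t - 1 \<le> card (S \<inter> X)" if y: "y \<in> link (gens \<G>) X" for y
  proof -
    note Y = linkD[OF y]
    have "t \<le> card (insert y X \<inter> S)" by (rule gens_cross[OF assms(2) Y(6)])
    moreover have "card (X \<inter> S) < card X" using n Y(2) by (intro psubset_card_mono) auto
    ultimately have "y \<in> S" using Y(3) by (cases "y \<in> S") auto
    moreover have "card (insert y X \<inter> S) \<le> Suc (card (S \<inter> X))"
      using S(2) by (metis Int_commute Int_insert_right_if1 \<open>y \<in> S\<close> card_insert_le_m1 finite_Int card_insert_if le_SucI le_refl)
    ultimately show ?thesis using \<open>t \<le> card (insert y X \<inter> S)\<close> by linarith
  qed
  obtain y where y: "y \<in> link (gens \<G>) X" using assms(1) by fastforce
  have "link (gens \<G>) X \<union> (S \<inter> X) \<subseteq> S" using mem by auto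
  then have "card (link (gens \<G>) X \<union> (S \<inter> X)) \<le> t + 1" using S card_mono by metis
  moreover have "card (link (gens \<G>) X \<union> (S \<inter> X)) = card (link (gens \<G>) X) + card (S \<inter> X)"
    using S finite_link_gens by (intro card_Un_disjoint) (auto simp: link_def)
  ultimately show False using assms(1) mem[OF y] t2 by linarith
qed

text \<open>By \<open>gens_F_star\<close> all generators of \<F> contain X, so there are exactly
  two, while \<G> has at most m + t: its link lies in a set G0 - X of m points. The resulting
  product, about 2 (m + t), is only linear in m and t.\<close>

lemma one_rich:
  assumes rich: "3 \<le> card (link (gens \<G>) X)" and poor: "card (link (gens \<F>) X) \<le> 2" and two: "2 \<le> card (gens \<F>)"
  shows "real (card \<F>) * real (card \<G>) < (real target)\<^sup>2"
proof -
  interpret sw: closed_pair n k t \<G> \<F> by (rule swap)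
  have neG: "link (gens \<G>) X \<noteq> {}" using rich by auto
  then obtain y where y: "y \<in> link (gens \<G>) X" by auto
  note Y = linkD[OF y]
  have sub: "gens \<F> \<subseteq> (\<lambda>y. insert y X) ` link (gens \<F>) X"
  proof
    fix S assume S: "S \<in> gens \<F>"
    have XS: "X \<subseteq> S" by (rule gens_F_star[OF rich S])
    obtain z where "z \<in> S" "X = S - {z}"
      by (rule card_eq_Suc_diff_singleton[of S X]) (use gensD[OF S] Y XS in auto)
    then have "z \<in> link (gens \<F>) X" "S = insert z X" using S by (auto simp: link_def insert_absorb)
    then show "S \<in> (\<lambda>y. insert y X) ` link (gens \<F>) X" by blast
  qed
  then have "card (gens \<F>) \<le> card (link (gens \<F>) X)" using finite_link_gens by (intro surj_card_le)
  then have c2: "card (gens \<F>) = 2" using poor two by linarith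
  then obtain S1 S2 where S12: "gens \<F> = {S1, S2}" "S1 \<noteq> S2" by (auto simp: card_2_iff)
  then have S: "S1 \<in> gens \<F>" "S2 \<in> gens \<F>" by auto
  have XX: "X \<subseteq> S1 \<inter> S2" using gens_F_star[OF rich] S by auto
  then have "card X \<le> card (S1 \<inter> S2)" using gensD[OF S(1)] by (intro card_mono) auto
  then have ct: "card (S1 \<inter> S2) = t"
  proof -
    have "gens \<G> \<noteq> {}" using Y(6) by auto
    from gens_Int_card[OF S S12(2) this] \<open>card X \<le> card (S1 \<inter> S2)\<close> Y(3) t2
    show ?thesis by (elim disjE) linarith+
  qed
  then have X_eq: "S1 \<inter> S2 = X" using XX Y gensD[OF S(1)] card_subset_eq[of "S1 \<inter> S2" X] by auto
  have cG: "card (gens \<G>) \<le> card (link (gens \<G>) X) + t"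
    using card_gens_near[OF S ct] X_eq by simp
  obtain G0 where G0: "G0 \<in> \<G>" "\<not> X \<subseteq> G0" using sw.ex_F_nonstar[OF neG] .
  note DG = sw.nonstar_Diff[OF G0 neG]
  have "card (link (gens \<G>) X) \<le> m"
    using card_mono[OF _ DG(4)] DG(2) G_mem[OF G0(1)] by auto
  then have cG': "card (gens \<G>) \<le> m + t" using cG by linarith
  have "1 < card (link (gens \<G>) X)" using rich by simp
  then obtain z where z: "z \<in> link (gens \<G>) X" "z \<noteq> y"
    by (metis is_singletonI' is_singleton_altdef less_numeral_extra(4) neG)
  have R: "insert y X \<in> gens \<G>" "insert z X \<in> gens \<G>" "insert y X \<noteq> insert z X"
    using Y(6) linkD[OF z(1)] z Y(5) by auto
  have "real (card \<F>) \<le> (real (card (gens \<G>)) + rest_coeff) * b (t + 1)"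
    by (rule card_le_gens[OF S S12(2)]) (use R in auto)
  also have "\<dots> \<le> (real m + real t + rest_coeff) * b (t + 1)"
    using cG' b_nonneg by (intro mult_right_mono) auto
  finally have F: "real (card \<F>) \<le> (real m + real t + rest_coeff) * b (t + 1)" .
  have "real (card \<G>) \<le> (real (card (gens \<F>)) + rest_coeff) * b (t + 1)"
    by (rule sw.card_le_gens[OF R]) (use S in auto)
  then have G: "real (card \<G>) \<le> (2 + rest_coeff) * b (t + 1)" using c2 by simp
  have "real (card \<F>) * real (card \<G>) \<le> ((real m + real t + rest_coeff) * b (t + 1)) * ((2 + rest_coeff) * b (t + 1))"
    by (rule mult_mono[OF F G]) (use rest_coeff_nonneg b_nonneg in auto)
  also have "\<dots> = (real m + real t + rest_coeff) * (2 + rest_coeff) * (b (t + 1))\<^sup>2"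
    by (simp add: power2_eq_square)
  also have "\<dots> < (real target)\<^sup>2" by (rule two_generators_numeric)
  finally show ?thesis .
qed

lemma card_gens_G_le:
  assumes "\<And>X. card (link (gens \<G>) X) \<le> 2" "S1 \<in> gens \<F>" "S2 \<in> gens \<F>" "S1 \<noteq> S2" "gens \<G> \<noteq> {}"
  shows "card (gens \<G>) \<le> t + 2"
  using gens_Int_card[OF assms(2-5)]
proof
  assume "card (S1 \<inter> S2) = t"
  from card_gens_near[OF assms(2,3) this] assms(1)[of "S1 \<inter> S2"] show ?thesis by linarith
next
  assume "card (S1 \<inter> S2) = t - 1"
  from gens_far(2)[OF assms(2,3) this] t2 show ?thesis by linarith
qed

text \<open>A far pair leaves at most four generators of \<G>, so t = 2 and all four candidates
  occur. A generator of \<F> meeting each of them in two points must be S1 or S2, too few for t + 2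
  = 4.\<close>

lemma no_far_pair:
  assumes "card (gens \<F>) = t + 2" "card (gens \<G>) = t + 2" "S1 \<in> gens \<F>" "S2 \<in> gens \<F>" "S1 \<noteq> S2"
  shows "card (S1 \<inter> S2) = t"
proof (rule ccontr)
  assume "card (S1 \<inter> S2) \<noteq> t"
  moreover have "gens \<G> \<noteq> {}" using assms(2) by auto
  ultimately have far: "card (S1 \<inter> S2) = t - 1" using gens_Int_card[OF assms(3-5)] by auto
  note S1 = gensD[OF assms(3)] and S2 = gensD[OF assms(4)]
  define C where "C = S1 \<inter> S2"
  let ?R = "\<lambda>p. insert (fst p) (insert (snd p) C)"
  have t_eq: "t = 2" using gens_far(2)[OF assms(3,4) far] assms(2) t2 by linarith
  have c2: "card (S1 - S2) = 2" "card (S2 - S1) = 2"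
    using S1 S2 far t2 by (simp_all add: card_Diff_subset_Int Int_commute)
  have fin: "finite ((S1 - S2) \<times> (S2 - S1))" using S1 S2 by auto
  have "card (?R ` ((S1 - S2) \<times> (S2 - S1))) \<le> card ((S1 - S2) \<times> (S2 - S1))"
    by (rule card_image_le[OF fin])
  then have "card (?R ` ((S1 - S2) \<times> (S2 - S1))) \<le> card (gens \<G>)"
    using c2 assms(2) t_eq by (simp add: card_cartesian_product)
  then have eq: "gens \<G> = ?R ` ((S1 - S2) \<times> (S2 - S1))"
    using gens_far(1)[OF assms(3,4) far] fin unfolding C_def by (intro card_seteq) auto
  have cr: "t \<le> card (insert a (insert c C) \<inter> S)" if "a \<in> S1 - S2" "c \<in> S2 - S1" "S \<in> gens \<F>" for a c S
  proof (rule gens_cross[OF that(3)])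
    show "insert a (insert c C) \<in> gens \<G>"
      unfolding eq using that by (intro image_eqI[of _ _ "(a, c)"]) auto
  qed
  have "gens \<F> \<subseteq> {S1, S2}"
  proof
    fix S assume S: "S \<in> gens \<F>"
    note S' = gensD[OF S]
    have cC: "card C = t - 1" "finite C" using far S1 by (auto simp: C_def)
    \<comment> \<open>If S misses a point of C, it cannot miss c as well, since only t - 1 points of
      {a, c} \<union> C would remain. Applied to S1 - S2 and S2 - S1 in both orders.\<close>
    have full: "A \<subseteq> S \<and> C \<subseteq> S \<or> A \<subseteq> S \<and> B \<subseteq> S"
      if AB: "A \<subseteq> S" "B \<noteq> {}" "A \<noteq> {}" "\<And>a c. a \<in> A \<Longrightarrow> c \<in> B \<Longrightarrow> t \<le> card (insert a (insert c C) \<inter> S)" for A B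
    proof (cases "C \<subseteq> S")
      case False
      have "c \<in> S" if c: "c \<in> B" for c
      proof (rule ccontr)
        assume "c \<notin> S"
        obtain a where a: "a \<in> A" using AB(3) by auto
        have "insert a (insert c C) \<inter> S \<subseteq> insert a (C \<inter> S)" using \<open>c \<notin> S\<close> by auto
        then have "card (insert a (insert c C) \<inter> S) \<le> card (insert a (C \<inter> S))"
          using cC by (intro card_mono) auto
        also have "\<dots> \<le> Suc (card (C \<inter> S))" using cC by (simp add: card_insert_if)
        also have "card (C \<inter> S) < card C" using False cC by (intro psubset_card_mono) auto
        finally have "card (insert a (insert c C) \<inter> S) < t" using cC t2 by linarith
        then show False using AB(4)[OF a c] by linarith
      qed
      then show ?thesis using AB(1) by auto
    qed (use AB in simp)
    have dich: "S1 - S2 \<subseteq> S \<or> S2 - S1 \<subseteq> S"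
    proof (rule ccontr)
      assume "\<not> ?thesis"
      then obtain a c where ac: "a \<in> S1 - S2" "a \<notin> S" "c \<in> S2 - S1" "c \<notin> S" by auto
      then have "card (insert a (insert c C) \<inter> S) \<le> card C" using cC by (intro card_mono) auto
      then show False using cr[OF ac(1,3) S] cC t2 by linarith
    qed
    have ne: "S1 - S2 \<noteq> {}" "S2 - S1 \<noteq> {}" using c2 by (metis card.empty zero_neq_numeral)+
    have "\<not> (S1 - S2 \<subseteq> S \<and> S2 - S1 \<subseteq> S)"
    proof
      assume "S1 - S2 \<subseteq> S \<and> S2 - S1 \<subseteq> S"
      then have "card ((S1 - S2) \<union> (S2 - S1)) \<le> card S" using S' by (intro card_mono) auto
      moreover have "card ((S1 - S2) \<union> (S2 - S1)) = 4"
        using c2 S1 S2 by (subst card_Un_disjoint) auto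
      ultimately show False using S' t_eq by simp
    qed
    then have "(S1 - S2 \<subseteq> S \<and> C \<subseteq> S) \<or> (S2 - S1 \<subseteq> S \<and> C \<subseteq> S)"
    proof -
      have "S1 - S2 \<subseteq> S \<Longrightarrow> ?thesis"
        using full[of "S1 - S2" "S2 - S1"] ne cr[OF _ _ S] \<open>\<not> (S1 - S2 \<subseteq> S \<and> S2 - S1 \<subseteq> S)\<close> by blast
      moreover have "S2 - S1 \<subseteq> S \<Longrightarrow> ?thesis"
        using full[of "S2 - S1" "S1 - S2"] ne cr[OF _ _ S] \<open>\<not> (S1 - S2 \<subseteq> S \<and> S2 - S1 \<subseteq> S)\<close>
        by (metis insert_commute)
      ultimately show ?thesis using dich by blast
    qed
    then have "S1 \<subseteq> S \<or> S2 \<subseteq> S" by (auto simp: C_def)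
    then show "S \<in> {S1, S2}" using S' S1 S2 card_subset_eq[of S S1] card_subset_eq[of S S2] by auto
  qed
  then have "card (gens \<F>) \<le> card {S1, S2}" by (intro card_mono) auto
  also have "\<dots> \<le> 2" by (simp add: card_insert_if)
  finally show False using assms(1) t2 by simp
qed

text \<open>With the roles of the families exchanged as well, these inclusions give equality: each
  family lies in \<open>A_family n k t Z\<close>, which lies in the other.\<close>

lemma full_gens_A_family:
  assumes Z: "Z \<in> nsets {1..n} (t + 2)" and full: "\<And>z. z \<in> Z \<Longrightarrow> Z - {z} \<in> gens \<F>"
  shows "\<F> \<subseteq> A_family n k t Z" "A_family n k t Z \<subseteq> \<G>"
proof -
  have Z': "finite Z" "card Z = t + 2" "Z \<noteq> {}" using Z by (auto simp: nsets_def)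
  show "\<F> \<subseteq> A_family n k t Z"
  proof
    fix F assume F: "F \<in> \<F>"
    have "t + 1 \<le> card (F \<inter> Z)"
    proof (rule card_Int_ge_Suc[OF Z'(1) _ Z'(3)])
      show "t \<le> card (F \<inter> (Z - {z}))" if "z \<in> Z" for z
        using gensD(4)[OF full[OF that]] F by (auto simp: t_cover_def)
    qed (use t2 in simp)
    then show "F \<in> A_family n k t Z" using F F_sub by (auto simp: A_family_def)
  qed
  show "A_family n k t Z \<subseteq> \<G>"
  proof
    fix A assume A: "A \<in> A_family n k t Z"
    then have "Z \<subseteq> A \<or> (\<exists>z\<in>Z. A \<inter> Z = Z - {z})"
      using Z' by (intro Int_eq_or_Diff_singleton) (auto simp: A_family_def)
    then obtain z where "z \<in> Z" "Z - {z} \<subseteq> A" using Z'(3) by blast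
    then show "A \<in> \<G>" using gens_up[OF full] A by (auto simp: A_family_def)
  qed
qed

text \<open>Two near generators, X with y1 and X with y2, span Z. As all pairs are near, any further
  generator either contains X, which the degree bound 2 excludes, or is Z without a point of X. With
  t + 2 generators all sets Z - {z} occur, and a generator of \<G> meeting each of them in t points
  lies in Z.\<close>

lemma both_full:
  assumes deg: "\<And>X. card (link (gens \<F>) X) \<le> 2"
    and full: "card (gens \<F>) = t + 2" "card (gens \<G>) = t + 2"
  shows A_form
proof -
  interpret sw: closed_pair n k t \<G> \<F> by (rule swap)
  have "1 < card (gens \<F>)" using full by simp
  then obtain S1 S2 where S: "S1 \<in> gens \<F>" "S2 \<in> gens \<F>" "S1 \<noteq> S2"
    by (metis One_nat_def Suc_lessD card_le_Suc0_iff_eq card.infinite leD less_one not_less0)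
  note near = no_far_pair[OF full]
  note S1 = gensD[OF S(1)] and S2 = gensD[OF S(2)]
  define X where "X = S1 \<inter> S2"
  obtain y1 y2 where y: "y1 \<noteq> y2" "y1 \<notin> X" "y2 \<notin> X" "S1 = insert y1 X" "S2 = insert y2 X"
    unfolding X_def using pair_gens_near[OF S(1,2) near[OF S]] by metis
  have X: "finite X" "card X = t" using S1 near[OF S] by (auto simp: X_def)
  define Z where "Z = insert y1 (insert y2 X)"
  have Z: "Z \<in> nsets {1..n} (t + 2)" using X y S1 S2 by (auto simp: Z_def nsets_def)
  then have Z': "finite Z" "card Z = t + 2" "Z \<noteq> {}" by (auto simp: nsets_def)
  have link_eq: "link (gens \<F>) X = {y1, y2}"
    using deg[of X] S y finite_link_gens[of \<F> X]
    by (intro card_seteq[symmetric]) (auto simp: link_def)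
  have in_Z: "S \<subseteq> Z" if Sg: "S \<in> gens \<F>" for S
  proof -
    note S' = gensD[OF Sg]
    have "t \<le> card (S \<inter> S1)" "t \<le> card (S \<inter> S2)"
      using near[OF Sg S(1)] near[OF Sg S(2)] S' by (cases "S = S1"; cases "S = S2"; simp)+
    then have "X \<subseteq> S \<or> (\<exists>x\<in>X. S \<inter> X = X - {x} \<and> insert y1 (insert y2 (X - {x})) \<subseteq> S)"
      using X y by (intro covers_near_pair) auto
    then show ?thesis
    proof
      assume XS: "X \<subseteq> S"
      obtain z where z: "z \<in> S" "X = S - {z}"
        by (rule card_eq_Suc_diff_singleton[of S X]) (use S' X XS in auto)
      then have "z \<in> link (gens \<F>) X" using Sg by (auto simp: link_def insert_absorb)
      then show ?thesis using z link_eq by (auto simp: Z_def)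
    next
      assume "\<exists>x\<in>X. S \<inter> X = X - {x} \<and> insert y1 (insert y2 (X - {x})) \<subseteq> S"
      then obtain x where x: "x \<in> X" "insert y1 (insert y2 (X - {x})) \<subseteq> S" by auto
      have "card (insert y1 (insert y2 (X - {x}))) = t + 1"
        using x X y t2 by (auto simp: card_Diff_singleton_if)
      then have "insert y1 (insert y2 (X - {x})) = S" using x S' by (intro card_subset_eq) auto
      then show ?thesis by (auto simp: Z_def)
    qed
  qed
  have all: "\<P> = (\<lambda>z. Z - {z}) ` Z" if P: "\<And>S. S \<in> \<P> \<Longrightarrow> S \<subseteq> Z \<and> card S = t + 1" "card \<P> = t + 2" for \<P>
  proof (rule card_seteq)
    show "\<P> \<subseteq> (\<lambda>z. Z - {z}) ` Z"
    proof
      fix S assume "S \<in> \<P>"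
      then have S: "S \<subseteq> Z" "card S = t + 1" using P by auto
      obtain z where "z \<in> Z" "S = Z - {z}"
        by (rule card_eq_Suc_diff_singleton[OF Z'(1) S(1)]) (use S Z' in auto)
      then show "S \<in> (\<lambda>z. Z - {z}) ` Z" by auto
    qed
    show "card ((\<lambda>z. Z - {z}) ` Z) \<le> card \<P>" using card_image_le[OF Z'(1)] Z'(2) P(2) by metis
  qed (use Z' in simp)
  have gF: "gens \<F> = (\<lambda>z. Z - {z}) ` Z" by (rule all) (use in_Z gensD full in auto)
  have gG: "gens \<G> = (\<lambda>z. Z - {z}) ` Z"
  proof (rule all)
    fix R assume R: "R \<in> gens \<G>"
    have "t + 1 \<le> card (R \<inter> Z)"
      by (rule card_Int_ge_Suc[OF Z'(1) _ Z'(3)]) (use gens_cross[OF _ R] gF t2 in auto)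
    then have "R \<inter> Z = R" using gensD[OF R] by (intro card_seteq) auto
    then show "R \<subseteq> Z \<and> card R = t + 1" using gensD[OF R] by auto
  qed (use full in simp)
  have "\<F> = A_family n k t Z" "\<G> = A_family n k t Z"
    using full_gens_A_family[OF Z] sw.full_gens_A_family[OF Z] gF gG by blast+
  then show A_form unfolding A_form_def using Z by blast
qed

lemma all_poor:
  assumes degF: "\<And>X. card (link (gens \<F>) X) \<le> 2" and degG: "\<And>X. card (link (gens \<G>) X) \<le> 2"
    and two: "2 \<le> card (gens \<F>)" "2 \<le> card (gens \<G>)"
  shows "real (card \<F>) * real (card \<G>) < (real target)\<^sup>2 \<or> A_form"
proof -
  interpret sw: closed_pair n k t \<G> \<F> by (rule swap)
  have ex2: "\<exists>S1 S2. S1 \<in> A \<and> S2 \<in> A \<and> S1 \<noteq> S2" if "2 \<le> card A" for A :: "nat set set"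
    using that by (metis card_2_iff' card_le_Suc0_iff_eq card.infinite not_less_eq_eq numeral_2_eq_2 zero_neq_numeral le_zero_eq)
  obtain S1 S2 where S: "S1 \<in> gens \<F>" "S2 \<in> gens \<F>" "S1 \<noteq> S2" using ex2[OF two(1)] by auto
  obtain R1 R2 where R: "R1 \<in> gens \<G>" "R2 \<in> gens \<G>" "R1 \<noteq> R2" using ex2[OF two(2)] by auto
  have ne: "gens \<F> \<noteq> {}" "gens \<G> \<noteq> {}" using S R by auto
  have c: "card (gens \<G>) \<le> t + 2" "card (gens \<F>) \<le> t + 2"
    by (rule card_gens_G_le[OF degG S ne(2)]) (rule sw.card_gens_G_le[OF degF R ne(1)])
  show ?thesis
  proof (cases "card (gens \<F>) = t + 2 \<and> card (gens \<G>) = t + 2")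
    case True
    then show ?thesis using both_full[OF degF] by auto
  next
    case False
    let ?B = "b (t + 1)"
    let ?p = "real (card (gens \<F>))" and ?q = "real (card (gens \<G>))"
    have F: "real (card \<F>) \<le> (?q + rest_coeff) * ?B" by (rule card_le_gens[OF S ne(2)])
    have G: "real (card \<G>) \<le> (?p + rest_coeff) * ?B" by (rule sw.card_le_gens[OF R ne(1)])
    have "real (card \<F>) * real (card \<G>) \<le> ((?q + rest_coeff) * ?B) * ((?p + rest_coeff) * ?B)"
      by (rule mult_mono[OF F G]) (use rest_coeff_nonneg b_nonneg in auto)
    also have "\<dots> = ((?q + rest_coeff) * (?p + rest_coeff)) * ?B\<^sup>2" by (simp add: power2_eq_square)
    also have "\<dots> \<le> ((real t + 2 + rest_coeff) * (real t + 1 + rest_coeff)) * ?B\<^sup>2"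
    proof (rule mult_right_mono)
      consider "?q \<le> real t + 2" "?p \<le> real t + 1" | "?q \<le> real t + 1" "?p \<le> real t + 2"
        using c False by linarith
      then show "(?q + rest_coeff) * (?p + rest_coeff) \<le> (real t + 2 + rest_coeff) * (real t + 1 + rest_coeff)"
      proof cases
        case 1
        then show ?thesis using rest_coeff_nonneg by (intro mult_mono) auto
      next
        case 2
        then have "(?p + rest_coeff) * (?q + rest_coeff) \<le> (real t + 2 + rest_coeff) * (real t + 1 + rest_coeff)"
          using rest_coeff_nonneg by (intro mult_mono) auto
        then show ?thesis by (simp add: mult.commute)
      qed
    qed simp
    also have "\<dots> < (real target)\<^sup>2" by (rule few_generators_numeric)
    finally show ?thesis by blast
  qed
qed

end

section \<open>The maximum product\<close>

text \<open>A t-cover of a nonempty family with at most t points has exactly t and is contained in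
  every member, hence in the common part.\<close>

lemma not_t_cover_if_common_part:
  assumes "\<F> \<subseteq> nsets {1..n} k" "card (common_part n \<F>) < t" "t \<le> n" "finite T" "card T \<le> t"
  shows "\<not> t_cover t \<F> T"
proof
  assume c: "t_cover t \<F> T"
  show False
  proof (cases "\<F> = {}")
    case True
    \<comment> \<open>The common part of the empty family is {1..n}, which has n \<ge> t
      points.\<close>
    then show False using assms by (simp add: common_part_def)
  next
    case False
    have sub: "T \<subseteq> F" and ct: "card T = t" if F: "F \<in> \<F>" for F
    proof -
      have "t \<le> card (F \<inter> T)" using c F by (simp add: t_cover_def)
      moreover have "card (F \<inter> T) \<le> card T" using assms(4) by (intro card_mono) auto
      ultimately show "card T = t" using assms(5) by linarith
      then have "F \<inter> T = T" using \<open>t \<le> card (F \<inter> T)\<close> assms(4) by (intro card_seteq) auto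
      then show "T \<subseteq> F" by auto
    qed
    obtain F where F: "F \<in> \<F>" using False by auto
    then have "T \<subseteq> {1..n}" using sub[OF F] assms(1) by (auto simp: nsets_def)
    then have "T \<subseteq> common_part n \<F>" using sub by (auto simp: common_part_def)
    then have "card T \<le> card (common_part n \<F>)" by (intro card_mono) (auto simp: common_part_def)
    then show False using ct[OF F] assms(2) by linarith
  qed
qed

lemma mult_eq_square_imp_eq:
  fixes p q h :: nat
  assumes "p \<le> h" "q \<le> h" "0 < h" "h\<^sup>2 \<le> p * q"
  shows "p = h \<and> q = h"
proof (rule ccontr)
  assume "\<not> ?thesis"
  then have "p < h \<or> q < h" using assms by auto
  then have "p * q < h * h"
  proof
    assume "p < h"
    then have "p * h < h * h" using assms(3) by simp
    moreover have "p * q \<le> p * h" using assms(2) by simp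
    ultimately show ?thesis by linarith
  next
    assume "q < h"
    then have "h * q < h * h" using assms(3) by simp
    moreover have "p * q \<le> h * q" using assms(1) by simp
    ultimately show ?thesis by linarith
  qed
  then show False using assms(4) by (simp add: power2_eq_square)
qed

context closed_pair
begin

lemma H_form_card: "H_form \<Longrightarrow> card \<F> = card_H \<and> card \<G> = card_H"
  unfolding H_form_def using card_H_family by auto

lemma A_form_card: "A_form \<Longrightarrow> card \<F> = card_A \<and> card \<G> = card_A"
  unfolding A_form_def using card_A_family by auto

lemma target_ge: "card_H \<le> target" "card_A \<le> target"
  using card_H_less_card_A card_A_less_card_H by (auto simp: target_def intro: less_imp_le)

lemma less_target_or_form:
  "card \<F> * card \<G> < target\<^sup>2 \<or> t + 3 \<le> m \<and> H_form \<or> m \<le> t + 2 \<and> A_form"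
proof -
  interpret sw: closed_pair n k t \<G> \<F> by (rule swap)
  have "real (card \<F>) * real (card \<G>) < (real target)\<^sup>2 \<or> H_form \<or> A_form"
  proof -
    consider "gens \<F> = {}" | "gens \<G> = {}" | S where "gens \<F> = {S}" | S where "gens \<G> = {S}"
      | "2 \<le> card (gens \<F>)" "2 \<le> card (gens \<G>)"
    proof -
      have "A = {} \<or> (\<exists>S. A = {S}) \<or> 2 \<le> card A" if "finite A" for A :: "nat set set"
      proof -
        consider "card A = 0" | "card A = 1" | "2 \<le> card A" by linarith
        then show ?thesis using that by cases (auto simp: card_1_singleton_iff)
      qed
      from this[OF finite_gens[of \<F>]] this[OF finite_gens[of \<G>]] that show ?thesis by blast
    qed
    then show ?thesis
    proof cases
      case 1
      then show ?thesis using less_target_if_no_gens by blast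
    next
      case 2
      then show ?thesis using sw.less_target_if_no_gens by (simp add: mult.commute)
    next
      case (3 S)
      then show ?thesis using less_target_if_one_gen by blast
    next
      case (4 S)
      then show ?thesis using sw.less_target_if_one_gen by (simp add: mult.commute)
    next
      case 5
      consider X where "3 \<le> card (link (gens \<F>) X)" "3 \<le> card (link (gens \<G>) X)"
        | X where "3 \<le> card (link (gens \<G>) X)" "card (link (gens \<F>) X) \<le> 2"
        | X where "3 \<le> card (link (gens \<F>) X)" "card (link (gens \<G>) X) \<le> 2"
        | "\<And>X. card (link (gens \<F>) X) \<le> 2" "\<And>X. card (link (gens \<G>) X) \<le> 2"
      proof -
        have "c \<le> 2 \<or> 3 \<le> c" for c :: nat by linarith
        then show ?thesis using that by metis
      qed
      then show ?thesis
      proof cases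
        case (1 X)
        have "(real card_H)\<^sup>2 \<le> (real target)\<^sup>2" using target_ge by (intro power_mono) auto
        then show ?thesis using both_rich[OF 1] by linarith
      next
        case (2 X)
        then show ?thesis using one_rich[OF 2 5(1)] by blast
      next
        case (3 X)
        then show ?thesis using sw.one_rich[OF 3 5(2)] by (simp add: mult.commute)
      next
        case 4
        then show ?thesis using all_poor[OF 4 5] by blast
      qed
    qed
  qed
  moreover have "card \<F> * card \<G> < target\<^sup>2" if "real (card \<F>) * real (card \<G>) < (real target)\<^sup>2"
    using that by (metis of_nat_less_iff of_nat_mult of_nat_power)
  \<comment> \<open>An extremal form in the other range of m attains only the smaller of
    \<open>card_H\<close> and \<open>card_A\<close>, so its product is strictly below the square of
    \<open>target\<close>.\<close>
  moreover have "t + 3 \<le> m \<or> card \<F> * card \<G> < target\<^sup>2" if H_form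
    using H_form_card[OF that] card_H_less_card_A
    by (auto simp: target_def power2_eq_square intro!: mult_strict_mono)
  moreover have "m \<le> t + 2 \<or> card \<F> * card \<G> < target\<^sup>2" if A_form
    using A_form_card[OF that] card_A_less_card_H
    by (auto simp: target_def power2_eq_square intro!: mult_strict_mono)
  ultimately show ?thesis by blast
qed

end

theorem theorem1p7:
  fixes n k t :: nat and \<F> \<G> :: "nat set set"
  assumes "k \<ge> t + 2" and "t + 2 \<ge> 4"
    and "n \<ge> t + max (15 * (t + 2)^2 * (k - t)) (10 * k^2)"
    and "\<F> \<subseteq> nsets {1..n} k" and "\<G> \<subseteq> nsets {1..n} k"
    and "cross_intersecting t \<F> \<G>"
    and "card (common_part n \<F>) < t" and "card (common_part n \<G>) < t"
  shows
    "(k \<ge> 2 * t + 2 \<longrightarrow>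
        card \<F> * card \<G> \<le> (card (H_std n k t))^2 \<and>
        (card \<F> * card \<G> = (card (H_std n k t))^2 \<longleftrightarrow>
          (\<exists>X \<in> nsets {1..n} t. \<exists>K \<in> nsets {1..n} (k + 1). \<exists>L \<in> nsets {1..n} (k + 1).
             X \<subseteq> K \<inter> L \<and> card (K \<inter> L) \<ge> t + 2 \<and>
             \<F> = H_family n k X K L \<and> \<G> = H_family n k X L K)))
     \<and>
     (k \<le> 2 * t + 1 \<longrightarrow>
        card \<F> * card \<G> \<le> (card (A_std n k t))^2 \<and>
        (card \<F> * card \<G> = (card (A_std n k t))^2 \<longleftrightarrow>
          (\<exists>Z \<in> nsets {1..n} (t + 2). \<F> = A_family n k t Z \<and> \<G> = A_family n k t Z)))"
proof -
  interpret params n k t by unfold_locales (use assms(1-3) in auto)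
  \<comment> \<open>Enlarging \<F> first, and then \<G> relative to \<F>', reaches a maximal pair:
    since \<G> \<subseteq> \<G>', a set compatible with \<G>' is already in \<F>'. A t-cover of the
    larger family covers the smaller one, so nontriviality persists.\<close>
  define \<F>' where "\<F>' = {A \<in> nsets {1..n} k. \<forall>B\<in>\<G>. t \<le> card (A \<inter> B)}"
  define \<G>' where "\<G>' = {B \<in> nsets {1..n} k. \<forall>A\<in>\<F>'. t \<le> card (A \<inter> B)}"
  have sub: "\<F> \<subseteq> \<F>'" "\<G> \<subseteq> \<G>'"
    using assms(4-6) by (auto simp: \<F>'_def \<G>'_def cross_intersecting_def)
  have tn: "t \<le> n" using t_less_n by simp
  interpret closed_pair n k t \<F>' \<G>'
  proof
    show "\<F>' \<subseteq> nsets {1..n} k" "\<G>' \<subseteq> nsets {1..n} k" by (auto simp: \<F>'_def \<G>'_def)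
    show "cross_intersecting t \<F>' \<G>'" by (auto simp: \<G>'_def cross_intersecting_def)
    show "A \<in> \<F>'" if "A \<in> nsets {1..n} k" "\<forall>B\<in>\<G>'. t \<le> card (A \<inter> B)" for A
      using that sub by (auto simp: \<F>'_def)
    show "B \<in> \<G>'" if "B \<in> nsets {1..n} k" "\<forall>A\<in>\<F>'. t \<le> card (A \<inter> B)" for B
      using that by (auto simp: \<G>'_def)
    show "\<not> t_cover t \<F>' T" if "finite T" "card T \<le> t" for T
      using not_t_cover_if_common_part[OF assms(4,7) tn that] sub by (auto simp: t_cover_def)
    show "\<not> t_cover t \<G>' T" if "finite T" "card T \<le> t" for T
      using not_t_cover_if_common_part[OF assms(5,8) tn that] sub by (auto simp: t_cover_def)
  qed
  have le: "card \<F> \<le> card \<F>'" "card \<G> \<le> card \<G>'"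
    using card_mono[OF FG_finite(1) sub(1)] card_mono[OF FG_finite(2) sub(2)] by auto
  then have prod: "card \<F> * card \<G> \<le> card \<F>' * card \<G>'" by (rule mult_le_mono)
  \<comment> \<open>The enlarged families have h members each, so a product h^2 leaves no room for
    the enlargement to have added anything.\<close>
  have equal: "\<F> = \<F>' \<and> \<G> = \<G>'"
    if "card \<F>' = h" "card \<G>' = h" "card \<F> * card \<G> = h\<^sup>2" "0 < h" for h
  proof -
    have "card \<F> = h \<and> card \<G> = h" using that le by (intro mult_eq_square_imp_eq) auto
    then show ?thesis
      using card_subset_eq[OF FG_finite(1) sub(1)] card_subset_eq[OF FG_finite(2) sub(2)] that by auto
  qed
  have H_std: "card (H_std n k t) = card_H"
    unfolding H_std_def using t_less_n kt by (intro card_H_family) (auto simp: nsets_def)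
  have A_std: "card (A_std n k t) = card_A"
    unfolding A_std_def using t_less_n kt by (intro card_A_family) (auto simp: nsets_def)
  have hpos: "0 < card_H" using t2 by (simp add: card_H_def)
  show ?thesis
  proof (intro conjI impI)
    assume k: "k \<ge> 2 * t + 2"
    then have m3: "t + 3 \<le> m" by (simp add: m_def)
    then have target: "target = card_H" by (simp add: target_def)
    have cases: "card \<F>' * card \<G>' < card_H\<^sup>2 \<or> H_form"
      using less_target_or_form m3 target by auto
    then show "card \<F> * card \<G> \<le> (card (H_std n k t))\<^sup>2"
      using prod H_form_card unfolding H_std by (auto simp: power2_eq_square)
    show "card \<F> * card \<G> = (card (H_std n k t))\<^sup>2 \<longleftrightarrow>
          (\<exists>X \<in> nsets {1..n} t. \<exists>K \<in> nsets {1..n} (k + 1). \<exists>L \<in> nsets {1..n} (k + 1).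
             X \<subseteq> K \<inter> L \<and> card (K \<inter> L) \<ge> t + 2 \<and>
             \<F> = H_family n k X K L \<and> \<G> = H_family n k X L K)" (is "_ \<longleftrightarrow> ?R")
    proof
      assume eq: "card \<F> * card \<G> = (card (H_std n k t))\<^sup>2"
      then have H_form using cases prod unfolding H_std by linarith
      with equal[of card_H] eq H_form_card hpos H_std show ?R unfolding H_form_def by auto
    next
      assume ?R
      then show "card \<F> * card \<G> = (card (H_std n k t))\<^sup>2"
        unfolding H_std using card_H_family by (auto simp: power2_eq_square)
    qed
  next
    assume k: "k \<le> 2 * t + 1"
    then have m2: "m \<le> t + 2" using kt by (simp add: m_def)
    then have target: "target = card_A" by (simp add: target_def)
    have cases: "card \<F>' * card \<G>' < card_A\<^sup>2 \<or> A_form"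
      using less_target_or_form m2 target by auto
    then show "card \<F> * card \<G> \<le> (card (A_std n k t))\<^sup>2"
      using prod A_form_card unfolding A_std by (auto simp: power2_eq_square)
    show "card \<F> * card \<G> = (card (A_std n k t))\<^sup>2 \<longleftrightarrow>
          (\<exists>Z \<in> nsets {1..n} (t + 2). \<F> = A_family n k t Z \<and> \<G> = A_family n k t Z)" (is "_ \<longleftrightarrow> ?R")
    proof
      assume eq: "card \<F> * card \<G> = (card (A_std n k t))\<^sup>2"
      then have A_form using cases prod unfolding A_std by linarith
      moreover have "0 < card_A" using card_H_less_card_A[OF m2] by simp
      ultimately show ?R using equal[of card_A] eq A_form_card A_std unfolding A_form_def by auto
    next
      assume ?R
      then show "card \<F> * card \<G> = (card (A_std n k t))\<^sup>2"
        unfolding A_std using card_A_family by (auto simp: power2_eq_square)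
    qed
  qed
qed

end
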